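(* Let $0<\beta\le 1$, $0<p\le1$, $1<q<\infty$, $\alpha\in\mathbb R$, and let $w_1\in A_{q_1}$ and $w_2\in A_{q_2}$ be weights on $\mathbb R^n$. If $1\le q_1<\infty$, $1\le q_2\le q$ and $\alpha q_1=n(1-q_2/q)$, then the intrinsic square function $\mathcal S_\beta$ is bounded from $\dot K^{\alpha,p}_q(w_1,w_2)$ into $W\dot K^{\alpha,p}_q(w_1,w_2)$ and from $K^{\alpha,p}_q(w_1,w_2)$ into $WK^{\alpha,p}_q(w_1,w_2)$; that is, there is a constant $C>0$ independent of $f$ such that $$\|\mathcal S_\beta(f)\|_{W\dot K^{\alpha,p}_q(w_1,w_2)}\le C\|f\|_{\dot K^{\alpha,p}_q(w_1,w_2)}\quad\text{for all } f\in\dot K^{\alpha,p}_q(w_1,w_2),$$ and $$\|\mathcal S_\beta(f)\|_{WK^{\alpha,p}_q(w_1,w_2)}\le C\|f\|_{K^{\alpha,p}_q(w_1,w_2)}\quad\text{for all } f\in K^{\alpha,p}_q(w_1,w_2).$$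
   Context: **Weights.** A weight $w$ is a nonnegative, locally integrable function on $\mathbb R^n$, not identically zero (a.e.); $w(E)=\int_E w(x)\,dx$. For $1<s<\infty$, $w\in A_s$ means there is $C>0$ such that for every ball $B\subseteq\mathbb R^n$, $\big(\frac1{|B|}\int_B w\,dx\big)\big(\frac1{|B|}\int_B w^{-1/(s-1)}\,dx\big)^{s-1}\le C$; $w\in A_1$ means there is $C>0$ with $\frac1{|B|}\int_B w\,dx\le C\,\operatorname{ess\,inf}_{x\in B}w(x)$ for every ball $B$. $\|f\|_{L^q_w}=\big(\int_{\mathbb R^n}|f|^q w\,dx\big)^{1/q}$. **Weighted Herz spaces.** Let $B_k=\{x\in\mathbb R^n:|x|\le 2^k\}$, $C_k=B_k\setminus B_{k-1}$ for $k\in\mathbb Z$, $\chi_k=\chi_{C_k}$ (characteristic function), $\widetilde\chi_k=\chi_k$ for integers $k\ge1$ and $\widetilde\chi_0=\chi_{B_0}$. The homogeneous space $\dot K^{\alpha,p}_q(w_1,w_2)$ consists of all $f\in L^q_{loc}(\mathbb R^n\setminus\{0\},w_2)$ with $$\|f\|_{\dot K^{\alpha,p}_q(w_1,w_2)}=\Big(\sum_{k\in\mathbb Z}[w_1(B_k)]^{\alpha p/n}\|f\chi_k\|_{L^q_{w_2}}^p\Big)^{1/p}<\infty,$$ and the non-homogeneous space $K^{\alpha,p}_q(w_1,w_2)$ consists of all $f\in L^q_{loc}(\mathbb R^n,w_2)$ with $$\|f\|_{K^{\alpha,p}_q(w_1,w_2)}=\Big(\sum_{k=0}^\infty[w_1(B_k)]^{\alpha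 p/n}\|f\widetilde\chi_k\|_{L^q_{w_2}}^p\Big)^{1/p}<\infty.$$ **Weighted weak Herz spaces.** For $\sigma>0$ and measurable $f$, let $E_k(\sigma,f)=\{x\in C_k:|f(x)|>\sigma\}$ for $k\in\mathbb Z$, $\widetilde E_k(\sigma,f)=E_k(\sigma,f)$ for integers $k\ge1$, and $\widetilde E_0(\sigma,f)=\{x\in B_0:|f(x)|>\sigma\}$. The spaces $W\dot K^{\alpha,p}_q(w_1,w_2)$ and $WK^{\alpha,p}_q(w_1,w_2)$ consist of the measurable $f$ for which, respectively, $$\|f\|_{W\dot K^{\alpha,p}_q(w_1,w_2)}=\sup_{\sigma>0}\sigma\Big(\sum_{k\in\mathbb Z}[w_1(B_k)]^{\alpha p/n}[w_2(E_k(\sigma,f))]^{p/q}\Big)^{1/p}<\infty,$$ $$\|f\|_{WK^{\alpha,p}_q(w_1,w_2)}=\sup_{\sigma>0}\sigma\Big(\sum_{k=0}^\infty[w_1(B_k)]^{\alpha p/n}[w_2(\widetilde E_k(\sigma,f))]^{p/q}\Big)^{1/p}<\infty.$$ **Intrinsic square function.** For $0<\beta\le1$, $\mathcal C_\beta$ is the family of functions $\varphi$ on $\mathbb R^n$ with support contained in $\{|x|\le1\}$, $\int_{\mathbb R^n}\varphi\,dx=0$, and $|\varphi(x)-\varphi(x')|\le|x-x'|^\beta$ for all $x,x'\in\mathbb R^n$. With $\varphi_t(x)=t^{-n}\varphi(x/t)$, for $f\in L^1_{loc}(\mathbb R^n)$ and $(y,t)\in\mathbb R^{n+1}_+=\mathbb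 R^n\times(0,\infty)$ put $A_\beta(f)(y,t)=\sup_{\varphi\in\mathcal C_\beta}|f*\varphi_t(y)|$. With $\Gamma(x)=\{(y,t)\in\mathbb R^{n+1}_+:|x-y|<t\}$, $$\mathcal S_\beta(f)(x)=\Big(\iint_{\Gamma(x)}\big(A_\beta(f)(y,t)\big)^2\frac{dy\,dt}{t^{n+1}}\Big)^{1/2}.$$ *)

theory Defs
  imports "HOL-Analysis.Analysis"
begin

text \<open>
  The space $R^n$ is \<^typ>\<open>real ^ 'n\<close>, with n = \<^term>\<open>CARD('n)\<close>. Norms, weighted measures and
  the square function take values in \<^typ>\<open>ennreal\<close>, since each of them may be infinite.
\<close>

text \<open>
  Real powers of extended nonnegative reals: $0^r = \infty$ and $\infty^r = 0$ for r < 0. The function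
  \<^const>\<open>powr\<close> cannot be used for this purpose, because \<^term>\<open>0 powr r = (0::real)\<close> for every r.
\<close>

definition epowr :: "ennreal \<Rightarrow> real \<Rightarrow> ennreal" where
  "epowr x r =
    (if r = 0 then 1
     else if x = 0 then (if r < 0 then \<infinity> else 0)
     else if x = \<infinity> then (if r < 0 then 0 else \<infinity>)
     else ennreal (enn2real x powr r))"

section \<open>Weights\<close>

definition is_weight :: "(real ^ 'n \<Rightarrow> real) \<Rightarrow> bool" where
  "is_weight w \<longleftrightarrow>
     w \<in> borel_measurable lebesgue \<and> (\<forall>x. 0 \<le> w x) \<and>
     (\<forall>K. compact K \<longrightarrow> set_integrable lebesgue K w) \<and>
     \<not> (AE x in lebesgue. w x = 0)"

definition wmeas :: "(real ^ 'n \<Rightarrow> real) \<Rightarrow> (real ^ 'n) set \<Rightarrow> ennreal" where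
  "wmeas w E = (\<integral>\<^sup>+x\<in>E. ennreal (w x) \<partial>lebesgue)"

definition average :: "(real ^ 'n) set \<Rightarrow> (real ^ 'n \<Rightarrow> ennreal) \<Rightarrow> ennreal" where
  "average B g = (\<integral>\<^sup>+x\<in>B. g x \<partial>lebesgue) / emeasure lebesgue B"

definition ess_inf_on :: "(real ^ 'n) set \<Rightarrow> (real ^ 'n \<Rightarrow> ennreal) \<Rightarrow> ennreal" where
  "ess_inf_on B g = Sup {c. AE x in lebesgue. x \<in> B \<longrightarrow> c \<le> g x}"

text \<open>The Muckenhoupt class $A_s$, meaningful for $1 \le s < \infty$ only.
  For s > 1 the left-hand side is 0 by the convention $0 \cdot \infty = 0$ on a ball where w vanishes almost
  everywhere. This does not weaken the condition: since w is not almost everywhere zero, a larger ball then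
  violates it, so that w is positive almost everywhere.\<close>

definition muckenhoupt :: "real \<Rightarrow> (real ^ 'n \<Rightarrow> real) set" where
  "muckenhoupt s = {w. is_weight w \<and>
     (if s = 1 then
        \<exists>C>0. \<forall>z. \<forall>r>0.
          average (ball z r) (\<lambda>x. ennreal (w x))
            \<le> ennreal C * ess_inf_on (ball z r) (\<lambda>x. ennreal (w x))
      else
        \<exists>C>0. \<forall>z. \<forall>r>0.
          average (ball z r) (\<lambda>x. ennreal (w x)) *
          epowr (average (ball z r) (\<lambda>x. epowr (ennreal (w x)) (- 1 / (s - 1)))) (s - 1)
            \<le> ennreal C)}"

definition Lq_norm :: "real \<Rightarrow> (real ^ 'n \<Rightarrow> real) \<Rightarrow> (real ^ 'n \<Rightarrow> complex) \<Rightarrow> ennreal" where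
  "Lq_norm q w f =
     epowr (\<integral>\<^sup>+x. ennreal (norm (f x) powr q) * ennreal (w x) \<partial>lebesgue) (1 / q)"

definition Lq_loc :: "(real ^ 'n) set \<Rightarrow> real \<Rightarrow> (real ^ 'n \<Rightarrow> real) \<Rightarrow> (real ^ 'n \<Rightarrow> complex) set" where
  "Lq_loc U q w = {f. f \<in> borel_measurable lebesgue \<and>
     (\<forall>K. compact K \<and> K \<subseteq> U \<longrightarrow> Lq_norm q w (\<lambda>x. indicator K x * f x) < \<infinity>)}"

section \<open>Weighted Herz spaces\<close>

definition Bk :: "int \<Rightarrow> (real ^ 'n) set" where
  "Bk k = {x. norm x \<le> 2 powi k}"

definition Ck :: "int \<Rightarrow> (real ^ 'n) set" where
  "Ck k = Bk k - Bk (k - 1)"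

definition Ck_tilde :: "nat \<Rightarrow> (real ^ 'n) set" where
  "Ck_tilde k = (if k = 0 then Bk 0 else Ck (int k))"

definition herz_norm_hom ::
  "real \<Rightarrow> real \<Rightarrow> real \<Rightarrow> (real ^ 'n \<Rightarrow> real) \<Rightarrow> (real ^ 'n \<Rightarrow> real) \<Rightarrow> (real ^ 'n \<Rightarrow> complex) \<Rightarrow> ennreal"
where
  "herz_norm_hom \<alpha> p q w1 w2 f =
     epowr (\<Sum>\<^sub>\<infinity>k\<in>(UNIV :: int set).
              epowr (wmeas w1 (Bk k)) (\<alpha> * p / real CARD('n)) *
              epowr (Lq_norm q w2 (\<lambda>x. f x * indicator (Ck k) x)) p) (1 / p)"

definition herz_norm ::
  "real \<Rightarrow> real \<Rightarrow> real \<Rightarrow> (real ^ 'n \<Rightarrow> real) \<Rightarrow> (real ^ 'n \<Rightarrow> real) \<Rightarrow> (real ^ 'n \<Rightarrow> complex) \<Rightarrow> ennreal"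
where
  "herz_norm \<alpha> p q w1 w2 f =
     epowr (\<Sum>k. epowr (wmeas w1 (Bk (int k))) (\<alpha> * p / real CARD('n)) *
                 epowr (Lq_norm q w2 (\<lambda>x. f x * indicator (Ck_tilde k) x)) p) (1 / p)"

definition herz_space_hom ::
  "real \<Rightarrow> real \<Rightarrow> real \<Rightarrow> (real ^ 'n \<Rightarrow> real) \<Rightarrow> (real ^ 'n \<Rightarrow> real) \<Rightarrow> (real ^ 'n \<Rightarrow> complex) set"
where
  "herz_space_hom \<alpha> p q w1 w2 =
     {f \<in> Lq_loc (- {0}) q w2. herz_norm_hom \<alpha> p q w1 w2 f < \<infinity>}"

definition herz_space ::
  "real \<Rightarrow> real \<Rightarrow> real \<Rightarrow> (real ^ 'n \<Rightarrow> real) \<Rightarrow> (real ^ 'n \<Rightarrow> real) \<Rightarrow> (real ^ 'n \<Rightarrow> complex) set"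
where
  "herz_space \<alpha> p q w1 w2 =
     {f \<in> Lq_loc UNIV q w2. herz_norm \<alpha> p q w1 w2 f < \<infinity>}"

section \<open>Weighted weak Herz spaces\<close>

text \<open>
  The weak spaces are applied to the square function, which a priori may be infinite somewhere, so
  their elements are extended real functions.
\<close>

definition weak_herz_norm_hom ::
  "real \<Rightarrow> real \<Rightarrow> real \<Rightarrow> (real ^ 'n \<Rightarrow> real) \<Rightarrow> (real ^ 'n \<Rightarrow> real) \<Rightarrow> (real ^ 'n \<Rightarrow> ereal) \<Rightarrow> ennreal"
where
  "weak_herz_norm_hom \<alpha> p q w1 w2 f =
     (SUP \<sigma>\<in>{0<..}. ennreal \<sigma> *
        epowr (\<Sum>\<^sub>\<infinity>k\<in>(UNIV :: int set).
                 epowr (wmeas w1 (Bk k)) (\<alpha> * p / real CARD('n)) *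
                 epowr (wmeas w2 {x \<in> Ck k. \<bar>f x\<bar> > ereal \<sigma>}) (p / q)) (1 / p))"

definition weak_herz_norm ::
  "real \<Rightarrow> real \<Rightarrow> real \<Rightarrow> (real ^ 'n \<Rightarrow> real) \<Rightarrow> (real ^ 'n \<Rightarrow> real) \<Rightarrow> (real ^ 'n \<Rightarrow> ereal) \<Rightarrow> ennreal"
where
  "weak_herz_norm \<alpha> p q w1 w2 f =
     (SUP \<sigma>\<in>{0<..}. ennreal \<sigma> *
        epowr (\<Sum>k. epowr (wmeas w1 (Bk (int k))) (\<alpha> * p / real CARD('n)) *
                    epowr (wmeas w2 {x \<in> Ck_tilde k. \<bar>f x\<bar> > ereal \<sigma>}) (p / q)) (1 / p))"

definition weak_herz_space_hom ::
  "real \<Rightarrow> real \<Rightarrow> real \<Rightarrow> (real ^ 'n \<Rightarrow> real) \<Rightarrow> (real ^ 'n \<Rightarrow> real) \<Rightarrow> (real ^ 'n \<Rightarrow> ereal) set"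
where
  "weak_herz_space_hom \<alpha> p q w1 w2 =
     {f \<in> borel_measurable lebesgue. weak_herz_norm_hom \<alpha> p q w1 w2 f < \<infinity>}"

definition weak_herz_space ::
  "real \<Rightarrow> real \<Rightarrow> real \<Rightarrow> (real ^ 'n \<Rightarrow> real) \<Rightarrow> (real ^ 'n \<Rightarrow> real) \<Rightarrow> (real ^ 'n \<Rightarrow> ereal) set"
where
  "weak_herz_space \<alpha> p q w1 w2 =
     {f \<in> borel_measurable lebesgue. weak_herz_norm \<alpha> p q w1 w2 f < \<infinity>}"

section \<open>The intrinsic square function\<close>

text \<open>
  The convolution is a Bochner integral, which defaults to 0 for non-integrable functions; the
  square function is meant for locally integrable f.\<close>

definition test_family :: "real \<Rightarrow> (real ^ 'n \<Rightarrow> complex) set" where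
  "test_family \<beta> = {\<phi>. closure {x. \<phi> x \<noteq> 0} \<subseteq> {x. norm x \<le> 1} \<and>
     (LINT x|lebesgue. \<phi> x) = 0 \<and>
     (\<forall>x x'. norm (\<phi> x - \<phi> x') \<le> norm (x - x') powr \<beta>)}"

definition dilate :: "real \<Rightarrow> (real ^ 'n \<Rightarrow> complex) \<Rightarrow> real ^ 'n \<Rightarrow> complex" where
  "dilate t \<phi> x = (1 / t ^ CARD('n)) *\<^sub>R \<phi> (x /\<^sub>R t)"

definition convolve ::
  "(real ^ 'n \<Rightarrow> complex) \<Rightarrow> (real ^ 'n \<Rightarrow> complex) \<Rightarrow> real ^ 'n \<Rightarrow> complex" where
  "convolve f g y = (LINT z|lebesgue. f z * g (y - z))"

definition A_max :: "real \<Rightarrow> (real ^ 'n \<Rightarrow> complex) \<Rightarrow> real ^ 'n \<Rightarrow> real \<Rightarrow> ennreal" where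
  "A_max \<beta> f y t = (SUP \<phi>\<in>test_family \<beta>. ennreal (norm (convolve f (dilate t \<phi>) y)))"

definition cone :: "real ^ 'n \<Rightarrow> ((real ^ 'n) \<times> real) set" where
  "cone x = {(y, t). t > 0 \<and> norm (x - y) < t}"

definition intrinsic_square :: "real \<Rightarrow> (real ^ 'n \<Rightarrow> complex) \<Rightarrow> real ^ 'n \<Rightarrow> ennreal" where
  "intrinsic_square \<beta> f x =
     epowr (\<integral>\<^sup>+z\<in>cone x. (case z of (y, t) \<Rightarrow>
              (A_max \<beta> f y t)\<^sup>2 / ennreal (t ^ (CARD('n) + 1))) \<partial>lebesgue) (1 / 2)"

end

theory Submission
  imports Defs
begin

text \<open>
  The cone integral defining the square function is dominated by a sum over dyadic cubes Q of
  \<open>|\<langle>f, \<phi>\<^sub>Q\<rangle>|\<^sup>2\<close> times a bump supported near Q, where \<open>\<phi>\<^sub>Q\<close> is an almost extremal test function at the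
  position and scale of Q; for fixed f this is the square of a linear operator D.
  On a set F where all averages of \<open>|g|\<close> are at most A, almost orthogonality gives
  \<open>\<integral>\<^sub>F (D g)\<^sup>2 \<le> C A \<parallel>g\<parallel>\<^sub>1\<close>; this single estimate plays the role of both the \<open>L\<^sup>2\<close> bound and the
  weak (1,1) bound. A good-lambda inequality between the levels s and (1 + \<eta>)s, with \<eta> small, then
  yields the weighted weak type (q,q) for \<open>A\<^sub>q\<close> weights: because \<eta> is small, no reverse
  Hoelder inequality is needed. Finally, on the annulus with index k the function is split into the
  neighbouring annuli, controlled by the weak type estimate, and the rest, controlled pointwise. At the
  critical \<alpha> the inner annuli contribute at most a constant multiple of
  the Herz norm divided by \<open>z\<^sub>k\<close>, the product of the powers \<open>\<alpha>/n\<close> and \<open>1/q\<close> of the weights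
  \<open>w\<^sub>1(B\<^sub>k)\<close> and \<open>w\<^sub>2(B\<^sub>k)\<close>. Since \<open>z\<^sub>k\<close> grows geometrically, the sum over the k that reach a given level
  is dominated by its largest term.
\<close>

section \<open>The dyadic grid\<close>

text \<open>The supremum in \<open>A_max\<close> makes the square function nonlinear, and the
  functions \<open>\<phi>\<close> that linearise it depend on f. The constants of the locale
  \<open>adapted_family\<close> therefore never involve \<open>\<phi>\<close>; this is what makes
  the final bounds uniform in f. On the side of the weights the obstacle is the critical exponent.
  From annulus i to a larger annulus k the kernel decays like 2^(-n(k - i)), while z_k may grow like
  2^(n(k - i)), because the growth exponents of the two weights, in units of n, add up to \<alpha>
  q1 / n + q2 / q = 1. The two factors cancel, so the inner annuli leave no decay in k that could be
  summed, and the level has to be fixed before the sum over k is taken. The outer annuli are treated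
  by Chebyshev's inequality with exponent p. There p \<le> 1 enters through the embedding of l^p
  into l^1; for the neighbouring annuli it enters through the subadditivity of t^(p/q).\<close>

definition side :: "int \<times> (int ^ 'n) \<Rightarrow> real" where
  "side Q = 2 powi fst Q"

definition center :: "int \<times> (int ^ 'n) \<Rightarrow> real ^ 'n" where
  "center Q = (\<chi> i. 2 powi fst Q * of_int (snd Q $ i))"

lemma side_pos [simp]: "0 < side Q"
  by (simp add: side_def)

lemma side_nonneg [simp]: "0 \<le> side Q" "side Q \<noteq> 0"
  by (simp_all add: side_def)

lemma dyadic_center_separated:
  assumes "fst Q = fst Q'" "Q \<noteq> Q'"
  shows "side Q \<le> dist (center Q) (center Q')"
proof -
  obtain i where i: "snd Q $ i \<noteq> snd Q' $ i"
    using assms by (auto simp: prod_eq_iff vec_eq_iff)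
  have "side Q * 1 \<le> side Q * \<bar>of_int (snd Q $ i - snd Q' $ i)\<bar>"
  proof (rule mult_left_mono)
    have "1 \<le> \<bar>snd Q $ i - snd Q' $ i\<bar>" using i by linarith
    then show "1 \<le> \<bar>real_of_int (snd Q $ i - snd Q' $ i)\<bar>" by linarith
  qed simp
  also have "\<dots> = \<bar>(center Q - center Q') $ i\<bar>"
    using assms(1) by (simp add: center_def side_def abs_mult flip: right_diff_distrib)
  also have "\<dots> \<le> dist (center Q) (center Q')"
    unfolding dist_norm by (rule component_le_norm_cart)
  finally show ?thesis by simp
qed

text \<open>Packing by volume: the balls of half the side around the centers are disjoint and, since
  the side is at most L, lie in the ball of radius 2L around x.\<close>

lemma card_dyadic_centers_le:
  fixes G :: "(int \<times> (int ^ 'n)) set" and x :: "real ^ 'n"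
  assumes "finite G" and G: "\<And>Q. Q \<in> G \<Longrightarrow> fst Q = k \<and> dist x (center Q) \<le> L"
    and L: "2 powi k \<le> L"
  shows "real (card G) \<le> (4 * L / 2 powi k) ^ CARD('n)"
proof -
  define s :: real where "s = 2 powi k"
  have s: "0 < s" "s \<le> L" using L by (auto simp: s_def)
  let ?B = "\<lambda>Q. ball (center Q) (s / 2) :: (real ^ 'n) set"
  have sep: "s \<le> dist (center Q) (center Q')" if "Q \<in> G" "Q' \<in> G" "Q \<noteq> Q'" for Q Q' :: "int \<times> (int ^ 'n)"
    using dyadic_center_separated[of Q Q'] G[OF that(1)] G[OF that(2)] that(3)
    by (simp add: s_def side_def)
  have disj: "disjoint_family_on ?B G"
    unfolding disjoint_family_on_def
  proof (intro ballI impI)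
    fix Q Q' assume "Q \<in> G" "Q' \<in> G" "Q \<noteq> Q'"
    with sep have "s / 2 + s / 2 \<le> dist (center Q) (center Q')" by auto
    then show "?B Q \<inter> ?B Q' = {}" by (rule disjoint_ballI)
  qed
  have "(\<Sum>Q\<in>G. measure lebesgue (?B Q)) = measure lebesgue (\<Union>Q\<in>G. ?B Q)"
    using \<open>finite G\<close> disj s by (intro measure_finite_Union[symmetric]) (auto simp: emeasure_ball)
  also have "\<dots> \<le> measure lebesgue (ball x (2 * L))"
  proof (rule measure_mono_fmeasurable)
    show "(\<Union>Q\<in>G. ?B Q) \<subseteq> ball x (2 * L)"
    proof (intro UN_least subsetI)
      fix Q z assume Q: "Q \<in> G" and "z \<in> ?B Q"
      then have "dist x z < L + s / 2"
        using G[OF Q] dist_triangle[of x z "center Q"] by simp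
      then show "z \<in> ball x (2 * L)" using s by simp
    qed
  qed (use \<open>finite G\<close> in auto)
  finally have "real (card G) * (unit_ball_vol (real CARD('n)) * (s / 2) ^ CARD('n))
      \<le> unit_ball_vol (real CARD('n)) * (2 * L) ^ CARD('n)"
    using s by (simp add: content_ball)
  then have "real (card G) * (s / 2) ^ CARD('n) \<le> (2 * L) ^ CARD('n)"
    by (simp add: mult.left_commute)
  then have "real (card G) \<le> (2 * L) ^ CARD('n) / (s / 2) ^ CARD('n)"
    using s by (simp add: pos_le_divide_eq)
  also have "\<dots> = (2 * L / (s / 2)) ^ CARD('n)"
    by (simp only: power_divide)
  finally have "real (card G) \<le> (4 * L / s) ^ CARD('n)"
    by simp
  then show ?thesis by (simp add: s_def)
qed

section \<open>Sums of powers of the side over dyadic cubes, scale by scale\<close>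

lemma sum_geometric_int_le:
  fixes b :: real
  assumes "finite K" "0 \<le> b" "b < 1" "\<And>k. k \<in> K \<Longrightarrow> k0 \<le> k"
  shows "(\<Sum>k\<in>K. b ^ nat (k - k0)) \<le> 1 / (1 - b)"
proof -
  have "inj_on (\<lambda>k. nat (k - k0)) K"
    using assms(4) by (auto simp: inj_on_def eq_nat_nat_iff)
  then have "(\<Sum>k\<in>K. b ^ nat (k - k0)) = (\<Sum>i\<in>(\<lambda>k. nat (k - k0)) ` K. b ^ i)"
    by (simp add: sum.reindex)
  also have "\<dots> \<le> (\<Sum>i. b ^ i)"
    using assms by (intro sum_le_suminf summable_geometric) auto
  also have "\<dots> = 1 / (1 - b)"
    using assms by (intro suminf_geometric) auto
  finally show ?thesis .
qed

lemma power_nat_eq_powr: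
  fixes \<gamma> :: real
  assumes "i \<le> k" shows "((2::real) powr (- \<gamma>)) ^ nat (k - i) = (2 powi i / 2 powi k) powr \<gamma>"
proof -
  have "2 powi i / 2 powi k = (2::real) powr (real_of_int (i - k))"
    by (simp add: powr_diff flip: powr_real_of_int')
  then have "(2 powi i / 2 powi k) powr \<gamma> = (2::real) powr (real_of_int (i - k) * \<gamma>)"
    by (simp add: powr_powr)
  moreover have "((2::real) powr (- \<gamma>)) ^ nat (k - i) = 2 powr (- \<gamma> * real (nat (k - i)))"
    by (simp add: powr_powr flip: powr_realpow)
  ultimately show ?thesis using assms by (simp add: algebra_simps)
qed

text \<open>The first factor bounds the number of cubes of one scale whose centers lie within R
  sides of a point; the second is the geometric series over the scales.\<close>

definition overlap :: "nat \<Rightarrow> real \<Rightarrow> real \<Rightarrow> real" where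
  "overlap N R \<gamma> = (4 * R) ^ N / (1 - 2 powr (- \<gamma>))"

lemma overlap_nonneg: "0 \<le> R \<Longrightarrow> 0 < \<gamma> \<Longrightarrow> 0 \<le> overlap N R \<gamma>"
  unfolding overlap_def by (intro divide_nonneg_nonneg) (auto simp: powr_less_one less_imp_le)

text \<open>Each scale contributes a bounded number of cubes that see x, so the sum is dominated by
  a geometric series starting at the smallest scale present, whose side is at least r.\<close>

lemma sum_dyadic_large_scales:
  fixes G :: "(int \<times> (int ^ 'n)) set" and x :: "real ^ 'n"
  assumes "finite G" "0 < r" "1 \<le> R" "0 < \<gamma>"
    and G: "\<And>Q. Q \<in> G \<Longrightarrow> r \<le> side Q \<and> dist x (center Q) \<le> R * side Q"
  shows "(\<Sum>Q\<in>G. (r / side Q) powr \<gamma>) \<le> overlap CARD('n) R \<gamma>"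
proof (cases "G = {}")
  case True
  have "2 powr (- \<gamma>) < (1::real)" using \<open>0 < \<gamma>\<close> by (simp add: powr_less_one)
  then show ?thesis using True \<open>1 \<le> R\<close> by (simp add: overlap_def)
next
  case False
  define b :: real where "b = 2 powr (- \<gamma>)"
  have b: "0 \<le> b" "b < 1" using \<open>0 < \<gamma>\<close> by (auto simp: b_def powr_less_one)
  define k0 where "k0 = Min (fst ` G)"
  have k0: "k0 \<le> fst Q" if "Q \<in> G" for Q using that \<open>finite G\<close> by (auto simp: k0_def)
  have "k0 \<in> fst ` G" unfolding k0_def using \<open>finite G\<close> False by (intro Min_in) auto
  then have rk0: "r \<le> 2 powi k0" using G by (auto simp: side_def)
  have inner: "(\<Sum>Q\<in>{Q\<in>G. fst Q = k}. (r / side Q) powr \<gamma>) \<le> (4 * R) ^ CARD('n) * b ^ nat (k - k0)"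
    if "k \<in> fst ` G" for k
  proof -
    have "(\<Sum>Q\<in>{Q\<in>G. fst Q = k}. (r / side Q) powr \<gamma>)
        = real (card {Q\<in>G. fst Q = k}) * (r / 2 powi k) powr \<gamma>"
      by (simp add: side_def)
    also have "\<dots> \<le> (4 * R) ^ CARD('n) * b ^ nat (k - k0)"
    proof (rule mult_mono)
      have "real (card {Q\<in>G. fst Q = k}) \<le> (4 * (R * 2 powi k) / 2 powi k) ^ CARD('n)"
        using assms by (intro card_dyadic_centers_le[of _ _ x]) (auto simp: side_def)
      then show "real (card {Q\<in>G. fst Q = k}) \<le> (4 * R) ^ CARD('n)" by simp
      have "(r / 2 powi k) powr \<gamma> \<le> (2 powi k0 / 2 powi k) powr \<gamma>"
        using assms rk0 by (intro powr_mono2 divide_right_mono) auto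
      also have "\<dots> = b ^ nat (k - k0)"
        unfolding b_def using that k0 by (intro power_nat_eq_powr[symmetric]) auto
      finally show "(r / 2 powi k) powr \<gamma> \<le> b ^ nat (k - k0)" .
    qed (use assms in auto)
    finally show ?thesis .
  qed
  have "(\<Sum>Q\<in>G. (r / side Q) powr \<gamma>)
      = (\<Sum>k\<in>fst ` G. \<Sum>Q\<in>{Q\<in>G. fst Q = k}. (r / side Q) powr \<gamma>)"
    using \<open>finite G\<close> by (rule sum.image_gen)
  also have "\<dots> \<le> (\<Sum>k\<in>fst ` G. (4 * R) ^ CARD('n) * b ^ nat (k - k0))"
    using inner by (rule sum_mono)
  also have "\<dots> = (4 * R) ^ CARD('n) * (\<Sum>k\<in>fst ` G. b ^ nat (k - k0))"
    by (simp add: sum_distrib_left)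
  also have "\<dots> \<le> (4 * R) ^ CARD('n) * (1 / (1 - b))"
    using \<open>finite G\<close> \<open>1 \<le> R\<close> k0 b by (intro mult_left_mono sum_geometric_int_le) auto
  finally show ?thesis by (simp add: b_def overlap_def)
qed

text \<open>Here a scale may contribute a multiple of (L / side)^n cubes. The n in the exponent
  cancels this count, and \<gamma> leaves a geometric series running down from the largest
  scale.\<close>

lemma sum_dyadic_small_scales:
  fixes G :: "(int \<times> (int ^ 'n)) set" and x :: "real ^ 'n"
  assumes "finite G" "0 < L" "1 \<le> R" "0 < \<gamma>"
    and G: "\<And>Q. Q \<in> G \<Longrightarrow> side Q \<le> L \<and> dist x (center Q) \<le> R * L"
  shows "(\<Sum>Q\<in>G. (side Q / L) powr (real CARD('n) + \<gamma>)) \<le> overlap CARD('n) R \<gamma>"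
proof (cases "G = {}")
  case True
  have "2 powr (- \<gamma>) < (1::real)" using \<open>0 < \<gamma>\<close> by (simp add: powr_less_one)
  then show ?thesis using True \<open>1 \<le> R\<close> by (simp add: overlap_def)
next
  case False
  define b :: real where "b = 2 powr (- \<gamma>)"
  have b: "0 \<le> b" "b < 1" using \<open>0 < \<gamma>\<close> by (auto simp: b_def powr_less_one)
  define k0 where "k0 = Max (fst ` G)"
  have k0: "fst Q \<le> k0" if "Q \<in> G" for Q using that \<open>finite G\<close> by (auto simp: k0_def)
  have "k0 \<in> fst ` G" unfolding k0_def using \<open>finite G\<close> False by (intro Max_in) auto
  then have rk0: "2 powi k0 \<le> L" using G by (auto simp: side_def)
  have inner: "(\<Sum>Q\<in>{Q\<in>G. fst Q = k}. (side Q / L) powr (real CARD('n) + \<gamma>))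
      \<le> (4 * R) ^ CARD('n) * b ^ nat (- k - (- k0))"
    if "k \<in> fst ` G" for k
  proof -
    have kL: "2 powi k \<le> L" using that G by (auto simp: side_def)
    have "(\<Sum>Q\<in>{Q\<in>G. fst Q = k}. (side Q / L) powr (real CARD('n) + \<gamma>))
        = real (card {Q\<in>G. fst Q = k}) * (2 powi k / L) powr (real CARD('n) + \<gamma>)"
      by (simp add: side_def)
    also have "\<dots> \<le> (4 * (R * L) / 2 powi k) ^ CARD('n) * (2 powi k / L) powr (real CARD('n) + \<gamma>)"
    proof (rule mult_right_mono)
      have "L \<le> R * L" using assms by simp
      with kL have "2 powi k \<le> R * L" by simp
      then show "real (card {Q\<in>G. fst Q = k}) \<le> (4 * (R * L) / 2 powi k) ^ CARD('n)"
        using assms by (intro card_dyadic_centers_le[of _ _ x]) auto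
    qed auto
    also have "\<dots> = ((4 * (R * L) / 2 powi k) * (2 powi k / L)) ^ CARD('n) * (2 powi k / L) powr \<gamma>"
      using assms by (simp add: powr_add powr_realpow power_divide power_mult_distrib)
    also have "\<dots> = (4 * R) ^ CARD('n) * (2 powi k / L) powr \<gamma>"
    proof -
      have "(4 * (R * L) / 2 powi k) * (2 powi k / L) = 4 * R"
        using assms by simp
      then show ?thesis by (simp only:)
    qed
    also have "\<dots> \<le> (4 * R) ^ CARD('n) * (2 powi k / 2 powi k0) powr \<gamma>"
      using assms rk0 by (intro mult_left_mono powr_mono2 divide_left_mono) auto
    also have "(2 powi k / 2 powi k0) powr \<gamma> = b ^ nat (- k - (- k0))"
      using power_nat_eq_powr[of k k0 \<gamma>] that k0 by (auto simp: b_def)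
    finally show ?thesis .
  qed
  have "(\<Sum>Q\<in>G. (side Q / L) powr (real CARD('n) + \<gamma>))
      = (\<Sum>k\<in>fst ` G. \<Sum>Q\<in>{Q\<in>G. fst Q = k}. (side Q / L) powr (real CARD('n) + \<gamma>))"
    using \<open>finite G\<close> by (rule sum.image_gen)
  also have "\<dots> \<le> (\<Sum>k\<in>fst ` G. (4 * R) ^ CARD('n) * b ^ nat (- k - (- k0)))"
    using inner by (rule sum_mono)
  also have "\<dots> = (4 * R) ^ CARD('n) * (\<Sum>k\<in>uminus ` fst ` G. b ^ nat (k - (- k0)))"
    by (subst sum.reindex) (auto simp: sum_distrib_left)
  also have "\<dots> \<le> (4 * R) ^ CARD('n) * (1 / (1 - b))"
    using \<open>finite G\<close> \<open>1 \<le> R\<close> k0 b by (intro mult_left_mono sum_geometric_int_le) auto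
  finally show ?thesis by (simp add: b_def overlap_def)
qed

section \<open>Adapted families\<close>

lemma sets_lebesgue_ball [measurable, simp]: "ball c r \<in> sets lebesgue" "cball c r \<in> sets lebesgue"
  by auto

lemma hoelder_imp_continuous:
  fixes f :: "'a::metric_space \<Rightarrow> 'b::real_normed_vector"
  assumes "0 < \<beta>" and le: "\<And>x z. norm (f x - f z) \<le> C * dist x z powr \<beta>"
  shows "continuous_on UNIV f"
  unfolding continuous_on_def
proof
  fix x :: 'a
  have "((\<lambda>z. C * dist z x powr \<beta>) \<longlongrightarrow> C * dist x x powr \<beta>) (at x)"
    using assms(1) by (intro tendsto_intros) auto
  then have "((\<lambda>z. C * dist z x powr \<beta>) \<longlongrightarrow> 0) (at x)"
    by simp
  then have "((\<lambda>z. norm (f z - f x)) \<longlongrightarrow> 0) (at x)"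
    by (rule tendsto_sandwich[OF _ _ tendsto_const, rotated 2])
      (intro always_eventually allI le norm_ge_zero)+
  then show "(f \<longlongrightarrow> f x) (at x within UNIV)"
    by (simp add: tendsto_norm_zero_iff LIM_zero_iff)
qed

abbreviation mass :: "('a::euclidean_space \<Rightarrow> complex) \<Rightarrow> 'a set \<Rightarrow> ennreal" where
  "mass f B \<equiv> (\<integral>\<^sup>+y\<in>B. ennreal (norm (f y)) \<partial>lebesgue)"

text \<open>The index Q = (k, m) stands for the dyadic cube of side \<open>2^k\<close> around \<open>2^k m\<close>.\<close>

locale adapted_family =
  fixes \<beta> K R :: real and \<phi> :: "int \<times> (int ^ 'n) \<Rightarrow> real ^ 'n \<Rightarrow> complex"
  assumes \<beta>: "0 < \<beta>" "\<beta> \<le> 1" and K: "0 < K" and R: "1 \<le> R"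
    and supp: "\<And>Q x. R * side Q < dist x (center Q) \<Longrightarrow> \<phi> Q x = 0"
    and mean: "\<And>Q. (LINT x|lebesgue. \<phi> Q x) = 0"
    and hoelder: "\<And>Q x z. norm (\<phi> Q x - \<phi> Q z) \<le> K / side Q ^ CARD('n) * (dist x z / side Q) powr \<beta>"
    and bound: "\<And>Q x. norm (\<phi> Q x) \<le> K / side Q ^ CARD('n)"
begin

lemma continuous_adapted: "continuous_on UNIV (\<phi> Q)"
proof (rule hoelder_imp_continuous[OF \<beta>(1)])
  show "norm (\<phi> Q x - \<phi> Q z) \<le> K / side Q ^ CARD('n) / side Q powr \<beta> * dist x z powr \<beta>" for x z
    using hoelder[of Q x z] by (simp add: powr_divide)
qed

lemma borel_measurable_adapted [measurable]: "\<phi> Q \<in> borel_measurable borel"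
  using continuous_adapted by (rule borel_measurable_continuous_onI)

lemma lebesgue_measurable_adapted [measurable]: "\<phi> Q \<in> borel_measurable lebesgue"
  using borel_measurable_adapted by (simp add: measurable_completion)

lemma adapted_eq_0: "x \<notin> cball (center Q) (R * side Q) \<Longrightarrow> \<phi> Q x = 0"
  by (rule supp) (simp add: dist_commute)

lemma integrable_adapted [simp, intro]: "integrable lebesgue (\<phi> Q)"
proof (rule integrableI_bounded_set)
  show "cball (center Q) (R * side Q) \<in> sets lebesgue" by auto
  show "emeasure lebesgue (cball (center Q) (R * side Q)) < \<infinity>"
    using R by (simp add: emeasure_cball)
  show "AE x\<in>cball (center Q) (R * side Q) in lebesgue. norm (\<phi> Q x) \<le> K / side Q ^ CARD('n)"
    using bound by simp
qed (use adapted_eq_0 in auto)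

lemma integrable_mult_adapted:
  assumes "integrable lebesgue g" shows "integrable lebesgue (\<lambda>x. g x * \<phi> Q x)"
proof (rule Bochner_Integration.integrable_bound)
  note [measurable] = borel_measurable_integrable[OF assms]
  show "integrable lebesgue (\<lambda>x. (K / side Q ^ CARD('n)) *\<^sub>R g x)"
    using assms by (rule integrable_scaleR_right)
  show "AE x in lebesgue. norm (g x * \<phi> Q x) \<le> norm ((K / side Q ^ CARD('n)) *\<^sub>R g x)"
  proof (intro AE_I2)
    fix x
    have "norm (\<phi> Q x) * norm (g x) \<le> K / side Q ^ CARD('n) * norm (g x)"
      by (intro mult_right_mono bound) auto
    then show "norm (g x * \<phi> Q x) \<le> norm ((K / side Q ^ CARD('n)) *\<^sub>R g x)"
      using K by (simp add: norm_mult mult.commute)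
  qed
  show "(\<lambda>x. g x * \<phi> Q x) \<in> borel_measurable lebesgue" by measurable
qed

section \<open>Coefficients against the adapted family, and their bumps\<close>

definition pairing :: "(real ^ 'n \<Rightarrow> complex) \<Rightarrow> int \<times> (int ^ 'n) \<Rightarrow> complex" where
  "pairing g Q = (LINT x|lebesgue. g x * \<phi> Q x)"

text \<open>A Lipschitz cutoff instead of an indicator: its continuity makes the superlevel sets of
  \<open>square_sum\<close> open, and its Lipschitz constant 1 / side measures the loss when the
  point of evaluation is moved in \<open>square_sum_localise\<close>. Support radius R + 1 leaves
  values of at least 1 on the ball of radius R, in units of the side.\<close>

definition bump :: "int \<times> (int ^ 'n) \<Rightarrow> real ^ 'n \<Rightarrow> real" where
  "bump Q x = max 0 (R + 1 - dist x (center Q) / side Q)"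

lemma bump_nonneg [simp]: "0 \<le> bump Q x"
  by (simp add: bump_def)

lemma bump_le: "bump Q x \<le> R + 1"
  using R by (simp add: bump_def)

lemma bump_eq_0: "(R + 1) * side Q \<le> dist x (center Q) \<Longrightarrow> bump Q x = 0"
  by (simp add: bump_def pos_le_divide_eq)

lemma bump_ge_1: "dist x (center Q) \<le> R * side Q \<Longrightarrow> 1 \<le> bump Q x"
  by (simp add: bump_def pos_divide_le_eq le_max_iff_disj)

lemma bump_diff_le: "bump Q x - bump Q z \<le> dist x z / side Q"
proof -
  have "dist z (center Q) / side Q \<le> (dist x z + dist x (center Q)) / side Q"
    using dist_triangle3[of z "center Q" x] by (intro divide_right_mono) (auto simp: dist_commute)
  moreover have "0 \<le> dist x z / side Q"
    by simp
  ultimately show ?thesis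
    unfolding bump_def add_divide_distrib by linarith
qed

lemma continuous_bump: "continuous_on UNIV (bump Q)"
  unfolding bump_def by (intro continuous_intros) auto

lemma borel_measurable_bump [measurable]: "bump Q \<in> borel_measurable borel"
  using continuous_bump by (rule borel_measurable_continuous_onI)

lemma norm_pairing_le:
  assumes [measurable]: "g \<in> borel_measurable lebesgue"
  shows "ennreal (norm (pairing g Q)) \<le>
     ennreal (K / side Q ^ CARD('n)) *
     mass g (cball (center Q) (R * side Q))"
proof (cases "integrable lebesgue (\<lambda>x. g x * \<phi> Q x)")
  case False
  \<comment> \<open>The Bochner integral is 0 by default here, so the bound is trivial.\<close>
  then show ?thesis by (simp add: pairing_def not_integrable_integral_eq)
next
  case True
  have "ennreal (norm (pairing g Q)) \<le> (\<integral>\<^sup>+x. ennreal (norm (g x * \<phi> Q x)) \<partial>lebesgue)"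
    unfolding pairing_def by (rule integral_norm_bound_ennreal[OF True])
  also have "\<dots> \<le> (\<integral>\<^sup>+x. ennreal (K / side Q ^ CARD('n)) *
      (ennreal (norm (g x)) * indicator (cball (center Q) (R * side Q)) x) \<partial>lebesgue)"
  proof (rule nn_integral_mono)
    fix x
    show "ennreal (norm (g x * \<phi> Q x)) \<le> ennreal (K / side Q ^ CARD('n)) *
      (ennreal (norm (g x)) * indicator (cball (center Q) (R * side Q)) x)"
    proof (cases "x \<in> cball (center Q) (R * side Q)")
      case True
      have "norm (g x * \<phi> Q x) \<le> K / side Q ^ CARD('n) * norm (g x)"
        unfolding norm_mult by (subst mult.commute) (intro mult_right_mono bound norm_ge_zero)
      then show ?thesis
        using True K by (simp add: ennreal_mult' ennreal_leI flip: ennreal_mult)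
    qed (simp add: adapted_eq_0)
  qed
  also have "\<dots> = ennreal (K / side Q ^ CARD('n)) *
     mass g (cball (center Q) (R * side Q))"
    by (rule nn_integral_cmult) measurable
  finally show ?thesis .
qed

text \<open>The ball that supports \<open>\<phi> Q\<close> lies in a ball around p of comparable
  radius, so control of the averages centred at the single point p bounds the coefficients of all
  cubes near p.\<close>

lemma norm_pairing_le_maximal:
  assumes "g \<in> borel_measurable lebesgue" "0 \<le> A"
    and A: "\<And>r. 0 < r \<Longrightarrow> mass g (cball p r) \<le> ennreal (A * r ^ CARD('n))"
    and p: "dist p (center Q) \<le> T * side Q" and "0 \<le> T"
  shows "norm (pairing g Q) \<le> K * (T + R) ^ CARD('n) * A"
proof -
  have "ennreal (norm (pairing g Q)) \<le> ennreal (K / side Q ^ CARD('n)) *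
     mass g (cball (center Q) (R * side Q))"
    using assms(1) by (rule norm_pairing_le)
  also have "\<dots> \<le> ennreal (K / side Q ^ CARD('n)) *
     mass g (cball p ((T + R) * side Q))"
  proof -
    have "cball (center Q) (R * side Q) \<subseteq> cball p ((T + R) * side Q)"
      using p by (simp add: cball_subset_cball_iff dist_commute algebra_simps)
    then show ?thesis
      by (intro mult_left_mono nn_integral_mono) (auto simp: indicator_def)
  qed
  also have "\<dots> \<le> ennreal (K / side Q ^ CARD('n)) * ennreal (A * ((T + R) * side Q) ^ CARD('n))"
    using R \<open>0 \<le> T\<close> by (intro mult_left_mono A) auto
  also have "\<dots> = ennreal (K * (T + R) ^ CARD('n) * A)"
    using K R \<open>0 \<le> T\<close> \<open>0 \<le> A\<close> by (simp add: power_mult_distrib flip: ennreal_mult)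
  finally show ?thesis
    using K R \<open>0 \<le> T\<close> \<open>0 \<le> A\<close> by (simp add: ennreal_le_iff)
qed

end

section \<open>Almost orthogonality\<close>

lemma norm_integral_le_measure:
  fixes f :: "'a \<Rightarrow> 'b::{banach, second_countable_topology}"
  assumes "S \<in> fmeasurable M" "\<And>x. norm (f x) \<le> B * indicator S x" "0 \<le> B"
  shows "norm (LINT x|M. f x) \<le> B * measure M S"
proof (cases "integrable M f")
  case True
  have "norm (LINT x|M. f x) \<le> (LINT x|M. B * indicator S x)"
    using assms by (intro order_trans[OF integral_norm_bound] integral_mono integrable_norm True) (auto simp: fmeasurable_def)
  then show ?thesis using assms(1) by (simp add: fmeasurable_def)
qed (use assms in \<open>simp add: not_integrable_integral_eq\<close>)

context adapted_family
begin

lemma dist_centers_le: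
  assumes "\<phi> Q x \<noteq> 0" "\<phi> Q' x \<noteq> 0" "side Q' \<le> side Q"
  shows "dist (center Q) (center Q') \<le> 2 * R * side Q"
proof -
  have "dist x (center Q) \<le> R * side Q" "dist x (center Q') \<le> R * side Q'"
    using assms supp by (meson not_le)+
  moreover have "R * side Q' \<le> R * side Q"
    using assms R by (intro mult_left_mono) auto
  ultimately show ?thesis
    using dist_triangle3[of "center Q" "center Q'" x] by linarith
qed

lemma integrable_adapted_mult: "integrable lebesgue (\<lambda>x. \<phi> Q x * cnj (\<phi> Q' x))"
  using integrable_mult_adapted[of "\<lambda>x. cnj (\<phi> Q' x)" Q] by (simp add: mult.commute)

text \<open>The function of the smaller cube has mean zero, so the value of the other one at
  \<open>center Q'\<close> may be subtracted; Hoelder continuity over the distance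
  \<open>R * side Q'\<close> then yields the gain.\<close>

lemma adapted_almost_orthogonal:
  assumes "side Q' \<le> side Q"
  shows "norm (LINT x|lebesgue. \<phi> Q x * cnj (\<phi> Q' x))
    \<le> K\<^sup>2 * unit_ball_vol (real CARD('n)) * R ^ (CARD('n) + 1) / side Q ^ CARD('n)
       * (side Q' / side Q) powr \<beta>"
proof -
  let ?l = "side Q" and ?l' = "side Q'" and ?c = "center Q'"
  let ?B = "cball ?c (R * ?l')"
  define C where "C = K / ?l ^ CARD('n) * (R * (?l' / ?l) powr \<beta>) * (K / ?l' ^ CARD('n))"
  have "0 \<le> C" using K R by (simp add: C_def)
  have "(LINT x|lebesgue. \<phi> Q ?c * cnj (\<phi> Q' x)) = 0"
    using mean by simp
  then have "(LINT x|lebesgue. \<phi> Q x * cnj (\<phi> Q' x))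
      = (LINT x|lebesgue. \<phi> Q x * cnj (\<phi> Q' x)) - (LINT x|lebesgue. \<phi> Q ?c * cnj (\<phi> Q' x))"
    by simp
  also have "\<dots> = (LINT x|lebesgue. (\<phi> Q x - \<phi> Q ?c) * cnj (\<phi> Q' x))"
    by (subst Bochner_Integration.integral_diff[symmetric]) (auto simp: integrable_adapted_mult left_diff_distrib)
  also have "norm \<dots> \<le> C * measure lebesgue ?B"
  proof (rule norm_integral_le_measure[OF _ _ \<open>0 \<le> C\<close>])
    show "?B \<in> lmeasurable" by simp
    fix x
    show "norm ((\<phi> Q x - \<phi> Q ?c) * cnj (\<phi> Q' x)) \<le> C * indicator ?B x"
    proof (cases "x \<in> ?B")
      case True
      have "(dist x ?c / ?l) powr \<beta> \<le> (R * ?l' / ?l) powr \<beta>"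
        using True \<beta> by (intro powr_mono2 divide_right_mono) (auto simp: dist_commute)
      also have "\<dots> = R powr \<beta> * (?l' / ?l) powr \<beta>"
        using R by (simp flip: powr_mult)
      also have "\<dots> \<le> R powr 1 * (?l' / ?l) powr \<beta>"
        using R \<beta> by (intro mult_right_mono powr_mono) auto
      finally have *: "(dist x ?c / ?l) powr \<beta> \<le> R * (?l' / ?l) powr \<beta>"
        using R by simp
      have "norm (\<phi> Q x - \<phi> Q ?c) * norm (\<phi> Q' x)
          \<le> (K / ?l ^ CARD('n) * (R * (?l' / ?l) powr \<beta>)) * (K / ?l' ^ CARD('n))"
        using K R by (intro mult_mono order_trans[OF hoelder] mult_left_mono * bound) auto
      then show ?thesis using True by (simp add: norm_mult C_def)
    qed (use adapted_eq_0 in auto)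
  qed
  also have "measure lebesgue ?B = unit_ball_vol (real CARD('n)) * (R * ?l') ^ CARD('n)"
    using R by (simp add: content_cball)
  also have "C * \<dots> = K\<^sup>2 * unit_ball_vol (real CARD('n)) * R ^ (CARD('n) + 1) / ?l ^ CARD('n)
       * (?l' / ?l) powr \<beta>"
    by (simp add: C_def power_mult_distrib power2_eq_square)
  finally show ?thesis .
qed

text \<open>The bound on the Gram entries times the bound on the row sums; the factor 2 accounts for
  rows and columns.\<close>

definition schur_const :: real where
  "schur_const = 2 * K\<^sup>2 * unit_ball_vol (real CARD('n)) * R ^ (CARD('n) + 1) * overlap CARD('n) (2 * R) \<beta>"

lemma schur_const_nonneg: "0 \<le> schur_const"
  unfolding schur_const_def using R K \<beta> by (intro mult_nonneg_nonneg overlap_nonneg) auto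

text \<open>Schur's test for the Gram matrix of the functions \<open>\<phi> Q\<close>: expanding the
  square leaves entries controlled by \<open>adapted_almost_orthogonal\<close>.\<close>

lemma adapted_sum_L2_bound:
  assumes "finite G"
  shows "(\<integral>\<^sup>+x. ennreal ((norm (\<Sum>Q\<in>G. c Q * \<phi> Q x))\<^sup>2) \<partial>lebesgue)
    \<le> ennreal (schur_const * (\<Sum>Q\<in>G. (norm (c Q))\<^sup>2 / side Q ^ CARD('n)))"
proof -
  define h where "h x = (\<Sum>Q\<in>G. c Q * \<phi> Q x)" for x
  \<comment> \<open>Dividing by the n-th power of the side turns the bound on the Gram entries into
    the kernel W, whose row sums and column sums have the same form.\<close>
  define b where "b Q = norm (c Q) / side Q ^ CARD('n)" for Q :: "int \<times> (int ^ 'n)"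
  define I where "I Q Q' = (LINT x|lebesgue. \<phi> Q x * cnj (\<phi> Q' x))" for Q Q'
  \<comment> \<open>Only pairs in which Q' is the smaller cube are kept; the others are recovered
    from W with the arguments exchanged. For more distant centers the product of the two functions
    vanishes by \<open>dist_centers_le\<close>.\<close>
  define W where "W Q Q' = (if side Q' \<le> side Q \<and>
      dist (center Q) (center Q') \<le> 2 * R * side Q
    then side Q' ^ CARD('n) * (side Q' / side Q) powr \<beta> else 0)"
    for Q Q' :: "int \<times> (int ^ 'n)"
  define C where "C = K\<^sup>2 * unit_ball_vol (real CARD('n)) * R ^ (CARD('n) + 1)"
  define T where "T = overlap CARD('n) (2 * R) \<beta>"
  have C0: "0 \<le> C" using R by (simp add: C_def)
  have W0: "0 \<le> W Q Q'" for Q Q' by (simp add: W_def)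
  have b0: "0 \<le> b Q" for Q by (simp add: b_def)
  have I_small: "norm (I Q Q') * (side Q ^ CARD('n) * side Q' ^ CARD('n)) \<le> C * W Q Q'"
    if "side Q' \<le> side Q" for Q Q'
  proof (cases "dist (center Q) (center Q') \<le> 2 * R * side Q")
    case True
    have "norm (I Q Q') * (side Q ^ CARD('n) * side Q' ^ CARD('n))
        \<le> C / side Q ^ CARD('n) * (side Q' / side Q) powr \<beta>
          * (side Q ^ CARD('n) * side Q' ^ CARD('n))"
      unfolding I_def C_def by (intro mult_right_mono adapted_almost_orthogonal that) auto
    also have "\<dots> = C * W Q Q'"
      using that True by (simp add: W_def)
    finally show ?thesis .
  next
    case False
    then have "\<phi> Q x = 0 \<or> \<phi> Q' x = 0" for x
      using dist_centers_le[OF _ _ that] by blast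
    then have "(\<lambda>x. \<phi> Q x * cnj (\<phi> Q' x)) = (\<lambda>x. 0)"
      by (simp add: fun_eq_iff)
    then have "I Q Q' = 0" by (simp add: I_def)
    then show ?thesis using C0 W0 by simp
  qed
  have I_sym: "norm (I Q Q') = norm (I Q' Q)" for Q Q'
  proof -
    have "I Q Q' = cnj (I Q' Q)"
      unfolding I_def Bochner_Integration.integral_cnj[symmetric] by (simp add: mult.commute)
    then show ?thesis by simp
  qed
  have I_le: "norm (c Q) * norm (c Q') * norm (I Q Q') \<le> C * (b Q * b Q' * (W Q Q' + W Q' Q))" for Q Q'
  proof -
    have "norm (I Q Q') * (side Q ^ CARD('n) * side Q' ^ CARD('n)) \<le> C * (W Q Q' + W Q' Q)"
    proof (cases "side Q' \<le> side Q")
      case True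
      then show ?thesis
        using I_small[of Q' Q] mult_left_mono[OF W0[of Q' Q] C0] by (simp add: distrib_left)
    next
      case False
      then show ?thesis
        using I_small[of Q Q'] mult_left_mono[OF W0[of Q Q'] C0] I_sym[of Q Q']
        by (simp add: distrib_left mult.commute)
    qed
    then have "(b Q * b Q') * (norm (I Q Q') * (side Q ^ CARD('n) * side Q' ^ CARD('n)))
        \<le> (b Q * b Q') * (C * (W Q Q' + W Q' Q))"
      by (intro mult_left_mono mult_nonneg_nonneg b0)
    then show ?thesis by (simp add: b_def mult_ac)
  qed
  \<comment> \<open>Over smaller cubes the n-th power of \<open>side Q'\<close> compensates for
    their number.\<close>
  have row: "(\<Sum>Q'\<in>G. W Q Q') \<le> T * side Q ^ CARD('n)" for Q
  proof -
    let ?G = "{Q'\<in>G. side Q' \<le> side Q \<and>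
      dist (center Q) (center Q') \<le> 2 * R * side Q}"
    have "(\<Sum>Q'\<in>G. W Q Q') = (\<Sum>Q'\<in>?G. side Q' ^ CARD('n) * (side Q' / side Q) powr \<beta>)"
      unfolding W_def using \<open>finite G\<close> by (simp add: sum.inter_filter)
    also have "\<dots> = (\<Sum>Q'\<in>?G. (side Q' / side Q) powr (real CARD('n) + \<beta>)) * side Q ^ CARD('n)"
      unfolding sum_distrib_right by (intro sum.cong) (auto simp: powr_add powr_realpow power_divide)
    also have "\<dots> \<le> T * side Q ^ CARD('n)"
      unfolding T_def using \<open>finite G\<close> R \<beta>
      by (intro mult_right_mono sum_dyadic_small_scales[of _ _ _ _ "center Q"]) auto
    finally show ?thesis .
  qed
  \<comment> \<open>Over larger cubes there are boundedly many per scale, and the power \<beta>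
    alone makes the sum converge.\<close>
  have col: "(\<Sum>Q\<in>G. W Q Q') \<le> T * side Q' ^ CARD('n)" for Q'
  proof -
    let ?G = "{Q\<in>G. side Q' \<le> side Q \<and>
      dist (center Q) (center Q') \<le> 2 * R * side Q}"
    have "(\<Sum>Q\<in>G. W Q Q') = (\<Sum>Q\<in>?G. side Q' ^ CARD('n) * (side Q' / side Q) powr \<beta>)"
      unfolding W_def using \<open>finite G\<close> by (simp add: sum.inter_filter)
    also have "\<dots> = (\<Sum>Q\<in>?G. (side Q' / side Q) powr \<beta>) * side Q' ^ CARD('n)"
      by (simp add: sum_distrib_left mult.commute)
    also have "\<dots> \<le> T * side Q' ^ CARD('n)"
      unfolding T_def using \<open>finite G\<close> R \<beta>
      by (intro mult_right_mono sum_dyadic_large_scales[of _ _ _ _ "center Q'"]) (auto simp: dist_commute)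
    finally show ?thesis .
  qed
  have hsq: "of_real ((norm (h x))\<^sup>2) = (\<Sum>Q\<in>G. \<Sum>Q'\<in>G. c Q * cnj (c Q') * (\<phi> Q x * cnj (\<phi> Q' x)))" for x
    unfolding complex_norm_square h_def cnj_sum sum_product by (simp add: mult_ac)
  have int_sq: "integrable lebesgue (\<lambda>x. complex_of_real ((norm (h x))\<^sup>2))"
    unfolding hsq by (intro Bochner_Integration.integrable_sum integrable_mult_right integrable_adapted_mult)
  have "complex_of_real (LINT x|lebesgue. (norm (h x))\<^sup>2) = (LINT x|lebesgue. complex_of_real ((norm (h x))\<^sup>2))"
    by (simp del: of_real_power)
  also have "\<dots> = (\<Sum>Q\<in>G. \<Sum>Q'\<in>G. c Q * cnj (c Q') * I Q Q')"
    unfolding hsq by (simp add: integrable_adapted_mult I_def)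
  finally have "norm (complex_of_real (LINT x|lebesgue. (norm (h x))\<^sup>2))
      = norm (\<Sum>Q\<in>G. \<Sum>Q'\<in>G. c Q * cnj (c Q') * I Q Q')"
    by (rule arg_cong)
  then have "(LINT x|lebesgue. (norm (h x))\<^sup>2) = norm (\<Sum>Q\<in>G. \<Sum>Q'\<in>G. c Q * cnj (c Q') * I Q Q')"
    unfolding norm_of_real by (subst (asm) abs_of_nonneg) (auto intro: Bochner_Integration.integral_nonneg)
  also have "\<dots> \<le> (\<Sum>Q\<in>G. \<Sum>Q'\<in>G. norm (c Q) * norm (c Q') * norm (I Q Q'))"
    by (intro order_trans[OF norm_sum] sum_mono) (simp add: norm_mult)
  also have "\<dots> \<le> (\<Sum>Q\<in>G. \<Sum>Q'\<in>G. C * (b Q * b Q' * (W Q Q' + W Q' Q)))"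
    by (intro sum_mono I_le)
  also have "\<dots> \<le> (\<Sum>Q\<in>G. \<Sum>Q'\<in>G. C * (((b Q)\<^sup>2 + (b Q')\<^sup>2) / 2 * (W Q Q' + W Q' Q)))"
  proof (intro sum_mono mult_left_mono mult_right_mono C0)
    show "b Q * b Q' \<le> ((b Q)\<^sup>2 + (b Q')\<^sup>2) / 2" for Q Q'
      using sum_squares_bound[of "b Q" "b Q'"] by simp
  qed (auto intro: add_nonneg_nonneg W0)
  also have "\<dots> = C * ((\<Sum>Q\<in>G. \<Sum>Q'\<in>G. (b Q)\<^sup>2 * W Q Q') + (\<Sum>Q\<in>G. \<Sum>Q'\<in>G. (b Q)\<^sup>2 * W Q' Q))"
  proof -
    have 1: "(\<Sum>Q\<in>G. \<Sum>Q'\<in>G. (b Q')\<^sup>2 * W Q Q') = (\<Sum>Q\<in>G. \<Sum>Q'\<in>G. (b Q)\<^sup>2 * W Q' Q)"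
      by (rule sum.swap)
    have 2: "(\<Sum>Q\<in>G. \<Sum>Q'\<in>G. (b Q')\<^sup>2 * W Q' Q) = (\<Sum>Q\<in>G. \<Sum>Q'\<in>G. (b Q)\<^sup>2 * W Q Q')"
      by (rule sum.swap)
    have 3: "C / 2 * (s + t + (t + s)) = C * (s + t)" for s t :: real
      by simp
    have 4: "(\<Sum>Q\<in>G. \<Sum>Q'\<in>G. C * (((b Q)\<^sup>2 + (b Q')\<^sup>2) / 2 * (W Q Q' + W Q' Q)))
        = C / 2 * ((\<Sum>Q\<in>G. \<Sum>Q'\<in>G. (b Q)\<^sup>2 * W Q Q') + (\<Sum>Q\<in>G. \<Sum>Q'\<in>G. (b Q)\<^sup>2 * W Q' Q)
          + ((\<Sum>Q\<in>G. \<Sum>Q'\<in>G. (b Q')\<^sup>2 * W Q Q') + (\<Sum>Q\<in>G. \<Sum>Q'\<in>G. (b Q')\<^sup>2 * W Q' Q)))"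
      unfolding sum.distrib[symmetric] sum_distrib_left by (intro sum.cong refl) (simp add: algebra_simps)
    show ?thesis by (rule 4[unfolded 1 2 3])
  qed
  also have "\<dots> \<le> C * ((\<Sum>Q\<in>G. (b Q)\<^sup>2 * (T * side Q ^ CARD('n))) + (\<Sum>Q\<in>G. (b Q)\<^sup>2 * (T * side Q ^ CARD('n))))"
    unfolding sum_distrib_left[symmetric]
    by (intro mult_left_mono add_mono sum_mono row col C0) auto
  also have "\<dots> = schur_const * (\<Sum>Q\<in>G. (norm (c Q))\<^sup>2 / side Q ^ CARD('n))"
    unfolding sum_distrib_left[symmetric] sum.distrib[symmetric] schur_const_def C_def[symmetric] T_def[symmetric]
    unfolding sum_distrib_left
    by (intro sum.cong refl) (simp add: b_def power_divide power2_eq_square field_simps C_def T_def)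
  finally have "(LINT x|lebesgue. (norm (h x))\<^sup>2) \<le> schur_const * (\<Sum>Q\<in>G. (norm (c Q))\<^sup>2 / side Q ^ CARD('n))" .
  moreover have "(\<integral>\<^sup>+x. ennreal ((norm (h x))\<^sup>2) \<partial>lebesgue) = ennreal (LINT x|lebesgue. (norm (h x))\<^sup>2)"
    using int_sq by (intro nn_integral_eq_integral) (simp_all only: complex_of_real_integrable_eq zero_le_power2 AE_I2)
  ultimately show ?thesis
    unfolding h_def by (simp add: ennreal_leI)
qed

end

section \<open>The tent estimate\<close>

lemma sigma_finite_lebesgue: "sigma_finite_measure (lebesgue :: 'a::euclidean_space measure)"
proof
  obtain A :: "'a set set" where "countable A" "A \<subseteq> sets lborel" "\<Union>A = space lborel"
      "\<forall>a\<in>A. emeasure lborel a \<noteq> \<infinity>"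
    using lborel.sigma_finite_countable by auto
  then show "\<exists>A::'a set set. countable A \<and> A \<subseteq> sets lebesgue \<and> \<Union>A = space lebesgue \<and>
      (\<forall>a\<in>A. emeasure lebesgue a \<noteq> \<infinity>)"
    by (intro exI[of _ A]) auto
qed

lemma ident_lebesgue_borel [measurable]: "(\<lambda>x. x) \<in> borel_measurable (lebesgue :: 'a::euclidean_space measure)"
  by (simp add: measurable_completion)

lemma infdist_lipschitz: "\<bar>infdist x F - infdist y F\<bar> \<le> dist x y"
  using infdist_triangle[of x F y] infdist_triangle[of y F x] by (auto simp: dist_commute)

lemma exists_near_infdist:
  assumes "F \<noteq> {}" "infdist x F < d"
  shows "\<exists>p\<in>F. dist x p < d"
proof -
  have "(INF a\<in>F. dist x a) < d" using assms by (simp add: infdist_def)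
  then show ?thesis using assms(1) by (subst (asm) cINF_less_iff) auto
qed

context adapted_family
begin

text \<open>The bound \<open>M1 / (2 * \<epsilon>) + 2 * M0\<close> that remains in
  \<open>finite_tent_estimate\<close> once half of X has been absorbed, divided by A.\<close>

definition tent_const :: real where
  "tent_const = 2 * K\<^sup>2 * (2 * R + 1) ^ CARD('n) * R * overlap CARD('n) (2 * R) \<beta>
     + 9 ^ CARD('n) / unit_ball_vol (real CARD('n)) * (schur_const + 1)"

lemma tent_const_nonneg: "0 \<le> tent_const"
  unfolding tent_const_def using R K \<beta> schur_const_nonneg
  by (intro add_nonneg_nonneg mult_nonneg_nonneg overlap_nonneg divide_nonneg_nonneg) auto

text \<open>
  With \<open>c Q\<close> the conjugate of \<open>pairing g Q\<close> times \<open>side Q ^ n\<close>, the left-hand side X is the integral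
  of g h for \<open>h = \<Sum> c Q \<phi> Q\<close>. All cubes that see x have side at least comparable to the distance of x to F,
  so h is almost constant at that scale and \<open>|h|\<close> may be replaced by its average there. Moving the
  average over to g gives a function bounded by a multiple of A. The remaining term
  \<open>\<integral> |h|\<^sup>2 \<le> C X\<close> is absorbed into X.\<close>

lemma finite_tent_estimate:
  assumes g: "integrable lebesgue g" and "F \<noteq> {}" and A0: "0 \<le> A"
    and A: "\<And>x r. x \<in> F \<Longrightarrow> 0 < r \<Longrightarrow>
      mass g (cball x r) \<le> ennreal (A * r ^ CARD('n))"
    and "finite G" and near: "\<And>Q. Q \<in> G \<Longrightarrow> \<exists>p\<in>F. dist p (center Q) \<le> (R + 1) * side Q"
  shows "ennreal (\<Sum>Q\<in>G. (norm (pairing g Q))\<^sup>2 * side Q ^ CARD('n))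
    \<le> ennreal (tent_const * A) * (\<integral>\<^sup>+x. ennreal (norm (g x)) \<partial>lebesgue)"
proof (cases "G = {}")
  case False
  note [measurable] = borel_measurable_integrable[OF g]
  let ?N = "CARD('n)"
  define \<omega> where "\<omega> = unit_ball_vol (real ?N)"
  define X where "X = (\<Sum>Q\<in>G. (norm (pairing g Q))\<^sup>2 * side Q ^ ?N)"
  define c where "c Q = cnj (pairing g Q) * of_real (side Q ^ ?N)" for Q
  define h where "h x = (\<Sum>Q\<in>G. c Q * \<phi> Q x)" for x
  define l0 where "l0 = Min (side ` G)"
  \<comment> \<open>\<open>\<rho>\<close> is Lipschitz with constant 1/4, so its values at x and at
    points within \<open>\<rho> x\<close> of x are comparable; \<open>l0\<close>, the smallest side
    in G, keeps it positive on F.\<close>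
  define \<rho> where "\<rho> x = max (infdist x F) l0 / 4" for x
  define M0 where "M0 = K\<^sup>2 * (2 * R + 1) ^ ?N * R * overlap ?N (2 * R) \<beta> * A"
  define M1 where "M1 = 9 ^ ?N / \<omega> * A"
  \<comment> \<open>Chosen so that \<open>\<epsilon> * schur_const\<close> is at most 1/2, which
    allows half of X to be absorbed at the end.\<close>
  define \<epsilon> where "\<epsilon> = 1 / (2 * (schur_const + 1))"
  define k where "k x z = ennreal (1 / (\<omega> * \<rho> x ^ ?N)) * indicator (ball x (\<rho> x)) z" for x z
  define Y where "Y = (\<integral>\<^sup>+x. ennreal (norm (g x)) \<partial>lebesgue)"
  have \<omega>: "0 < \<omega>" by (simp add: \<omega>_def)
  have \<epsilon>: "0 < \<epsilon>" using schur_const_nonneg by (simp add: \<epsilon>_def)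
  have M0: "0 \<le> M0" unfolding M0_def using R K \<beta> A0 by (intro mult_nonneg_nonneg overlap_nonneg) auto
  have M1: "0 \<le> M1" unfolding M1_def using \<omega> A0 by (intro mult_nonneg_nonneg) auto
  have X0: "0 \<le> X" unfolding X_def by (intro sum_nonneg) auto
  have Yfin: "Y < \<infinity>" using g unfolding Y_def integrable_iff_bounded by auto
  have "l0 \<in> side ` G" unfolding l0_def using \<open>finite G\<close> False by (intro Min_in) auto
  then have l0: "0 < l0" by auto
  have l0_le: "l0 \<le> side Q" if "Q \<in> G" for Q
    using that \<open>finite G\<close> by (simp add: l0_def)
  have \<rho>_pos: "0 < \<rho> x" for x using l0 by (simp add: \<rho>_def)
  have \<rho>_lip: "\<rho> x \<le> \<rho> y + dist x y / 4" for x y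
    using infdist_lipschitz[of x F y] by (auto simp: \<rho>_def)
  have \<rho>_cont: "continuous_on UNIV \<rho>"
    unfolding \<rho>_def by (intro continuous_intros) auto
  have \<rho>_meas [measurable]: "\<rho> \<in> borel_measurable borel"
    using \<rho>_cont by (rule borel_measurable_continuous_onI)
  have [measurable]: "h \<in> borel_measurable borel"
    unfolding h_def by measurable
  have [measurable]: "h \<in> borel_measurable lebesgue"
    by (simp add: measurable_completion)
  have c_le: "norm (c Q) \<le> K * (2 * R + 1) ^ ?N * A * side Q ^ ?N" if Q: "Q \<in> G" for Q
  proof -
    obtain p where p: "p \<in> F" "dist p (center Q) \<le> (R + 1) * side Q"
      using near[OF Q] by blast
    have "norm (pairing g Q) \<le> K * (R + 1 + R) ^ ?N * A"
      using R by (intro norm_pairing_le_maximal[OF _ A0 A[OF p(1)] p(2)]) auto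
    moreover have "R + 1 + R = 2 * R + 1" by simp
    ultimately have "norm (pairing g Q) \<le> K * (2 * R + 1) ^ ?N * A" by (simp only:)
    then have "norm (pairing g Q) * side Q ^ ?N \<le> K * (2 * R + 1) ^ ?N * A * side Q ^ ?N"
      by (rule mult_right_mono) simp
    then show ?thesis by (simp add: c_def norm_mult norm_power)
  qed
  have X_eq: "complex_of_real X = (LINT x|lebesgue. g x * h x)"
  proof -
    have "(LINT x|lebesgue. g x * h x) = (LINT x|lebesgue. (\<Sum>Q\<in>G. c Q * (g x * \<phi> Q x)))"
      by (simp add: h_def sum_distrib_left mult_ac)
    also have "\<dots> = (\<Sum>Q\<in>G. c Q * pairing g Q)"
      by (subst Bochner_Integration.integral_sum) (auto simp: pairing_def integrable_mult_adapted[OF g])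
    also have "\<dots> = complex_of_real X"
      unfolding X_def of_real_sum
      by (intro sum.cong refl) (simp add: c_def complex_norm_square mult_ac flip: of_real_power)
    finally show ?thesis by simp
  qed
  \<comment> \<open>A cube that sees x or z is near F and has side at least \<open>l0\<close>, hence
    \<open>\<rho> x / R \<le> side Q\<close>. The oscillation of h is then a convergent sum over
    large scales.\<close>
  have osc: "norm (h x) \<le> norm (h z) + M0" if xz: "dist x z < \<rho> x" for x z
  proof -
    let ?G = "{Q\<in>G. \<rho> x / R \<le> side Q \<and> dist x (center Q) \<le> 2 * R * side Q}"
    have zero: "\<phi> Q x = 0 \<and> \<phi> Q z = 0" if Q: "Q \<in> G" "Q \<notin> ?G" for Q
    proof (rule ccontr)
      assume "\<not> ?thesis"
      then have "dist x (center Q) \<le> R * side Q \<or> dist z (center Q) \<le> R * side Q"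
        using supp not_le by blast
      then have d: "dist x (center Q) \<le> R * side Q + \<rho> x"
        using xz \<rho>_pos[of x] dist_triangle[of x "center Q" z] by linarith
      obtain p where p: "p \<in> F" "dist p (center Q) \<le> (R + 1) * side Q"
        using near[OF Q(1)] by blast
      have Rl: "side Q \<le> R * side Q" using R by simp
      have "\<rho> x \<le> R * side Q"
      proof (cases "l0 \<le> infdist x F")
        case True
        then have "4 * \<rho> x \<le> dist x p" using p by (simp add: \<rho>_def infdist_le)
        also have "\<dots> \<le> R * side Q + \<rho> x + (R + 1) * side Q"
          using dist_triangle2[of x p "center Q"] d p by linarith
        finally show ?thesis using Rl unfolding distrib_right by linarith
      next
        case False
        then have "\<rho> x = l0 / 4" by (simp add: \<rho>_def)
        then show ?thesis using l0_le[OF Q(1)] Rl l0 by linarith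
      qed
      then have "\<rho> x / R \<le> side Q" "dist x (center Q) \<le> 2 * R * side Q"
        using d R by (simp add: pos_divide_le_eq mult.commute, linarith)
      then show False
        using Q by simp
    qed
    have "norm (h x - h z) = norm (\<Sum>Q\<in>?G. c Q * (\<phi> Q x - \<phi> Q z))"
    proof -
      have "h x - h z = (\<Sum>Q\<in>G. c Q * (\<phi> Q x - \<phi> Q z))"
        by (simp add: h_def sum_subtractf right_diff_distrib)
      also have "\<dots> = (\<Sum>Q\<in>?G. c Q * (\<phi> Q x - \<phi> Q z))"
        using \<open>finite G\<close> zero by (intro sum.mono_neutral_right) auto
      finally show ?thesis by (rule arg_cong)
    qed
    also have "\<dots> \<le> (\<Sum>Q\<in>?G. norm (c Q) * norm (\<phi> Q x - \<phi> Q z))"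
      by (intro order_trans[OF norm_sum] sum_mono) (simp add: norm_mult)
    also have "\<dots> \<le> (\<Sum>Q\<in>?G. (K\<^sup>2 * (2 * R + 1) ^ ?N * A * R) * ((\<rho> x / R) / side Q) powr \<beta>)"
    proof (intro sum_mono)
      fix Q assume Q: "Q \<in> ?G"
      have "norm (\<phi> Q x - \<phi> Q z) \<le> K / side Q ^ ?N * (dist x z / side Q) powr \<beta>"
        by (rule hoelder)
      also have "(dist x z / side Q) powr \<beta> \<le> (\<rho> x / side Q) powr \<beta>"
        using xz \<beta> by (intro powr_mono2 divide_right_mono) auto
      also have "\<rho> x / side Q = R * ((\<rho> x / R) / side Q)"
        using R by simp
      also have "\<dots> powr \<beta> = R powr \<beta> * ((\<rho> x / R) / side Q) powr \<beta>"
        by (rule powr_mult)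
      also have "\<dots> \<le> R powr 1 * ((\<rho> x / R) / side Q) powr \<beta>"
        using R \<beta> by (intro mult_right_mono powr_mono) auto
      finally have "norm (\<phi> Q x - \<phi> Q z) \<le> K / side Q ^ ?N * (R * ((\<rho> x / R) / side Q) powr \<beta>)"
        using K R by (simp add: mult_left_mono divide_right_mono)
      then have "norm (c Q) * norm (\<phi> Q x - \<phi> Q z) \<le> (K * (2 * R + 1) ^ ?N * A * side Q ^ ?N) *
          (K / side Q ^ ?N * (R * ((\<rho> x / R) / side Q) powr \<beta>))"
        using Q K R A0 by (intro mult_mono c_le) auto
      also have "\<dots> = (K\<^sup>2 * (2 * R + 1) ^ ?N * A * R) * ((\<rho> x / R) / side Q) powr \<beta>"
        by (simp add: power2_eq_square)
      finally show "norm (c Q) * norm (\<phi> Q x - \<phi> Q z) \<le> \<dots>" .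
    qed
    also have "\<dots> = (K\<^sup>2 * (2 * R + 1) ^ ?N * A * R) * (\<Sum>Q\<in>?G. ((\<rho> x / R) / side Q) powr \<beta>)"
      by (simp add: sum_distrib_left)
    also have "\<dots> \<le> (K\<^sup>2 * (2 * R + 1) ^ ?N * A * R) * overlap ?N (2 * R) \<beta>"
      using \<open>finite G\<close> R \<beta> \<rho>_pos[of x] A0
      by (intro mult_left_mono sum_dyadic_large_scales[of _ _ _ _ x]) auto
    also have "\<dots> = M0" by (simp add: M0_def)
    finally show ?thesis using norm_triangle_ineq3[of "h x" "h z"] by linarith
  qed
  have k_meas: "(\<lambda>p. k (fst p) (snd p)) \<in> borel_measurable (lebesgue \<Otimes>\<^sub>M lebesgue)"
  proof -
    have 1: "fst \<in> borel_measurable (lebesgue \<Otimes>\<^sub>M (lebesgue :: (real ^ 'n) measure) :: ((real ^ 'n) \<times> (real ^ 'n)) measure)"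
      by (rule measurable_compose[OF measurable_fst ident_lebesgue_borel])
    have 2: "snd \<in> borel_measurable (lebesgue \<Otimes>\<^sub>M (lebesgue :: (real ^ 'n) measure) :: ((real ^ 'n) \<times> (real ^ 'n)) measure)"
      by (rule measurable_compose[OF measurable_snd ident_lebesgue_borel])
    have "open {q :: (real ^ 'n) \<times> (real ^ 'n). dist (fst q) (snd q) < \<rho> (fst q)}"
      by (intro open_Collect_less continuous_intros continuous_on_compose2[OF \<rho>_cont]) auto
    then have [measurable]: "{q :: (real ^ 'n) \<times> (real ^ 'n). dist (fst q) (snd q) < \<rho> (fst q)} \<in> sets borel"
      by simp
    have [measurable]: "(\<lambda>q :: (real ^ 'n) \<times> (real ^ 'n). \<rho> (fst q)) \<in> borel_measurable borel"
      by (intro borel_measurable_continuous_onI continuous_on_compose2[OF \<rho>_cont] continuous_intros) auto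
    have 3: "(\<lambda>p :: (real ^ 'n) \<times> (real ^ 'n). ennreal (1 / (\<omega> * \<rho> (fst p) ^ ?N)) * indicator {q. dist (fst q) (snd q) < \<rho> (fst q)} p)
      \<in> borel_measurable borel"
      by measurable
    have 4: "(\<lambda>p. p) \<in> borel_measurable (lebesgue \<Otimes>\<^sub>M (lebesgue :: (real ^ 'n) measure) :: ((real ^ 'n) \<times> (real ^ 'n)) measure)"
      using borel_measurable_Pair[OF 1 2] by simp
    note measurable_compose[OF 4 3]
    then show ?thesis by (simp add: k_def indicator_def)
  qed
  have k_meas2 [measurable]: "k x \<in> borel_measurable lebesgue" for x
    unfolding k_def by measurable
  have k_int: "(\<integral>\<^sup>+z. k x z \<partial>lebesgue) = 1" for x
    using \<rho>_pos[of x] \<omega>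
    by (simp add: k_def nn_integral_cmult_indicator emeasure_ball flip: \<omega>_def ennreal_mult)
  have h_avg: "ennreal (norm (h x)) \<le> (\<integral>\<^sup>+z. ennreal (norm (h z)) * k x z \<partial>lebesgue) + ennreal M0" for x
  proof -
    have "ennreal (norm (h x)) = (\<integral>\<^sup>+z. ennreal (norm (h x)) * k x z \<partial>lebesgue)"
      by (simp add: nn_integral_cmult k_int)
    also have "\<dots> \<le> (\<integral>\<^sup>+z. ennreal (norm (h z)) * k x z + ennreal M0 * k x z \<partial>lebesgue)"
    proof (rule nn_integral_mono)
      fix z
      show "ennreal (norm (h x)) * k x z \<le> ennreal (norm (h z)) * k x z + ennreal M0 * k x z"
      proof (cases "dist x z < \<rho> x")
        case True
        then have "ennreal (norm (h x)) \<le> ennreal (norm (h z)) + ennreal M0"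
          using osc M0 by (simp add: ennreal_leI flip: ennreal_plus)
        then have "ennreal (norm (h x)) * k x z \<le> (ennreal (norm (h z)) + ennreal M0) * k x z"
          by (rule mult_right_mono) simp
        then show ?thesis by (simp add: distrib_right)
      qed (simp add: k_def)
    qed
    also have "\<dots> = (\<integral>\<^sup>+z. ennreal (norm (h z)) * k x z \<partial>lebesgue) + ennreal M0"
      by (subst nn_integral_add) (auto simp: nn_integral_cmult k_int)
    finally show ?thesis .
  qed
  \<comment> \<open>The averaging of h is moved to |g|: \<open>\<Gamma>\<close> is the transposed
    average and has the same integral Y as |g|.\<close>
  define \<Gamma> where "\<Gamma> z = (\<integral>\<^sup>+x. ennreal (norm (g x)) * k x z \<partial>lebesgue)" for z
  interpret L: sigma_finite_measure "lebesgue :: (real ^ 'n) measure" by (rule sigma_finite_lebesgue)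
  interpret pair_sigma_finite "lebesgue :: (real ^ 'n) measure" "lebesgue :: (real ^ 'n) measure" ..
  note [measurable] = k_meas
  have \<Gamma>_meas [measurable]: "\<Gamma> \<in> borel_measurable lebesgue"
    unfolding \<Gamma>_def by (rule L.borel_measurable_nn_integral[of "\<lambda>z x. ennreal (norm (g x)) * k x z"])
      (use measurable_compose[OF measurable_pair_swap' k_meas] in \<open>simp add: split_beta'\<close>)
  have \<Gamma>_int: "(\<integral>\<^sup>+z. \<Gamma> z \<partial>lebesgue) = Y"
  proof -
    have "(\<integral>\<^sup>+z. \<Gamma> z \<partial>lebesgue) = (\<integral>\<^sup>+x. (\<integral>\<^sup>+z. ennreal (norm (g x)) * k x z \<partial>lebesgue) \<partial>lebesgue)"
      unfolding \<Gamma>_def by (rule Fubini') (simp add: split_beta')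
    also have "\<dots> = Y"
      by (simp add: nn_integral_cmult k_int Y_def)
    finally show ?thesis .
  qed
  have \<Gamma>_le: "\<Gamma> z \<le> ennreal M1" for z
  proof -
    have "infdist z F < 5 * \<rho> z"
      using \<rho>_pos[of z] by (auto simp: \<rho>_def)
    then obtain p where p: "p \<in> F" "dist z p < 5 * \<rho> z"
      using exists_near_infdist \<open>F \<noteq> {}\<close> by blast
    \<comment> \<open>If \<open>dist x z < \<rho> x\<close>, the Lipschitz property gives
      \<open>\<rho> z \<le> 5 / 4 * \<rho> x\<close> and
      \<open>\<rho> x \<le> 4 / 3 * \<rho> z\<close>. The radius 7 exceeds 5 + 4/3, and the base 9
      in \<open>M1\<close> exceeds 7 * 5/4.\<close>
    have "\<Gamma> z \<le> (\<integral>\<^sup>+x. ennreal ((5 / 4) ^ ?N / (\<omega> * \<rho> z ^ ?N)) * (ennreal (norm (g x)) * indicator (cball p (7 * \<rho> z)) x) \<partial>lebesgue)"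
      unfolding \<Gamma>_def
    proof (rule nn_integral_mono)
      fix x
      show "ennreal (norm (g x)) * k x z
        \<le> ennreal ((5 / 4) ^ ?N / (\<omega> * \<rho> z ^ ?N)) * (ennreal (norm (g x)) * indicator (cball p (7 * \<rho> z)) x)"
      proof (cases "dist x z < \<rho> x")
        case True
        have 1: "\<rho> z \<le> 5 / 4 * \<rho> x" using \<rho>_lip[of z x] True by (simp add: dist_commute)
        have 2: "\<rho> x \<le> 4 / 3 * \<rho> z" using \<rho>_lip[of x z] True by simp
        have "dist p x \<le> 7 * \<rho> z"
          using p(2) True 2 \<rho>_pos[of z] dist_triangle[of p x z] by (simp add: dist_commute)
        moreover have "1 / (\<omega> * \<rho> x ^ ?N) \<le> (5 / 4) ^ ?N / (\<omega> * \<rho> z ^ ?N)"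
        proof -
          have "\<rho> z ^ ?N \<le> (5 / 4 * \<rho> x) ^ ?N" using 1 \<rho>_pos[of z] by (intro power_mono) auto
          then show ?thesis
            using \<omega> \<rho>_pos[of x] \<rho>_pos[of z] by (simp add: field_simps power_mult_distrib power_divide)
        qed
        ultimately show ?thesis
          using True by (simp add: k_def mult.commute ennreal_leI mult_left_mono)
      qed (simp add: k_def)
    qed
    also have "\<dots> = ennreal ((5 / 4) ^ ?N / (\<omega> * \<rho> z ^ ?N)) * mass g (cball p (7 * \<rho> z))"
      by (rule nn_integral_cmult) measurable
    also have "\<dots> \<le> ennreal ((5 / 4) ^ ?N / (\<omega> * \<rho> z ^ ?N)) * ennreal (A * (7 * \<rho> z) ^ ?N)"
      using \<rho>_pos[of z] by (intro mult_left_mono A p) auto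
    also have "\<dots> = ennreal ((5 / 4) ^ ?N * 7 ^ ?N / \<omega> * A)"
      using \<rho>_pos[of z] \<omega> A0 by (simp add: power_mult_distrib flip: ennreal_mult)
    also have "\<dots> \<le> ennreal M1"
      unfolding M1_def power_mult_distrib[symmetric] using \<omega> A0
      by (intro ennreal_leI mult_right_mono divide_right_mono power_mono) auto
    finally show ?thesis .
  qed
  have "ennreal X = ennreal (norm (LINT x|lebesgue. g x * h x))"
    using X0 by (simp flip: X_eq)
  also have "\<dots> \<le> (\<integral>\<^sup>+x. ennreal (norm (g x * h x)) \<partial>lebesgue)"
  proof (rule integral_norm_bound_ennreal)
    have "integrable lebesgue (\<lambda>x. \<Sum>Q\<in>G. c Q * (g x * \<phi> Q x))"
      by (intro Bochner_Integration.integrable_sum integrable_mult_right integrable_mult_adapted[OF g])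
    then show "integrable lebesgue (\<lambda>x. g x * h x)"
      by (simp add: h_def sum_distrib_left mult_ac)
  qed
  also have "\<dots> \<le> (\<integral>\<^sup>+x. (\<integral>\<^sup>+z. ennreal (norm (g x)) * (ennreal (norm (h z)) * k x z) \<partial>lebesgue)
        + ennreal (norm (g x)) * ennreal M0 \<partial>lebesgue)"
  proof (rule nn_integral_mono)
    fix x
    have "ennreal (norm (g x * h x)) \<le> ennreal (norm (g x)) *
        ((\<integral>\<^sup>+z. ennreal (norm (h z)) * k x z \<partial>lebesgue) + ennreal M0)"
      unfolding norm_mult using h_avg[of x] by (simp add: ennreal_mult mult_left_mono)
    then show "ennreal (norm (g x * h x)) \<le> (\<integral>\<^sup>+z. ennreal (norm (g x)) * (ennreal (norm (h z)) * k x z) \<partial>lebesgue)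
        + ennreal (norm (g x)) * ennreal M0"
      by (simp add: nn_integral_cmult distrib_left)
  qed
  also have "\<dots> = (\<integral>\<^sup>+x. (\<integral>\<^sup>+z. ennreal (norm (g x)) * (ennreal (norm (h z)) * k x z) \<partial>lebesgue) \<partial>lebesgue)
        + (\<integral>\<^sup>+x. ennreal (norm (g x)) * ennreal M0 \<partial>lebesgue)"
  proof (rule nn_integral_add)
    show "(\<lambda>x. \<integral>\<^sup>+z. ennreal (norm (g x)) * (ennreal (norm (h z)) * k x z) \<partial>lebesgue) \<in> borel_measurable lebesgue"
      by (rule L.borel_measurable_nn_integral) (simp add: split_beta')
  qed measurable
  also have "(\<integral>\<^sup>+x. ennreal (norm (g x)) * ennreal M0 \<partial>lebesgue) = ennreal M0 * Y"
    unfolding Y_def by (subst nn_integral_multc) (auto simp: mult.commute)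
  also have "(\<integral>\<^sup>+x. (\<integral>\<^sup>+z. ennreal (norm (g x)) * (ennreal (norm (h z)) * k x z) \<partial>lebesgue) \<partial>lebesgue)
      = (\<integral>\<^sup>+z. (\<integral>\<^sup>+x. ennreal (norm (g x)) * (ennreal (norm (h z)) * k x z) \<partial>lebesgue) \<partial>lebesgue)"
    by (rule Fubini'[symmetric]) (simp add: split_beta')
  also have "\<dots> = (\<integral>\<^sup>+z. ennreal (norm (h z)) * \<Gamma> z \<partial>lebesgue)"
  proof (rule nn_integral_cong)
    fix z
    have "(\<lambda>x. ennreal (norm (g x)) * k x z) \<in> borel_measurable lebesgue"
      using measurable_compose[OF measurable_Pair2' k_meas, of z] by simp
    then show "(\<integral>\<^sup>+x. ennreal (norm (g x)) * (ennreal (norm (h z)) * k x z) \<partial>lebesgue) = ennreal (norm (h z)) * \<Gamma> z"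
      unfolding \<Gamma>_def by (subst nn_integral_cmult[symmetric]) (auto simp: mult_ac)
  qed
  \<comment> \<open>Young's inequality with \<epsilon>; since \<open>\<Gamma>\<close> is at most
    \<open>M1\<close>, its square is at most \<open>M1 * \<Gamma>\<close>, so that only the integral
    of \<open>\<Gamma>\<close> enters.\<close>
  also have "\<dots> \<le> (\<integral>\<^sup>+z. ennreal \<epsilon> * ennreal ((norm (h z))\<^sup>2) + ennreal (M1 / (4 * \<epsilon>)) * \<Gamma> z \<partial>lebesgue)"
  proof (rule nn_integral_mono)
    fix z
    obtain \<gamma> where \<gamma>: "\<Gamma> z = ennreal \<gamma>" "0 \<le> \<gamma>" "\<gamma> \<le> M1"
      using \<Gamma>_le[of z] M1 by (cases "\<Gamma> z") (auto simp: top_unique)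
    have "norm (h z) * \<gamma> \<le> \<epsilon> * (norm (h z))\<^sup>2 + \<gamma>\<^sup>2 / (4 * \<epsilon>)"
    proof -
      have "0 \<le> (2 * \<epsilon> * norm (h z) - \<gamma>)\<^sup>2 / (4 * \<epsilon>)" using \<epsilon> by simp
      also have "\<dots> = \<epsilon> * (norm (h z))\<^sup>2 + \<gamma>\<^sup>2 / (4 * \<epsilon>) - norm (h z) * \<gamma>"
        using \<epsilon> by (simp add: power2_eq_square field_simps)
      finally show ?thesis by simp
    qed
    also have "\<gamma>\<^sup>2 / (4 * \<epsilon>) \<le> M1 / (4 * \<epsilon>) * \<gamma>"
      using \<gamma> \<epsilon> by (simp add: power2_eq_square divide_right_mono mult_right_mono)
    finally show "ennreal (norm (h z)) * \<Gamma> z \<le> ennreal \<epsilon> * ennreal ((norm (h z))\<^sup>2) + ennreal (M1 / (4 * \<epsilon>)) * \<Gamma> z"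
      using \<gamma> \<epsilon> M1 by (simp add: ennreal_leI flip: ennreal_mult ennreal_plus)
  qed
  also have "\<dots> = ennreal \<epsilon> * (\<integral>\<^sup>+z. ennreal ((norm (h z))\<^sup>2) \<partial>lebesgue) + ennreal (M1 / (4 * \<epsilon>)) * Y"
    by (subst nn_integral_add) (auto simp: nn_integral_cmult \<Gamma>_int)
  also have "(\<integral>\<^sup>+z. ennreal ((norm (h z))\<^sup>2) \<partial>lebesgue) \<le> ennreal (schur_const * X)"
  proof -
    have "(\<Sum>Q\<in>G. (norm (c Q))\<^sup>2 / side Q ^ ?N) = X"
      unfolding X_def by (intro sum.cong refl) (simp add: c_def norm_mult norm_power power_mult_distrib power2_eq_square)
    then show ?thesis
      unfolding h_def using adapted_sum_L2_bound[OF \<open>finite G\<close>, of c] by simp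
  qed
  also have "ennreal \<epsilon> * ennreal (schur_const * X) \<le> ennreal (X / 2)"
  proof -
    have "\<epsilon> * (schur_const * X) \<le> 1 / 2 * X"
      unfolding \<epsilon>_def mult.assoc[symmetric] using schur_const_nonneg X0
      by (intro mult_right_mono) (auto simp: field_simps)
    then show ?thesis using \<epsilon> schur_const_nonneg X0 by (simp add: ennreal_leI flip: ennreal_mult)
  qed
  finally have main: "ennreal X \<le> ennreal (X / 2) + ennreal (M1 / (4 * \<epsilon>)) * Y + ennreal M0 * Y"
    by (simp add: add_right_mono mult_left_mono add_mono)
  \<comment> \<open>All quantities are real from here on, because G is finite and g integrable;
    hence X / 2 may be subtracted.\<close>
  obtain y where y: "Y = ennreal y" "0 \<le> y" using Yfin by (cases Y) auto
  have "X \<le> X / 2 + M1 / (4 * \<epsilon>) * y + M0 * y"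
    using main y X0 M0 M1 \<epsilon> by (simp add: ennreal_le_iff flip: ennreal_mult ennreal_plus)
  then have "X \<le> (M1 / (2 * \<epsilon>) + 2 * M0) * y" by (simp add: field_simps)
  also have "M1 / (2 * \<epsilon>) + 2 * M0 = tent_const * A"
    using schur_const_nonneg
    by (simp add: tent_const_def M1_def M0_def \<epsilon>_def \<omega>_def[symmetric] algebra_simps add_divide_distrib)
  finally show ?thesis
    unfolding X_def[symmetric] Y_def[symmetric] using y tent_const_nonneg A0
    by (simp add: ennreal_leI flip: ennreal_mult)
qed simp

end

section \<open>The discrete square function\<close>

text \<open>The bridge from sums over all cubes to finite families, for which the tent estimate and
  the overlap bounds are proved.\<close>

lemma nn_integral_count_space_eq_SUP:
  fixes f :: "'a \<Rightarrow> ennreal"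
  assumes "countable A"
  shows "(\<integral>\<^sup>+x. f x \<partial>count_space A) = (SUP G\<in>{G. finite G \<and> G \<subseteq> A}. sum f G)"
proof (rule antisym)
  show "(\<integral>\<^sup>+x. f x \<partial>count_space A) \<le> (SUP G\<in>{G. finite G \<and> G \<subseteq> A}. sum f G)"
  proof (cases "finite A")
    case True
    then show ?thesis
      by (subst nn_integral_count_space_finite) (auto intro!: SUP_upper2[of A])
  next
    case False
    with assms have bij: "bij_betw (from_nat_into A) UNIV A"
      by (rule bij_betw_from_nat_into)
    have "(\<integral>\<^sup>+x. f x \<partial>count_space A) = (\<Sum>i. f (from_nat_into A i))"
      by (simp add: nn_integral_bij_count_space[OF bij, symmetric] nn_integral_count_space_nat)
    also have "\<dots> = (SUP n. \<Sum>i<n. f (from_nat_into A i))"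
      by (rule suminf_eq_SUP)
    also have "\<dots> \<le> (SUP G\<in>{G. finite G \<and> G \<subseteq> A}. sum f G)"
    proof (rule SUP_least)
      fix n
      have "(\<Sum>i<n. f (from_nat_into A i)) = sum f (from_nat_into A ` {..<n})"
        using bij by (subst sum.reindex) (auto simp: bij_betw_def inj_on_def)
      also have "\<dots> \<le> (SUP G\<in>{G. finite G \<and> G \<subseteq> A}. sum f G)"
        using bij by (intro SUP_upper) (auto simp: bij_betw_def)
      finally show "(\<Sum>i<n. f (from_nat_into A i)) \<le> \<dots>" .
    qed
    finally show ?thesis .
  qed
  show "(SUP G\<in>{G. finite G \<and> G \<subseteq> A}. sum f G) \<le> (\<integral>\<^sup>+x. f x \<partial>count_space A)"
  proof (rule SUP_least)
    fix G assume "G \<in> {G. finite G \<and> G \<subseteq> A}"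
    then have G: "finite G" "G \<subseteq> A" by auto
    have "sum f G = (\<integral>\<^sup>+x. f x \<partial>count_space G)"
      using G by (simp add: nn_integral_count_space_finite)
    also have "\<dots> = (\<integral>\<^sup>+x. f x * indicator G x \<partial>count_space A)"
      using G by (subst nn_integral_count_space_indicator) (auto simp: nn_integral_count_space_indicator indicator_def intro!: nn_integral_cong)
    also have "\<dots> \<le> (\<integral>\<^sup>+x. f x \<partial>count_space A)"
      by (intro nn_integral_mono) (auto simp: indicator_def)
    finally show "sum f G \<le> \<dots>" .
  qed
qed

lemma nn_integral_count_space_le:
  fixes f :: "'a \<Rightarrow> ennreal"
  assumes "countable A" "\<And>G. finite G \<Longrightarrow> G \<subseteq> A \<Longrightarrow> sum f G \<le> B"
  shows "(\<integral>\<^sup>+x. f x \<partial>count_space A) \<le> B"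
  unfolding nn_integral_count_space_eq_SUP[OF assms(1)] using assms(2) by (intro SUP_least) auto

lemma ennreal_le_sum3:
  "x \<le> a + b + c \<Longrightarrow> 0 \<le> a \<Longrightarrow> 0 \<le> b \<Longrightarrow> 0 \<le> c \<Longrightarrow> ennreal x \<le> ennreal a + ennreal b + ennreal c"
  by (simp add: ennreal_leI flip: ennreal_plus)

context adapted_family
begin

text \<open>The square of the operator called D in the overview: no root is taken, so a level
  \<sigma> of the square function corresponds to a level of order \<sigma>^2 here.\<close>

definition square_sum :: "(real ^ 'n \<Rightarrow> complex) \<Rightarrow> real ^ 'n \<Rightarrow> ennreal" where
  "square_sum g x = (\<integral>\<^sup>+Q. ennreal ((norm (pairing g Q))\<^sup>2 * bump Q x) \<partial>count_space UNIV)"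

lemma square_sum_eq_SUP:
  "square_sum g x = (SUP G\<in>{G. finite G}. ennreal (\<Sum>Q\<in>G. (norm (pairing g Q))\<^sup>2 * bump Q x))"
  unfolding square_sum_def by (subst nn_integral_count_space_eq_SUP) auto

text \<open>A supremum of finite sums of continuous functions is lower semicontinuous; this is where
  the continuity of the bumps enters.\<close>

lemma open_square_sum_level: "open {x. s < square_sum g x}"
proof -
  have "{x. s < square_sum g x} = (\<Union>G\<in>{G. finite G}. {x. s < ennreal (\<Sum>Q\<in>G. (norm (pairing g Q))\<^sup>2 * bump Q x)})"
    by (auto simp: square_sum_eq_SUP less_SUP_iff)
  also have "open \<dots>"
    by (intro open_UN ballI open_Collect_less continuous_on_const continuous_on_ennreal continuous_on_sum
        continuous_on_mult continuous_bump)
  finally show ?thesis .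
qed

lemma borel_measurable_square_sum [measurable]: "square_sum g \<in> borel_measurable borel"
  using open_square_sum_level by (intro borel_measurableI_greater) auto

definition carleson_const :: real where
  "carleson_const = (R + 1) ^ (CARD('n) + 1) * unit_ball_vol (real CARD('n)) * tent_const"

lemma carleson_const_nonneg: "0 \<le> carleson_const"
  unfolding carleson_const_def using R tent_const_nonneg by (intro mult_nonneg_nonneg) auto

text \<open>Integrating the bumps over F produces the sum of \<open>finite_tent_estimate\<close>: a
  cube whose bump is not identically 0 on F has a point of F within R + 1 sides of its
  center.\<close>

lemma tent_estimate:
  assumes g: "integrable lebesgue g" and "F \<noteq> {}" and [measurable]: "F \<in> sets lebesgue" and A0: "0 \<le> A"
    and A: "\<And>x r. x \<in> F \<Longrightarrow> 0 < r \<Longrightarrow>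
      mass g (cball x r) \<le> ennreal (A * r ^ CARD('n))"
  shows "(\<integral>\<^sup>+x\<in>F. square_sum g x \<partial>lebesgue)
    \<le> ennreal (carleson_const * A) * (\<integral>\<^sup>+x. ennreal (norm (g x)) \<partial>lebesgue)"
proof -
  let ?N = "CARD('n)"
  let ?b = "\<lambda>Q. (norm (pairing g Q))\<^sup>2"
  define C where "C = (R + 1) ^ (CARD('n) + 1) * unit_ball_vol (real CARD('n))"
  have C: "0 \<le> C" using R by (simp add: C_def)
  have [measurable]: "bump Q \<in> borel_measurable lebesgue" for Q
    by (simp add: measurable_completion)
  have bump_int: "(\<integral>\<^sup>+x\<in>F. ennreal (bump Q x) \<partial>lebesgue) \<le> ennreal (C * side Q ^ ?N)" for Q
  proof -
    have "(\<integral>\<^sup>+x\<in>F. ennreal (bump Q x) \<partial>lebesgue)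
        \<le> (\<integral>\<^sup>+x. ennreal (R + 1) * indicator (cball (center Q) ((R + 1) * side Q)) x \<partial>lebesgue)"
      using bump_eq_0[of Q] bump_le[of Q]
      by (intro nn_integral_mono) (auto simp: indicator_def dist_commute ennreal_leI)
    also have "\<dots> = ennreal (R + 1) * emeasure lebesgue (cball (center Q) ((R + 1) * side Q))"
      by (rule nn_integral_cmult_indicator) simp
    also have "\<dots> = ennreal (C * side Q ^ ?N)"
      using R by (simp add: emeasure_cball C_def power_mult_distrib mult_ac del: ennreal_plus flip: ennreal_mult)
    finally show ?thesis .
  qed
  have "(\<integral>\<^sup>+x\<in>F. square_sum g x \<partial>lebesgue)
      = (\<integral>\<^sup>+x. (\<integral>\<^sup>+Q. ennreal (?b Q * bump Q x) * indicator F x \<partial>count_space UNIV) \<partial>lebesgue)"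
    unfolding square_sum_def by (simp add: nn_integral_multc)
  also have "\<dots> = (\<integral>\<^sup>+Q. (\<integral>\<^sup>+x. ennreal (?b Q * bump Q x) * indicator F x \<partial>lebesgue) \<partial>count_space UNIV)"
    by (rule nn_integral_count_space_nn_integral) auto
  also have "\<dots> \<le> ennreal (carleson_const * A) * (\<integral>\<^sup>+x. ennreal (norm (g x)) \<partial>lebesgue)"
  proof (rule nn_integral_count_space_le)
    fix G :: "(int \<times> (int ^ 'n)) set" assume "finite G"
    let ?G = "{Q\<in>G. \<exists>p\<in>F. dist p (center Q) \<le> (R + 1) * side Q}"
    have "(\<Sum>Q\<in>G. \<integral>\<^sup>+x. ennreal (?b Q * bump Q x) * indicator F x \<partial>lebesgue)
        = (\<Sum>Q\<in>?G. \<integral>\<^sup>+x. ennreal (?b Q * bump Q x) * indicator F x \<partial>lebesgue)"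
    proof (intro sum.mono_neutral_right ballI)
      fix Q assume Q: "Q \<in> G - ?G"
      have *: "ennreal (?b Q * bump Q x) * indicator F x = 0" for x
      proof (cases "x \<in> F")
        case True
        then have "(R + 1) * side Q \<le> dist x (center Q)" using Q by force
        then show ?thesis by (simp add: bump_eq_0)
      qed simp
      show "(\<integral>\<^sup>+x. ennreal (?b Q * bump Q x) * indicator F x \<partial>lebesgue) = 0"
        unfolding * by simp
    qed (use \<open>finite G\<close> in auto)
    also have "\<dots> \<le> (\<Sum>Q\<in>?G. ennreal C * ennreal (?b Q * side Q ^ ?N))"
    proof (rule sum_mono)
      fix Q
      have "(\<integral>\<^sup>+x. ennreal (?b Q * bump Q x) * indicator F x \<partial>lebesgue)
          = ennreal (?b Q) * (\<integral>\<^sup>+x\<in>F. ennreal (bump Q x) \<partial>lebesgue)"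
        by (subst nn_integral_cmult[symmetric]) (auto simp: ennreal_mult mult_ac)
      also have "\<dots> \<le> ennreal (?b Q) * ennreal (C * side Q ^ ?N)"
        by (intro mult_left_mono bump_int) auto
      also have "\<dots> = ennreal C * ennreal (?b Q * side Q ^ ?N)"
        using C by (simp add: mult_ac flip: ennreal_mult)
      finally show "(\<integral>\<^sup>+x. ennreal (?b Q * bump Q x) * indicator F x \<partial>lebesgue) \<le> \<dots>" .
    qed
    also have "\<dots> = ennreal C * ennreal (\<Sum>Q\<in>?G. ?b Q * side Q ^ ?N)"
      unfolding sum_distrib_left[symmetric] by (subst sum_ennreal) auto
    also have "\<dots> \<le> ennreal C * (ennreal (tent_const * A) * (\<integral>\<^sup>+x. ennreal (norm (g x)) \<partial>lebesgue))"
      using \<open>finite G\<close> by (intro mult_left_mono finite_tent_estimate[OF g \<open>F \<noteq> {}\<close> A0 A]) auto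
    also have "\<dots> = ennreal (carleson_const * A) * (\<integral>\<^sup>+x. ennreal (norm (g x)) \<partial>lebesgue)"
      using C A0 tent_const_nonneg
      by (simp add: carleson_const_def C_def mult.assoc[symmetric] flip: ennreal_mult)
    finally show "(\<Sum>Q\<in>G. \<integral>\<^sup>+x. ennreal (?b Q * bump Q x) * indicator F x \<partial>lebesgue) \<le> \<dots>" .
  qed auto
  finally show ?thesis .
qed

section \<open>Pointwise bounds: distant mass and localisation\<close>

definition far_const :: real where
  "far_const = (R + 1) * K\<^sup>2 * ((2 * R + 1) ^ CARD('n))\<^sup>2 * overlap CARD('n) (R + 1) (real CARD('n))"

lemma far_const_nonneg: "0 \<le> far_const"
  unfolding far_const_def using R by (intro mult_nonneg_nonneg overlap_nonneg) auto

text \<open>A cube whose bump sees x and whose test function reaches \<open>S i\<close> satisfies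
  \<open>r i \<le> (2 * R + 1) * side Q\<close>. Each piece therefore meets only large cubes, over
  which the size bound K / side^n can be summed.\<close>

lemma square_sum_far:
  assumes [measurable]: "f \<in> borel_measurable lebesgue" "\<And>i. i \<in> I \<Longrightarrow> S i \<in> sets lebesgue"
    and "countable I" and r: "\<And>i. i \<in> I \<Longrightarrow> 0 < r i"
    and cover: "\<And>y. f y \<noteq> 0 \<Longrightarrow> \<exists>i\<in>I. y \<in> S i"
    and far: "\<And>i y. i \<in> I \<Longrightarrow> y \<in> S i \<Longrightarrow> f y \<noteq> 0 \<Longrightarrow> r i \<le> dist x y"
  shows "square_sum f x \<le> ennreal far_const *
    (\<integral>\<^sup>+i. ennreal (1 / r i ^ CARD('n)) * mass f (S i) \<partial>count_space I)\<^sup>2"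
proof -
  let ?N = "CARD('n)"
  define t where "t i = ennreal (1 / r i ^ ?N) * mass f (S i)" for i
  define T where "T = (\<integral>\<^sup>+i. t i \<partial>count_space I)"
  define a where "a Q i = (if r i \<le> (2 * R + 1) * side Q then (r i / side Q) ^ ?N else 0)"
    for Q :: "int \<times> (int ^ 'n)" and i
  define near where "near Q \<longleftrightarrow> dist x (center Q) \<le> (R + 1) * side Q" for Q
  have a0: "0 \<le> a Q i" if "i \<in> I" for Q i
    using r[OF that] by (simp add: a_def)
  have a_le: "a Q i \<le> (2 * R + 1) ^ ?N" if "i \<in> I" for Q i
    using r[OF that] R by (auto simp: a_def pos_divide_le_eq intro!: power_mono)
  have pair: "ennreal (norm (pairing f Q)) \<le> ennreal K * (\<integral>\<^sup>+i. ennreal (a Q i) * t i \<partial>count_space I)"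
    if "near Q" for Q
  proof -
    let ?B = "cball (center Q) (R * side Q)"
    have "mass f ?B
        \<le> (\<integral>\<^sup>+y. (\<integral>\<^sup>+i. ennreal (norm (f y)) * indicator ?B y * indicator (S i) y \<partial>count_space I) \<partial>lebesgue)"
    proof (rule nn_integral_mono)
      fix y
      show "ennreal (norm (f y)) * indicator ?B y
          \<le> (\<integral>\<^sup>+i. ennreal (norm (f y)) * indicator ?B y * indicator (S i) y \<partial>count_space I)"
      proof (cases "f y = 0")
        case False
        then obtain i where i: "i \<in> I" "y \<in> S i" using cover by blast
        have "ennreal (norm (f y)) * indicator ?B y = (\<Sum>i\<in>{i}. ennreal (norm (f y)) * indicator ?B y * indicator (S i) y)"
          using i by simp
        also have "\<dots> \<le> (\<integral>\<^sup>+i. ennreal (norm (f y)) * indicator ?B y * indicator (S i) y \<partial>count_space I)"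
          unfolding nn_integral_count_space_eq_SUP[OF \<open>countable I\<close>] using i by (intro SUP_upper) auto
        finally show ?thesis .
      qed simp
    qed
    also have "\<dots> = (\<integral>\<^sup>+i. (\<integral>\<^sup>+y. ennreal (norm (f y)) * indicator ?B y * indicator (S i) y \<partial>lebesgue) \<partial>count_space I)"
      using \<open>countable I\<close> by (intro nn_integral_count_space_nn_integral) auto
    finally have "ennreal (K / side Q ^ ?N) * mass f ?B
      \<le> (\<integral>\<^sup>+i. ennreal (K / side Q ^ ?N) * (\<integral>\<^sup>+y. ennreal (norm (f y)) * indicator ?B y * indicator (S i) y \<partial>lebesgue) \<partial>count_space I)"
      by (simp add: nn_integral_cmult mult_left_mono)
    also have "\<dots> \<le> (\<integral>\<^sup>+i. ennreal K * (ennreal (a Q i) * t i) \<partial>count_space I)"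
    proof (rule nn_integral_mono)
      fix i assume "i \<in> space (count_space I)"
      then have i: "i \<in> I" by simp
      show "ennreal (K / side Q ^ ?N) * (\<integral>\<^sup>+y. ennreal (norm (f y)) * indicator ?B y * indicator (S i) y \<partial>lebesgue)
          \<le> ennreal K * (ennreal (a Q i) * t i)"
      proof (cases "r i \<le> (2 * R + 1) * side Q")
        case True
        have "(\<integral>\<^sup>+y. ennreal (norm (f y)) * indicator ?B y * indicator (S i) y \<partial>lebesgue)
            \<le> mass f (S i)"
          by (intro nn_integral_mono) (auto simp: indicator_def)
        then have "ennreal (K / side Q ^ ?N) * (\<integral>\<^sup>+y. ennreal (norm (f y)) * indicator ?B y * indicator (S i) y \<partial>lebesgue)
            \<le> ennreal (K / side Q ^ ?N) * mass f (S i)"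
          by (rule mult_left_mono) simp
        moreover have "ennreal (K / side Q ^ ?N) = ennreal K * (ennreal (a Q i) * ennreal (1 / r i ^ ?N))"
          using True K r[OF i] by (simp add: a_def power_divide flip: ennreal_mult)
        ultimately show ?thesis by (simp only: t_def mult.assoc)
      next
        case False
        have *: "ennreal (norm (f y)) * indicator ?B y * indicator (S i) y = 0" for y
        proof (rule ccontr)
          assume "\<not> ?thesis"
          then have "y \<in> ?B" "y \<in> S i" "f y \<noteq> 0" by (auto simp: indicator_def split: if_splits)
          then have "r i \<le> (R + 1) * side Q + R * side Q"
            using far[OF i] that dist_triangle[of x y "center Q"] by (force simp: near_def)
          then show False using False by (simp add: algebra_simps)
        qed
        show ?thesis unfolding * by simp
      qed
    qed
    also have "\<dots> = ennreal K * (\<integral>\<^sup>+i. ennreal (a Q i) * t i \<partial>count_space I)"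
      by (rule nn_integral_cmult) simp
    finally show ?thesis
      using norm_pairing_le[OF assms(1), of Q] by (rule order_trans[rotated])
  qed
  have aT: "(\<integral>\<^sup>+i. ennreal (a Q i) * t i \<partial>count_space I) \<le> ennreal ((2 * R + 1) ^ ?N) * T" for Q
    unfolding T_def by (subst nn_integral_cmult[symmetric]) (auto intro!: nn_integral_mono mult_right_mono ennreal_leI a_le)
  define M where "M = ennreal ((R + 1) * K * (K * (2 * R + 1) ^ ?N)) * T"
  have "square_sum f x \<le> (\<integral>\<^sup>+Q. M * (\<integral>\<^sup>+i. of_bool (near Q) * ennreal (a Q i) * t i \<partial>count_space I) \<partial>count_space UNIV)"
    unfolding square_sum_def
  proof (rule nn_integral_mono)
    fix Q
    show "ennreal ((norm (pairing f Q))\<^sup>2 * bump Q x) \<le> M * (\<integral>\<^sup>+i. of_bool (near Q) * ennreal (a Q i) * t i \<partial>count_space I)"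
    proof (cases "near Q")
      case True
      have "ennreal ((norm (pairing f Q))\<^sup>2 * bump Q x) \<le> ennreal (norm (pairing f Q) * norm (pairing f Q) * (R + 1))"
        using bump_le by (intro ennreal_leI) (auto simp: power2_eq_square mult_left_mono)
      also have "\<dots> = ennreal (norm (pairing f Q)) * ennreal (norm (pairing f Q)) * ennreal (R + 1)"
        using R by (simp add: ennreal_mult)
      \<comment> \<open>One of the two factors is bounded by the full sum T and only the other is
        left to be summed over the cubes; together they produce the square of T.\<close>
      also have "\<dots> \<le> (ennreal K * (ennreal ((2 * R + 1) ^ ?N) * T)) *
          (ennreal K * (\<integral>\<^sup>+i. ennreal (a Q i) * t i \<partial>count_space I)) * ennreal (R + 1)"
        by (intro mult_mono mult_left_mono order_trans[OF pair[OF True]] aT order_refl) auto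
      also have "\<dots> = M * (\<integral>\<^sup>+i. of_bool (near Q) * ennreal (a Q i) * t i \<partial>count_space I)"
        using True K R by (simp add: M_def ennreal_mult mult_ac)
      finally show ?thesis .
    next
      case False
      then show ?thesis by (simp add: near_def bump_eq_0)
    qed
  qed
  also have "\<dots> = M * (\<integral>\<^sup>+Q. (\<integral>\<^sup>+i. of_bool (near Q) * ennreal (a Q i) * t i \<partial>count_space I) \<partial>count_space UNIV)"
    by (rule nn_integral_cmult) simp
  also have "(\<integral>\<^sup>+Q. (\<integral>\<^sup>+i. of_bool (near Q) * ennreal (a Q i) * t i \<partial>count_space I) \<partial>count_space UNIV)
      = (\<integral>\<^sup>+i. (\<integral>\<^sup>+Q. of_bool (near Q) * ennreal (a Q i) * t i \<partial>count_space UNIV) \<partial>count_space I)"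
    using \<open>countable I\<close> by (intro nn_integral_count_space_nn_integral) auto
  also have "\<dots> \<le> (\<integral>\<^sup>+i. ennreal ((2 * R + 1) ^ ?N * overlap ?N (R + 1) (real ?N)) * t i \<partial>count_space I)"
  proof (rule nn_integral_mono)
    fix i assume "i \<in> space (count_space I)"
    then have i: "i \<in> I" by simp
    have "(\<integral>\<^sup>+Q. of_bool (near Q) * ennreal (a Q i) \<partial>count_space UNIV) \<le> ennreal ((2 * R + 1) ^ ?N * overlap ?N (R + 1) (real ?N))"
    proof (rule nn_integral_count_space_le)
      fix G :: "(int \<times> (int ^ 'n)) set" assume "finite G"
      let ?G = "{Q\<in>G. r i / (2 * R + 1) \<le> side Q \<and> near Q}"
      have "(\<Sum>Q\<in>G. of_bool (near Q) * ennreal (a Q i)) = (\<Sum>Q\<in>G. ennreal (of_bool (near Q) * a Q i))"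
        by (intro sum.cong) auto
      also have "\<dots> = ennreal (\<Sum>Q\<in>G. of_bool (near Q) * a Q i)"
        using a0[OF i] by (intro sum_ennreal) auto
      also have "(\<Sum>Q\<in>G. of_bool (near Q) * a Q i) = (\<Sum>Q\<in>?G. of_bool (near Q) * a Q i)"
        using \<open>finite G\<close> R by (intro sum.mono_neutral_right) (auto simp: a_def pos_divide_le_eq mult.commute)
      also have "\<dots> = (\<Sum>Q\<in>?G. (2 * R + 1) ^ ?N * (r i / (2 * R + 1) / side Q) powr real ?N)"
        using R r[OF i] by (intro sum.cong) (auto simp: a_def pos_divide_le_eq mult.commute powr_realpow power_divide power_mult_distrib)
      also have "\<dots> = (2 * R + 1) ^ ?N * (\<Sum>Q\<in>?G. (r i / (2 * R + 1) / side Q) powr real ?N)"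
        by (simp add: sum_distrib_left)
      also have "\<dots> \<le> (2 * R + 1) ^ ?N * overlap ?N (R + 1) (real ?N)"
        using \<open>finite G\<close> R r[OF i]
        by (intro mult_left_mono sum_dyadic_large_scales[of _ _ _ _ x]) (auto simp: near_def)
      finally show "(\<Sum>Q\<in>G. of_bool (near Q) * ennreal (a Q i)) \<le> ennreal ((2 * R + 1) ^ ?N * overlap ?N (R + 1) (real ?N))"
        by (simp add: ennreal_leI)
    qed auto
    then show "(\<integral>\<^sup>+Q. of_bool (near Q) * ennreal (a Q i) * t i \<partial>count_space UNIV)
        \<le> ennreal ((2 * R + 1) ^ ?N * overlap ?N (R + 1) (real ?N)) * t i"
      by (simp add: nn_integral_multc mult_right_mono)
  qed
  also have "\<dots> = ennreal ((2 * R + 1) ^ ?N * overlap ?N (R + 1) (real ?N)) * T"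
    unfolding T_def by (rule nn_integral_cmult) simp
  also have "M * \<dots> = ennreal far_const * T\<^sup>2"
  proof -
    have "0 \<le> overlap ?N (R + 1) (real ?N)" using R by (intro overlap_nonneg) auto
    then show ?thesis
      using R K by (simp add: M_def far_const_def power2_eq_square mult_ac flip: ennreal_mult) 
  qed
  finally show ?thesis
    unfolding T_def t_def by (simp add: mult_left_mono)
qed

text \<open>12 bounds the distance of x and z in units of r, the squared factor bounds the
  coefficients per unit of A, and the overlap has exponent 1 because the bumps are
  Lipschitz.\<close>

definition drift_const :: real where
  "drift_const = 12 * (K * (2 * R + 3) ^ CARD('n))\<^sup>2 * overlap CARD('n) (R + 1) 1"

lemma drift_const_nonneg: "0 \<le> drift_const"
  unfolding drift_const_def using R by (intro mult_nonneg_nonneg overlap_nonneg) auto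

text \<open>Cubes of side below r that see x meet only the ball to which g is cut off. For larger
  cubes the bump at x exceeds the bump at z by at most 12 r / side, and the averages at p bound the
  coefficients. In the good-lambda argument z lies outside the level set, and p is a point where the
  maximal function is small.\<close>

lemma square_sum_localise:
  assumes g: "g \<in> borel_measurable lebesgue" and "0 < r" "0 \<le> A"
    and x: "dist x0 x \<le> r" "dist x z \<le> 12 * r" "dist p x \<le> 2 * r"
    and A: "\<And>s. 0 < s \<Longrightarrow> mass g (cball p s) \<le> ennreal (A * s ^ CARD('n))"
  shows "square_sum g x \<le> square_sum (\<lambda>y. g y * indicator (cball x0 ((2 * R + 2) * r)) y) x
    + square_sum g z + ennreal (drift_const * A\<^sup>2)"
proof -
  let ?N = "CARD('n)"
  let ?g = "\<lambda>y. g y * indicator (cball x0 ((2 * R + 2) * r)) y"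
  define M where "M = 12 * (K * (2 * R + 3) ^ ?N * A)\<^sup>2"
  define big where "big Q \<longleftrightarrow> r \<le> side Q \<and> dist x (center Q) \<le> (R + 1) * side Q" for Q
  have M0: "0 \<le> M" by (simp add: M_def)
  have "square_sum g x \<le> (\<integral>\<^sup>+Q. ennreal ((norm (pairing ?g Q))\<^sup>2 * bump Q x) + ennreal ((norm (pairing g Q))\<^sup>2 * bump Q z)
      + ennreal (of_bool (big Q) * (M * (r / side Q))) \<partial>count_space UNIV)"
    unfolding square_sum_def
  proof (rule nn_integral_mono)
    fix Q
    have "(norm (pairing g Q))\<^sup>2 * bump Q x \<le> (norm (pairing ?g Q))\<^sup>2 * bump Q x
       + (norm (pairing g Q))\<^sup>2 * bump Q z + of_bool (big Q) * (M * (r / side Q))"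
    proof (cases "dist x (center Q) \<le> (R + 1) * side Q")
      case near: True
      show ?thesis
      proof (cases "r \<le> side Q")
        case True
        have "norm (pairing g Q) \<le> K * (R + 3 + R) ^ ?N * A"
        proof (rule norm_pairing_le_maximal[OF g \<open>0 \<le> A\<close> A])
          show "dist p (center Q) \<le> (R + 3) * side Q"
            using x near True dist_triangle[of p "center Q" x] unfolding distrib_right by linarith
        qed (use R in auto)
        then have b: "(norm (pairing g Q))\<^sup>2 \<le> (K * (R + 3 + R) ^ ?N * A)\<^sup>2"
          by (intro power_mono) auto
        have "(norm (pairing g Q))\<^sup>2 * bump Q x \<le> (norm (pairing g Q))\<^sup>2 * (bump Q z + dist x z / side Q)"
          using bump_diff_le[of Q x z] by (intro mult_left_mono) auto
        also have "\<dots> = (norm (pairing g Q))\<^sup>2 * bump Q z + (norm (pairing g Q))\<^sup>2 * (dist x z / side Q)"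
          by (simp add: distrib_left)
        also have "(norm (pairing g Q))\<^sup>2 * (dist x z / side Q) \<le> (K * (R + 3 + R) ^ ?N * A)\<^sup>2 * (12 * r / side Q)"
          using x b by (intro mult_mono divide_right_mono) auto
        also have "\<dots> = of_bool (big Q) * (M * (r / side Q))"
          using True near by (simp add: big_def M_def add.commute)
        finally have "(norm (pairing g Q))\<^sup>2 * bump Q x
            \<le> (norm (pairing g Q))\<^sup>2 * bump Q z + of_bool (big Q) * (M * (r / side Q))"
          by simp
        moreover have "0 \<le> (norm (pairing ?g Q))\<^sup>2 * bump Q x" by simp
        ultimately show ?thesis by linarith
      next
        case False
        have "pairing g Q = pairing ?g Q"
          unfolding pairing_def
        proof (intro Bochner_Integration.integral_cong refl)
          fix y
          show "g y * \<phi> Q y = ?g y * \<phi> Q y"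
          proof (cases "\<phi> Q y = 0")
            case False
            then have "dist y (center Q) \<le> R * side Q" using supp not_le by blast
            then have "dist x0 y \<le> r + (R + 1) * side Q + R * side Q"
              using x near dist_triangle[of x0 y x] dist_triangle2[of x y "center Q"] by linarith
            also have "\<dots> \<le> r + (R + 1) * r + R * r"
              using R \<open>\<not> r \<le> side Q\<close> by (intro add_mono mult_left_mono) auto
            finally show ?thesis by (simp add: algebra_simps)
          qed simp
        qed
        then show ?thesis using M0 \<open>0 < r\<close> by (simp add: add_increasing2)
      qed
    next
      case False
      then show ?thesis using M0 \<open>0 < r\<close> by (simp add: bump_eq_0)
    qed
    then show "ennreal ((norm (pairing g Q))\<^sup>2 * bump Q x) \<le> ennreal ((norm (pairing ?g Q))\<^sup>2 * bump Q x)
       + ennreal ((norm (pairing g Q))\<^sup>2 * bump Q z) + ennreal (of_bool (big Q) * (M * (r / side Q)))"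
      by (rule ennreal_le_sum3) (use M0 \<open>0 < r\<close> in auto)
  qed
  also have "\<dots> = square_sum ?g x + square_sum g z
      + (\<integral>\<^sup>+Q. ennreal (of_bool (big Q) * (M * (r / side Q))) \<partial>count_space UNIV)"
    unfolding square_sum_def by (simp add: nn_integral_add)
  also have "(\<integral>\<^sup>+Q. ennreal (of_bool (big Q) * (M * (r / side Q))) \<partial>count_space UNIV) \<le> ennreal (drift_const * A\<^sup>2)"
  proof (rule nn_integral_count_space_le)
    fix G :: "(int \<times> (int ^ 'n)) set" assume "finite G"
    have "(\<Sum>Q\<in>G. of_bool (big Q) * (M * (r / side Q))) = (\<Sum>Q\<in>{Q\<in>G. big Q}. M * (r / side Q) powr 1)"
      using \<open>finite G\<close> \<open>0 < r\<close> by (intro sum.mono_neutral_cong_right) auto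
    also have "\<dots> = M * (\<Sum>Q\<in>{Q\<in>G. big Q}. (r / side Q) powr 1)"
      by (simp only: sum_distrib_left)
    also have "\<dots> \<le> M * overlap ?N (R + 1) 1"
      using \<open>finite G\<close> \<open>0 < r\<close> R M0
      by (intro mult_left_mono sum_dyadic_large_scales[of _ _ _ _ x]) (auto simp: big_def)
    also have "\<dots> = drift_const * A\<^sup>2"
      by (simp add: M_def drift_const_def power_mult_distrib)
    finally show "(\<Sum>Q\<in>G. ennreal (of_bool (big Q) * (M * (r / side Q)))) \<le> ennreal (drift_const * A\<^sup>2)"
      using M0 \<open>0 < r\<close> by (subst sum_ennreal) (auto intro: ennreal_leI)
  qed auto
  finally show ?thesis by (simp add: add_left_mono)
qed

end

section \<open>Muckenhoupt weights\<close>

lemma epowr_ennreal: "0 < x \<Longrightarrow> epowr (ennreal x) r = ennreal (x powr r)"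
  by (simp add: epowr_def)

lemma epowr_0: "0 < r \<Longrightarrow> epowr 0 r = 0"
  by (simp add: epowr_def)

lemma epowr_top: "0 < r \<Longrightarrow> epowr \<infinity> r = \<infinity>" "0 < r \<Longrightarrow> epowr top r = top"
  by (auto simp: epowr_def)

lemma borel_measurable_epowr:
  assumes "f \<in> borel_measurable M"
  shows "(\<lambda>x. epowr (f x) r) \<in> borel_measurable M"
proof -
  have "(\<lambda>y. epowr y r) \<in> borel_measurable borel"
  proof (cases "r = 0")
    case False
    then have "(\<lambda>y. epowr y r) = (\<lambda>y. if y \<in> {0} then if r < 0 then \<infinity> else 0 else
        if y \<in> {\<infinity>} then if r < 0 then 0 else \<infinity> else ennreal (enn2real y powr r))"
      by (auto simp: epowr_def fun_eq_iff)
    also have "\<dots> \<in> borel_measurable borel"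
      by (intro measurable_If_set measurable_const) auto
    finally show ?thesis .
  qed (simp add: epowr_def)
  then show ?thesis
    using assms by (rule measurable_compose[rotated])
qed

lemma ennreal_divide_le_imp_le_mult:
  assumes "0 < v" "x / ennreal v \<le> y" shows "x \<le> y * ennreal v"
proof -
  have "x = x * ennreal v / ennreal v"
    using assms(1) by (intro mult_divide_eq_ennreal[symmetric]) auto
  also have "\<dots> = x / ennreal v * ennreal v"
    by (simp only: ennreal_divide_times ennreal_times_divide)
  also have "\<dots> \<le> y * ennreal v"
    using assms(2) by (rule mult_right_mono) simp
  finally show ?thesis .
qed

lemma is_weight_nonneg: "is_weight w \<Longrightarrow> 0 \<le> w x"
  by (simp add: is_weight_def)

lemma is_weight_measurable [measurable_dest]: "is_weight w \<Longrightarrow> w \<in> borel_measurable lebesgue"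
  by (simp add: is_weight_def)

lemma wmeas_mono: "A \<subseteq> B \<Longrightarrow> wmeas w A \<le> wmeas w B"
  unfolding wmeas_def by (intro nn_integral_mono) (auto simp: indicator_def)

lemma wmeas_cball_finite:
  assumes "is_weight w" shows "wmeas w (cball z r) < \<infinity>"
proof -
  have "set_integrable lebesgue (cball z r) w"
    using assms unfolding is_weight_def by (meson compact_cball)
  then have "(\<integral>\<^sup>+x. ennreal (norm (indicator (cball z r) x *\<^sub>R w x)) \<partial>lebesgue) < \<infinity>"
    unfolding set_integrable_def integrable_iff_bounded by blast
  also have "(\<integral>\<^sup>+x. ennreal (norm (indicator (cball z r) x *\<^sub>R w x)) \<partial>lebesgue) = wmeas w (cball z r)"
    unfolding wmeas_def using is_weight_nonneg[OF assms]
    by (intro nn_integral_cong) (auto simp: indicator_def)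
  finally show ?thesis .
qed

lemma wmeas_ball_finite: "is_weight w \<Longrightarrow> wmeas w (ball z r) < \<infinity>"
  using wmeas_cball_finite[of w z r] wmeas_mono[OF ball_subset_cball, of w z r] by (auto intro: le_less_trans)

lemma AE_balls:
  fixes P :: "'a::euclidean_space \<Rightarrow> bool"
  assumes "\<And>n::nat. n0 \<le> n \<Longrightarrow> AE x in lebesgue. x \<in> ball 0 (real n) \<longrightarrow> P x"
  shows "AE x in lebesgue. P x"
proof -
  have "AE x in lebesgue. \<forall>n. n0 \<le> n \<longrightarrow> x \<in> ball 0 (real n) \<longrightarrow> P x"
    unfolding AE_all_countable using assms by auto
  then show ?thesis
  proof (rule AE_mp, intro AE_I2 impI)
    fix x :: 'a assume *: "\<forall>n. n0 \<le> n \<longrightarrow> x \<in> ball 0 (real n) \<longrightarrow> P x"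
    obtain m :: nat where "norm x < real m" using reals_Archimedean2 by blast
    with *[rule_format, of "max n0 m"] show "P x" by (auto simp: dist_norm less_max_iff_disj)
  qed
qed

lemma wmeas_eq_0_iff:
  assumes [measurable]: "is_weight w" "A \<in> sets lebesgue"
  shows "wmeas w A = 0 \<longleftrightarrow> (AE x in lebesgue. x \<in> A \<longrightarrow> w x = 0)"
proof -
  have "ennreal (w x) * indicator A x = 0 \<longleftrightarrow> (x \<in> A \<longrightarrow> w x = 0)" for x
    using is_weight_nonneg[OF assms(1), of x] by (auto simp: indicator_def ennreal_eq_0_iff)
  then show ?thesis
    unfolding wmeas_def by (subst nn_integral_0_iff_AE) auto
qed

lemma wmeas_large_ball_pos:
  assumes "is_weight w"
  obtains n0 :: nat where "\<And>n. n0 \<le> n \<Longrightarrow> wmeas w (ball 0 (real n)) \<noteq> 0"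
proof -
  have "\<exists>n0::nat. wmeas w (ball 0 (real n0)) \<noteq> 0"
  proof (rule ccontr)
    assume "\<not> ?thesis"
    then have "wmeas w (ball 0 (real n)) = 0" for n by blast
    then have "AE x in lebesgue. x \<in> ball 0 (real n) \<longrightarrow> w x = 0" for n
      using wmeas_eq_0_iff[OF assms sets_lebesgue_ball(1), of 0 "real n"] by blast
    then have "AE x in lebesgue. w x = 0"
      by (rule AE_balls)
    then show False using assms by (simp add: is_weight_def)
  qed
  then obtain n0 :: nat where n0: "wmeas w (ball 0 (real n0)) \<noteq> 0" by blast
  show ?thesis
  proof (rule that)
    fix n assume "n0 \<le> n"
    then have "wmeas w (ball 0 (real n0)) \<le> wmeas w (ball 0 (real n))"
      by (intro wmeas_mono) auto
    then show "wmeas w (ball 0 (real n)) \<noteq> 0" using n0 by auto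
  qed
qed

text \<open>
  The only consequence of the Muckenhoupt condition that is used: the average of g over a ball is
  controlled by its weighted \<open>L^s\<close> average. The average is normalised by \<open>r^n\<close> instead of the volume.
\<close>

definition avg_cond :: "real \<Rightarrow> (real ^ 'n \<Rightarrow> real) \<Rightarrow> real \<Rightarrow> bool" where
  "avg_cond s w C \<longleftrightarrow> 0 < C \<and> (\<forall>z r g a. 0 < r \<longrightarrow> 0 \<le> a \<longrightarrow> g \<in> borel_measurable lebesgue \<longrightarrow> (\<forall>x. 0 \<le> g x) \<longrightarrow>
     ennreal (a * r ^ CARD('n)) \<le> (\<integral>\<^sup>+x\<in>ball z r. ennreal (g x) \<partial>lebesgue) \<longrightarrow>
     ennreal (a powr s) * wmeas w (ball z r)
       \<le> ennreal C * (\<integral>\<^sup>+x\<in>ball z r. ennreal (g x powr s) * ennreal (w x) \<partial>lebesgue))"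

lemma avg_cond_D:
  fixes w :: "real ^ 'n \<Rightarrow> real"
  assumes "avg_cond s w C" "0 < r" "0 \<le> a" "g \<in> borel_measurable lebesgue" "\<And>x. 0 \<le> g x"
    "ennreal (a * r ^ CARD('n)) \<le> (\<integral>\<^sup>+x\<in>ball z r. ennreal (g x) \<partial>lebesgue)"
  shows "ennreal (a powr s) * wmeas w (ball z r)
       \<le> ennreal C * (\<integral>\<^sup>+x\<in>ball z r. ennreal (g x powr s) * ennreal (w x) \<partial>lebesgue)"
  using assms unfolding avg_cond_def by blast

text \<open>For every constant c essentially below w on the ball, c times the integral of g is at
  most the integral of g w; the supremum of these c is the essential infimum.\<close>

lemma muckenhoupt_1_imp_avg_cond:
  fixes w :: "real ^ 'n \<Rightarrow> real"
  assumes w: "w \<in> muckenhoupt 1"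
  shows "\<exists>C. avg_cond 1 w C"
proof -
  let ?N = "CARD('n)"
  define \<omega> where "\<omega> = unit_ball_vol (real ?N)"
  have \<omega>: "0 < \<omega>" by (simp add: \<omega>_def)
  have W: "is_weight w" using w by (simp add: muckenhoupt_def)
  note [measurable] = is_weight_measurable[OF W]
  obtain C where "0 < C" and C: "\<And>z r. 0 < r \<Longrightarrow> average (ball z r) (\<lambda>x. ennreal (w x))
      \<le> ennreal C * ess_inf_on (ball z r) (\<lambda>x. ennreal (w x))"
    using w unfolding muckenhoupt_def by auto
  have "avg_cond 1 w (C * \<omega>)"
    unfolding avg_cond_def
  proof (intro conjI allI impI)
    show "0 < C * \<omega>" using \<open>0 < C\<close> \<omega> by simp
    fix z r a and g :: "real ^ 'n \<Rightarrow> real"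
    assume r: "0 < r" and a: "0 \<le> a" and [measurable]: "g \<in> borel_measurable lebesgue" and g: "\<forall>x. 0 \<le> g x"
      and le: "ennreal (a * r ^ ?N) \<le> (\<integral>\<^sup>+x\<in>ball z r. ennreal (g x) \<partial>lebesgue)"
    define I where "I = (\<integral>\<^sup>+x\<in>ball z r. ennreal (g x powr 1) * ennreal (w x) \<partial>lebesgue)"
    have "c * ennreal (a * r ^ ?N) \<le> I" if c: "AE x in lebesgue. x \<in> ball z r \<longrightarrow> c \<le> ennreal (w x)" for c
    proof -
      have "c * ennreal (a * r ^ ?N) \<le> c * (\<integral>\<^sup>+x\<in>ball z r. ennreal (g x) \<partial>lebesgue)"
        by (intro mult_left_mono le) simp
      also have "\<dots> = (\<integral>\<^sup>+x. c * (ennreal (g x) * indicator (ball z r) x) \<partial>lebesgue)"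
        by (rule nn_integral_cmult[symmetric]) measurable
      also have "\<dots> \<le> I"
        unfolding I_def
      proof (rule nn_integral_mono_AE, rule AE_mp[OF c], intro AE_I2 impI)
        fix x assume "x \<in> ball z r \<longrightarrow> c \<le> ennreal (w x)"
        then show "c * (ennreal (g x) * indicator (ball z r) x)
            \<le> ennreal (g x powr 1) * ennreal (w x) * indicator (ball z r) x"
          using g by (auto simp: indicator_def mult.commute[of c] intro!: mult_left_mono)
      qed
      finally show ?thesis .
    qed
    then have ess: "ess_inf_on (ball z r) (\<lambda>x. ennreal (w x)) * ennreal (a * r ^ ?N) \<le> I"
      unfolding ess_inf_on_def
      using SUP_mult_right_ennreal[of "\<lambda>c. c" "{c. AE x in lebesgue. x \<in> ball z r \<longrightarrow> c \<le> ennreal (w x)}" "ennreal (a * r ^ ?N)"]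
      by (auto intro!: SUP_least)
    have "wmeas w (ball z r) / ennreal (\<omega> * r ^ ?N) \<le> ennreal C * ess_inf_on (ball z r) (\<lambda>x. ennreal (w x))"
      using C[OF r, of z] r by (simp add: average_def wmeas_def emeasure_ball \<omega>_def)
    then have "wmeas w (ball z r) \<le> ennreal C * ess_inf_on (ball z r) (\<lambda>x. ennreal (w x)) * ennreal (\<omega> * r ^ ?N)"
      using \<omega> r by (intro ennreal_divide_le_imp_le_mult) auto
    then have "ennreal a * wmeas w (ball z r)
        \<le> ennreal a * (ennreal C * ess_inf_on (ball z r) (\<lambda>x. ennreal (w x)) * ennreal (\<omega> * r ^ ?N))"
      by (rule mult_left_mono) simp
    also have "\<dots> = ennreal (C * \<omega>) * (ess_inf_on (ball z r) (\<lambda>x. ennreal (w x)) * ennreal (a * r ^ ?N))"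
      using a r \<omega> \<open>0 < C\<close> by (simp add: ennreal_mult mult_ac)
    also have "\<dots> \<le> ennreal (C * \<omega>) * I"
      by (intro mult_left_mono ess) simp
    finally show "ennreal (a powr 1) * wmeas w (ball z r) \<le> ennreal (C * \<omega>) *
        (\<integral>\<^sup>+x\<in>ball z r. ennreal (g x powr 1) * ennreal (w x) \<partial>lebesgue)"
      using a by (simp add: I_def)
  qed
  then show ?thesis by blast
qed

text \<open>Young's inequality without the sharp constants: the first term dominates when
  \<open>(\<tau> g)^(s - 1) w \<ge> 1\<close>, the second one otherwise.\<close>
lemma split_by_weight:
  fixes g w \<tau> s :: real
  assumes "0 \<le> g" "0 < w" "0 < \<tau>" "1 < s"
  shows "g \<le> \<tau> powr (s - 1) * (g powr s * w) + w powr (- 1 / (s - 1)) / \<tau>"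
proof (cases "g = 0")
  case False
  then have g: "0 < g" using assms by simp
  show ?thesis
  proof (cases "1 \<le> (\<tau> * g) powr (s - 1) * w")
    case True
    have "g * 1 \<le> g * ((\<tau> * g) powr (s - 1) * w)"
      using True g by (intro mult_left_mono) auto
    also have "\<dots> = \<tau> powr (s - 1) * ((g powr 1 * g powr (s - 1)) * w)"
      using g by (simp add: powr_mult)
    also have "g powr 1 * g powr (s - 1) = g powr s"
      by (simp only: powr_add[symmetric]) simp
    finally show ?thesis using assms by (simp add: add_increasing2)
  next
    case False
    then have "(\<tau> * g) powr (s - 1) < 1 / w"
      using assms by (simp add: pos_less_divide_eq)
    then have "((\<tau> * g) powr (s - 1)) powr (1 / (s - 1)) < (1 / w) powr (1 / (s - 1))"
      using assms by (intro powr_less_mono2) auto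
    then have "\<tau> * g < w powr (- 1 / (s - 1))"
      using assms g by (simp add: powr_powr powr_minus_divide powr_divide)
    then have "g < w powr (- 1 / (s - 1)) / \<tau>"
      using assms by (simp add: pos_less_divide_eq mult.commute)
    then show ?thesis using assms by (simp add: add_increasing)
  qed
qed (use assms in simp)

text \<open>In place of Hoelder's inequality, \<open>split_by_weight\<close> is integrated with a
  free parameter \<open>\<tau>\<close>. The dual integral V is absorbed into the left-hand side, and
  the Muckenhoupt product then eliminates it.\<close>

lemma muckenhoupt_gt_1_imp_avg_cond:
  fixes w :: "real ^ 'n \<Rightarrow> real"
  assumes w: "w \<in> muckenhoupt s" and s: "1 < s"
  shows "\<exists>C. avg_cond s w C"
proof -
  let ?N = "CARD('n)"
  define \<omega> where "\<omega> = unit_ball_vol (real ?N)"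
  have \<omega>: "0 < \<omega>" by (simp add: \<omega>_def)
  have W: "is_weight w" using w by (simp add: muckenhoupt_def)
  note [measurable] = is_weight_measurable[OF W]
  define v where "v x = epowr (ennreal (w x)) (- 1 / (s - 1))" for x
  have [measurable]: "v \<in> borel_measurable lebesgue" unfolding v_def by (rule borel_measurable_epowr) measurable
  define V where "V B = (\<integral>\<^sup>+x\<in>B. v x \<partial>lebesgue)" for B
  obtain C where "0 < C" and C: "\<And>z r. 0 < r \<Longrightarrow>
      (wmeas w (ball z r) / ennreal (\<omega> * r ^ ?N)) * epowr (V (ball z r) / ennreal (\<omega> * r ^ ?N)) (s - 1) \<le> ennreal C"
    using w s unfolding muckenhoupt_def
    by (auto simp: average_def wmeas_def emeasure_ball \<omega>_def V_def v_def)
  \<comment> \<open>On a ball of nonzero weight an infinite V would make the Muckenhoupt product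
    infinite; on a ball of weight 0 the product would be 0.\<close>
  have V_finite: "V (ball z r) < \<infinity>" if r: "0 < r" and "wmeas w (ball z r) \<noteq> 0" for z r
  proof (rule ccontr)
    assume "\<not> ?thesis"
    then have "V (ball z r) = top" using top.not_eq_extremum by (metis infinity_ennreal_def)
    then have "epowr (V (ball z r) / ennreal (\<omega> * r ^ ?N)) (s - 1) = top"
      using s \<omega> r by (simp add: ennreal_top_divide epowr_top)
    moreover have "wmeas w (ball z r) / ennreal (\<omega> * r ^ ?N) \<noteq> 0"
      using that \<omega> r ennreal_divide_le_imp_le_mult[of "\<omega> * r ^ ?N" "wmeas w (ball z r)" 0] by auto
    ultimately show False
      using C[OF r, of z] by (simp add: ennreal_mult_top top_unique)
  qed
  \<comment> \<open>v is infinite where w vanishes. Since V is finite on all large balls, w vanishes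
    only on a null set.\<close>
  have pos: "AE x in lebesgue. 0 < w x"
  proof -
    obtain n0 :: nat where n0: "\<And>n. n0 \<le> n \<Longrightarrow> wmeas w (ball 0 (real n)) \<noteq> 0"
      using wmeas_large_ball_pos[OF W] by blast
    show ?thesis
    proof (rule AE_balls[of "max n0 1"])
      fix n :: nat assume n: "max n0 1 \<le> n"
      then have "V (ball 0 (real n)) < \<infinity>" by (intro V_finite n0) auto
      then have "AE x in lebesgue. v x * indicator (ball 0 (real n)) x \<noteq> \<infinity>"
        unfolding V_def by (intro nn_integral_PInf_AE) auto
      then show "AE x in lebesgue. x \<in> ball 0 (real n) \<longrightarrow> 0 < w x"
      proof (rule AE_mp, intro AE_I2 impI)
        fix x assume "v x * indicator (ball 0 (real n)) x \<noteq> \<infinity>" "x \<in> ball 0 (real n)"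
        then have "v x \<noteq> \<infinity>" by simp
        then have "w x \<noteq> 0" using s by (auto simp: v_def epowr_def)
        then show "0 < w x" using is_weight_nonneg[OF W, of x] by simp
      qed
    qed
  qed
  have ball_not_null: "\<not> (AE x in lebesgue. x \<notin> ball z r)" if "0 < r" for z :: "real ^ 'n" and r
  proof
    assume "AE x in lebesgue. x \<notin> ball z r"
    then have "emeasure lebesgue (ball z r) = 0"
      by (subst (asm) AE_iff_measurable[OF sets_lebesgue_ball(1)[of z r]]) auto
    then show False using that \<omega> by (simp add: emeasure_ball \<omega>_def)
  qed
  have wpos: "wmeas w (ball z r) \<noteq> 0" if "0 < r" for z r
  proof
    assume "wmeas w (ball z r) = 0"
    then have "AE x in lebesgue. x \<in> ball z r \<longrightarrow> w x = 0"
      using wmeas_eq_0_iff[OF W] by simp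
    with pos have "AE x in lebesgue. x \<notin> ball z r" by eventually_elim auto
    with ball_not_null[OF that] show False by blast
  qed
  have Vpos: "V (ball z r) \<noteq> 0" if "0 < r" for z r
  proof
    assume "V (ball z r) = 0"
    then have "AE x in lebesgue. v x * indicator (ball z r) x = 0"
      unfolding V_def by (subst (asm) nn_integral_0_iff_AE) auto
    then have "AE x in lebesgue. x \<notin> ball z r"
    proof (rule AE_mp, intro AE_I2 impI)
      fix x assume *: "v x * indicator (ball z r) x = 0"
      have "v x \<noteq> 0" using s is_weight_nonneg[OF W, of x] by (auto simp: v_def epowr_def)
      with * show "x \<notin> ball z r" by (auto simp: indicator_def)
    qed
    with ball_not_null[OF that] show False by blast
  qed
  have "avg_cond s w ((2 * \<omega>) powr s * C)"
    unfolding avg_cond_def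
  proof (intro conjI allI impI)
    show "0 < (2 * \<omega>) powr s * C" using \<open>0 < C\<close> \<omega> by simp
    fix z r a and g :: "real ^ 'n \<Rightarrow> real"
    assume r: "0 < r" and a0: "0 \<le> a" and [measurable]: "g \<in> borel_measurable lebesgue" and g: "\<forall>x. 0 \<le> g x"
      and le: "ennreal (a * r ^ ?N) \<le> (\<integral>\<^sup>+x\<in>ball z r. ennreal (g x) \<partial>lebesgue)"
    define I where "I = (\<integral>\<^sup>+x\<in>ball z r. ennreal (g x powr s) * ennreal (w x) \<partial>lebesgue)"
    have "ennreal (a powr s) * wmeas w (ball z r) \<le> ennreal ((2 * \<omega>) powr s * C) * I"
    proof (cases "a = 0 \<or> I = \<infinity>")
      case True
      then show ?thesis using \<open>0 < C\<close> \<omega> s by (auto simp: ennreal_mult_top)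
    next
      case False
      then have a: "0 < a" and "I < \<infinity>" using a0 by (auto simp: less_top)
      then obtain i where i: "I = ennreal i" "0 \<le> i" by (cases I) auto
      have "V (ball z r) < \<infinity>" "V (ball z r) \<noteq> 0" using V_finite wpos Vpos r by auto
      then obtain b where b: "V (ball z r) = ennreal b" "0 < b"
        by (cases "V (ball z r)") (auto simp: less_le)
      have "wmeas w (ball z r) < \<infinity>" using wmeas_ball_finite[OF W] by blast
      then obtain c where c: "wmeas w (ball z r) = ennreal c" "0 \<le> c"
        by (cases "wmeas w (ball z r)") auto
      define m where "m = \<omega> * r ^ ?N"
      have m: "0 < m" using \<omega> r by (simp add: m_def)
      have "ennreal (c / m) * epowr (ennreal (b / m)) (s - 1) \<le> ennreal C"
        using C[OF r, of z] b c m by (simp add: m_def[symmetric] divide_ennreal)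
      then have cb: "c / m * (b / m) powr (s - 1) \<le> C"
        using b m c \<open>0 < C\<close> by (simp add: epowr_ennreal ennreal_le_iff flip: ennreal_mult)
      define A where "A = a * r ^ ?N"
      have A: "0 < A" using a r by (simp add: A_def)
      \<comment> \<open>With this \<open>\<tau>\<close> the dual term \<open>b / \<tau>\<close>
        equals A / 2.\<close>
      define \<tau> where "\<tau> = 2 * b / A"
      have \<tau>: "0 < \<tau>" using b A by (simp add: \<tau>_def)
      have "ennreal A \<le> (\<integral>\<^sup>+x\<in>ball z r. ennreal (g x) \<partial>lebesgue)" using le by (simp add: A_def)
      also have "\<dots> \<le> (\<integral>\<^sup>+x. ennreal (\<tau> powr (s - 1)) * (ennreal (g x powr s) * ennreal (w x) * indicator (ball z r) x)
          + ennreal (1 / \<tau>) * (v x * indicator (ball z r) x) \<partial>lebesgue)"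
      proof (rule nn_integral_mono_AE, rule AE_mp[OF pos], intro AE_I2 impI)
        fix x assume wx: "0 < w x"
        have "ennreal (g x) \<le> ennreal (\<tau> powr (s - 1) * (g x powr s * w x) + w x powr (- 1 / (s - 1)) / \<tau>)"
          using split_by_weight[OF _ wx \<tau> s] g by (intro ennreal_leI) auto
        also have "\<tau> powr (s - 1) * (g x powr s * w x) + w x powr (- 1 / (s - 1)) / \<tau>
            = \<tau> powr (s - 1) * (g x powr s * w x) + 1 / \<tau> * w x powr (- 1 / (s - 1))"
          by simp
        also have "ennreal \<dots> = ennreal (\<tau> powr (s - 1)) * (ennreal (g x powr s) * ennreal (w x)) + ennreal (1 / \<tau>) * v x"
          unfolding v_def epowr_ennreal[OF wx] using wx \<tau>
          by (subst ennreal_plus) (auto simp: ennreal_mult simp del: mult_1 times_divide_eq_left)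
        finally show "ennreal (g x) * indicator (ball z r) x
          \<le> ennreal (\<tau> powr (s - 1)) * (ennreal (g x powr s) * ennreal (w x) * indicator (ball z r) x)
          + ennreal (1 / \<tau>) * (v x * indicator (ball z r) x)"
          by (simp add: indicator_def)
      qed
      also have "\<dots> = ennreal (\<tau> powr (s - 1)) * I + ennreal (1 / \<tau>) * V (ball z r)"
        unfolding I_def V_def by (subst nn_integral_add) (auto simp: nn_integral_cmult)
      finally have "A \<le> \<tau> powr (s - 1) * i + 1 / \<tau> * b"
        using i b \<tau> by (simp add: ennreal_le_iff flip: ennreal_mult ennreal_plus)
      then have half: "A \<le> 2 * ((2 * b / A) powr (s - 1) * i)"
        using b A by (simp add: \<tau>_def)
      have "A powr s = A powr (s - 1) * A"
        using A by (simp add: powr_diff)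
      also have "\<dots> \<le> A powr (s - 1) * (2 * ((2 * b / A) powr (s - 1) * i))"
        by (intro mult_left_mono half) simp
      also have "\<dots> = 2 * ((A * (2 * b / A)) powr (s - 1) * i)"
        by (simp only: powr_mult mult_ac)
      also have "\<dots> = 2 * 2 powr (s - 1) * (b powr (s - 1) * i)"
        using A by (simp add: powr_mult)
      also have "2 * 2 powr (s - 1) = (2::real) powr s"
        by (simp add: powr_diff)
      finally have As: "A powr s \<le> 2 powr s * (b powr (s - 1) * i)" .
      then have "A powr s * c \<le> 2 powr s * i * (c * b powr (s - 1))"
        using mult_right_mono[OF As c(2)] by (simp only: mult_ac)
      also have "c * b powr (s - 1) \<le> C * m powr s"
      proof -
        have "c * b powr (s - 1) = (c / m * (b / m) powr (s - 1)) * (m powr 1 * m powr (s - 1))"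
          using m by (simp add: powr_divide)
        also have "\<dots> \<le> C * (m powr 1 * m powr (s - 1))"
          by (intro mult_right_mono cb) simp
        also have "m powr 1 * m powr (s - 1) = m powr s"
          by (simp only: powr_add[symmetric]) simp
        finally show ?thesis .
      qed
      finally have "A powr s * c \<le> 2 powr s * i * (C * m powr s)"
        using i by (simp add: mult_left_mono)
      then have "a powr s * c * (r ^ ?N) powr s \<le> (2 * \<omega>) powr s * C * i * (r ^ ?N) powr s"
        by (simp add: A_def m_def powr_mult mult_ac)
      then have "a powr s * c \<le> (2 * \<omega>) powr s * C * i"
        using r by (subst (asm) mult_le_cancel_right) auto
      then show ?thesis
        using i c \<open>0 < C\<close> by (simp add: ennreal_leI flip: ennreal_mult)
    qed
    then show "ennreal (a powr s) * wmeas w (ball z r) \<le> ennreal ((2 * \<omega>) powr s * C) *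
        (\<integral>\<^sup>+x\<in>ball z r. ennreal (g x powr s) * ennreal (w x) \<partial>lebesgue)"
      by (simp add: I_def)
  qed
  then show ?thesis by blast
qed

lemma muckenhoupt_imp_avg_cond:
  fixes w :: "real ^ 'n \<Rightarrow> real"
  assumes "w \<in> muckenhoupt s" "1 \<le> s"
  obtains C where "avg_cond s w C"
proof (cases "s = 1")
  case True
  then show ?thesis using assms(1) muckenhoupt_1_imp_avg_cond that by blast
next
  case False
  then have "1 < s" using assms(2) by simp
  then show ?thesis using assms(1) muckenhoupt_gt_1_imp_avg_cond that by blast
qed

text \<open>The inclusion of A_s in A_q by truncation: values of g below a small multiple of a
  contribute at most half of the average, and above it g^s is at most a constant times a^(s - q)
  g^q.\<close>

lemma avg_cond_mono:
  fixes w :: "real ^ 'n \<Rightarrow> real"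
  assumes A: "avg_cond s w C" and sq: "1 \<le> s" "s \<le> q" and W: "is_weight w"
  obtains C' where "avg_cond q w C'"
proof -
  let ?N = "CARD('n)"
  note [measurable] = is_weight_measurable[OF W]
  define \<omega> where "\<omega> = unit_ball_vol (real ?N)"
  have \<omega>: "0 < \<omega>" by (simp add: \<omega>_def)
  have C: "0 < C" using A by (simp add: avg_cond_def)
  \<comment> \<open>The discarded values contribute at most \<epsilon> a \<omega> r^n, which is half
    of a r^n.\<close>
  define \<epsilon> where "\<epsilon> = 1 / (2 * \<omega>)"
  have \<epsilon>: "0 < \<epsilon>" using \<omega> by (simp add: \<epsilon>_def)
  define C' where "C' = C * 2 powr s * \<epsilon> powr (s - q)"
  have "avg_cond q w C'"
    unfolding avg_cond_def
  proof (intro conjI allI impI)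
    show "0 < C'" using C \<epsilon> by (simp add: C'_def)
    fix z r a and g :: "real ^ 'n \<Rightarrow> real"
    assume r: "0 < r" and a0: "0 \<le> a" and [measurable]: "g \<in> borel_measurable lebesgue" and g: "\<forall>x. 0 \<le> g x"
      and le: "ennreal (a * r ^ ?N) \<le> (\<integral>\<^sup>+x\<in>ball z r. ennreal (g x) \<partial>lebesgue)"
    define I where "I = (\<integral>\<^sup>+x\<in>ball z r. ennreal (g x powr q) * ennreal (w x) \<partial>lebesgue)"
    show "ennreal (a powr q) * wmeas w (ball z r) \<le> ennreal C' *
        (\<integral>\<^sup>+x\<in>ball z r. ennreal (g x powr q) * ennreal (w x) \<partial>lebesgue)"
    proof (cases "a = 0")
      case False
      then have a: "0 < a" using a0 by simp
      define h where "h x = (if \<epsilon> * a < g x then g x else 0)" for x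
      have [measurable]: "h \<in> borel_measurable lebesgue" unfolding h_def by measurable
      have "ennreal (a * r ^ ?N) \<le> (\<integral>\<^sup>+x. ennreal (h x) * indicator (ball z r) x + ennreal (\<epsilon> * a) * indicator (ball z r) x \<partial>lebesgue)"
        by (rule order_trans[OF le], intro nn_integral_mono)
          (use \<epsilon> a in \<open>auto simp: indicator_def h_def ennreal_leI\<close>)
      also have "\<dots> = (\<integral>\<^sup>+x\<in>ball z r. ennreal (h x) \<partial>lebesgue) + ennreal (\<epsilon> * a) * emeasure lebesgue (ball z r)"
        by (subst nn_integral_add) (auto simp: nn_integral_cmult_indicator)
      also have "ennreal (\<epsilon> * a) * emeasure lebesgue (ball z r) = ennreal (a / 2 * r ^ ?N)"
        using r \<epsilon> a \<omega> by (simp add: emeasure_ball \<epsilon>_def flip: \<omega>_def ennreal_mult)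
      finally have "ennreal (a / 2 * r ^ ?N) + ennreal (a / 2 * r ^ ?N) \<le> (\<integral>\<^sup>+x\<in>ball z r. ennreal (h x) \<partial>lebesgue) + ennreal (a / 2 * r ^ ?N)"
        using a r by (subst ennreal_plus[symmetric]) auto
      then have "ennreal (a / 2 * r ^ ?N) \<le> (\<integral>\<^sup>+x\<in>ball z r. ennreal (h x) \<partial>lebesgue)"
        by (simp add: add.commute[of _ "ennreal (a / 2 * r ^ ?N)"] ennreal_add_left_cancel_le)
      then have "ennreal ((a / 2) powr s) * wmeas w (ball z r)
          \<le> ennreal C * (\<integral>\<^sup>+x\<in>ball z r. ennreal (h x powr s) * ennreal (w x) \<partial>lebesgue)"
        using a g by (intro avg_cond_D[OF A r]) (auto simp: h_def)
      also have "\<dots> \<le> ennreal C * (\<integral>\<^sup>+x. ennreal ((\<epsilon> * a) powr (s - q)) * (ennreal (g x powr q) * ennreal (w x) * indicator (ball z r) x) \<partial>lebesgue)"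
      proof (intro mult_left_mono nn_integral_mono)
        fix x
        have "h x powr s \<le> (\<epsilon> * a) powr (s - q) * g x powr q"
        proof (cases "\<epsilon> * a < g x")
          case True
          have "g x powr (s - q) \<le> (\<epsilon> * a) powr (s - q)"
            using True \<epsilon> a sq by (intro powr_mono2') auto
          then have "g x powr (s - q) * g x powr q \<le> (\<epsilon> * a) powr (s - q) * g x powr q"
            by (rule mult_right_mono) simp
          then show ?thesis using True by (simp add: h_def flip: powr_add)
        qed (use sq in \<open>simp add: h_def\<close>)
        then have "ennreal (h x powr s) \<le> ennreal ((\<epsilon> * a) powr (s - q)) * ennreal (g x powr q)"
          by (simp add: ennreal_leI flip: ennreal_mult)
        then show "ennreal (h x powr s) * ennreal (w x) * indicator (ball z r) x
          \<le> ennreal ((\<epsilon> * a) powr (s - q)) * (ennreal (g x powr q) * ennreal (w x) * indicator (ball z r) x)"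
          by (auto simp: indicator_def mult.assoc[symmetric] intro!: mult_right_mono)
      qed simp
      also have "\<dots> = ennreal C * (ennreal ((\<epsilon> * a) powr (s - q)) * I)"
        unfolding I_def by (subst nn_integral_cmult) auto
      finally have "ennreal (2 powr s * a powr (q - s)) * (ennreal ((a / 2) powr s) * wmeas w (ball z r))
          \<le> ennreal (2 powr s * a powr (q - s)) * (ennreal C * (ennreal ((\<epsilon> * a) powr (s - q)) * I))"
        by (rule mult_left_mono) simp
      also have "ennreal (2 powr s * a powr (q - s)) * (ennreal ((a / 2) powr s) * wmeas w (ball z r))
          = ennreal (a powr q) * wmeas w (ball z r)"
        by (simp add: mult.assoc[symmetric] powr_divide flip: ennreal_mult powr_add)
      also have "ennreal (2 powr s * a powr (q - s)) * (ennreal C * (ennreal ((\<epsilon> * a) powr (s - q)) * I))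
          = ennreal C' * I"
      proof -
        have "a powr (q - s) * a powr (s - q) = 1" using a by (simp flip: powr_add)
        then have "2 powr s * a powr (q - s) * (C * (\<epsilon> * a) powr (s - q)) = C'"
          by (simp add: C'_def powr_mult mult_ac)
        then show ?thesis using C by (simp add: mult.assoc[symmetric] flip: ennreal_mult)
      qed
      finally show ?thesis by (simp add: I_def)
    qed simp
  qed
  then show ?thesis by (rule that)
qed

text \<open>The condition for an indicator: a subset with a fixed share of the volume carries a
  fixed share of the weight. Doubling, reverse doubling and the good-lambda step all use it in this
  form.\<close>

lemma avg_cond_set:
  fixes w :: "real ^ 'n \<Rightarrow> real"
  assumes "avg_cond s w C" "0 < s" "0 < r" "0 \<le> a" and [measurable]: "E \<in> sets lebesgue" and E: "E \<subseteq> ball z r"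
    and "ennreal (a * r ^ CARD('n)) \<le> emeasure lebesgue E"
  shows "ennreal (a powr s) * wmeas w (ball z r) \<le> ennreal C * wmeas w E"
proof -
  have 1: "(\<integral>\<^sup>+x\<in>ball z r. ennreal (indicator E x) \<partial>lebesgue) = emeasure lebesgue E"
  proof -
    have "ennreal (indicator E x) * indicator (ball z r) x = indicator E x" for x
      using E by (auto simp: indicator_def)
    then have "(\<lambda>x. ennreal (indicator E x) * indicator (ball z r) x) = indicator E"
      by (rule ext)
    then show ?thesis by (simp only: nn_integral_indicator[OF assms(5)])
  qed
  have 2: "(\<integral>\<^sup>+x\<in>ball z r. ennreal (indicator E x powr s) * ennreal (w x) \<partial>lebesgue) = wmeas w E"
    unfolding wmeas_def using E by (auto intro!: nn_integral_cong simp: indicator_def)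
  show ?thesis
    using avg_cond_D[OF assms(1,3,4), of "indicator E" z] assms(7) unfolding 1 2 by simp
qed

text \<open>Some large ball around 0 has positive weight, since w is not almost everywhere 0, and
  the given ball fills a positive share of its volume.\<close>

lemma wmeas_ball_pos:
  fixes w :: "real ^ 'n \<Rightarrow> real"
  assumes "avg_cond s w C" "0 < s" "is_weight w" "0 < r"
  shows "0 < wmeas w (ball z r)"
proof -
  obtain n0 :: nat where n0: "\<And>n. n0 \<le> n \<Longrightarrow> wmeas w (ball 0 (real n)) \<noteq> 0"
    using wmeas_large_ball_pos[OF assms(3)] by blast
  obtain n1 :: nat where n1: "norm z + r < real n1" using reals_Archimedean2 by blast
  define n where "n = max n0 n1"
  have n: "norm z + r < real n" "n0 \<le> n" using n1 by (auto simp: n_def)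
  then have n_pos: "0 < real n" using \<open>0 < r\<close> norm_ge_zero[of z] by linarith
  define a where "a = unit_ball_vol (real CARD('n)) * (r / real n) ^ CARD('n)"
  have a: "0 < a" using n_pos \<open>0 < r\<close> by (simp add: a_def)
  have "ennreal (a powr s) * wmeas w (ball 0 (real n)) \<le> ennreal C * wmeas w (ball z r)"
  proof (rule avg_cond_set[OF assms(1,2)])
    show "ball z r \<subseteq> ball 0 (real n)" using n by (simp add: ball_subset_ball_iff)
    show "ennreal (a * real n ^ CARD('n)) \<le> emeasure lebesgue (ball z r)"
      using n_pos \<open>0 < r\<close> by (simp add: emeasure_ball a_def power_divide)
  qed (use a n_pos in auto)
  moreover have "0 < ennreal (a powr s) * wmeas w (ball 0 (real n))"
    using a n0[OF n(2)] by (simp add: ennreal_zero_less_mult_iff zero_less_iff_neq_zero)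
  ultimately have "0 < ennreal C * wmeas w (ball z r)" by (rule less_le_trans[rotated])
  then show ?thesis by (simp add: ennreal_zero_less_mult_iff)
qed

section \<open>The maximal function and the good-lambda inequality\<close>

lemma nn_set_integral_UN_le:
  assumes [measurable]: "h \<in> borel_measurable M" "\<And>i. i \<in> I \<Longrightarrow> A i \<in> sets M" and "countable I"
    and S: "S \<subseteq> (\<Union>i\<in>I. A i)"
  shows "(\<integral>\<^sup>+y\<in>S. h y \<partial>M) \<le> (\<integral>\<^sup>+i. (\<integral>\<^sup>+y\<in>A i. h y \<partial>M) \<partial>count_space I)"
proof -
  have "(\<integral>\<^sup>+y\<in>S. h y \<partial>M) \<le> (\<integral>\<^sup>+y. (\<integral>\<^sup>+i. h y * indicator (A i) y \<partial>count_space I) \<partial>M)"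
  proof (rule nn_integral_mono)
    fix y
    show "h y * indicator S y \<le> (\<integral>\<^sup>+i. h y * indicator (A i) y \<partial>count_space I)"
    proof (cases "y \<in> S")
      case True
      then obtain i where i: "i \<in> I" "y \<in> A i" using S by blast
      have "h y = (\<Sum>i\<in>{i}. h y * indicator (A i) y)" using i by simp
      also have "\<dots> \<le> (\<integral>\<^sup>+i. h y * indicator (A i) y \<partial>count_space I)"
        unfolding nn_integral_count_space_eq_SUP[OF \<open>countable I\<close>] using i by (intro SUP_upper) auto
      finally show ?thesis using True by simp
    qed simp
  qed
  also have "\<dots> = (\<integral>\<^sup>+i. (\<integral>\<^sup>+y\<in>A i. h y \<partial>M) \<partial>count_space I)"
    using \<open>countable I\<close> by (intro nn_integral_count_space_nn_integral) auto
  finally show ?thesis .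
qed

lemma nn_set_integral_disjoint_le:
  assumes [measurable]: "h \<in> borel_measurable M" "\<And>i. i \<in> I \<Longrightarrow> A i \<in> sets M" and "countable I"
    and disj: "disjoint_family_on A I" and S: "\<And>i. i \<in> I \<Longrightarrow> A i \<subseteq> S"
  shows "(\<integral>\<^sup>+i. (\<integral>\<^sup>+y\<in>A i. h y \<partial>M) \<partial>count_space I) \<le> (\<integral>\<^sup>+y\<in>S. h y \<partial>M)"
proof -
  have "(\<integral>\<^sup>+i. (\<integral>\<^sup>+y\<in>A i. h y \<partial>M) \<partial>count_space I) = (\<integral>\<^sup>+y. (\<integral>\<^sup>+i. h y * indicator (A i) y \<partial>count_space I) \<partial>M)"
    using \<open>countable I\<close> by (intro nn_integral_count_space_nn_integral[symmetric]) auto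
  also have "\<dots> \<le> (\<integral>\<^sup>+y\<in>S. h y \<partial>M)"
  proof (intro nn_integral_mono nn_integral_count_space_le[OF \<open>countable I\<close>])
    fix y G assume G: "finite G" "G \<subseteq> I"
    show "(\<Sum>i\<in>G. h y * indicator (A i) y) \<le> h y * indicator S y"
    proof (cases "\<exists>i\<in>G. y \<in> A i")
      case True
      then obtain i where i: "i \<in> G" "y \<in> A i" by blast
      have "(\<Sum>i\<in>G. h y * indicator (A i) y) = (\<Sum>i\<in>{i}. h y * indicator (A i) y)"
      proof (rule sum.mono_neutral_right)
        show "\<forall>j\<in>G - {i}. h y * indicator (A j) y = 0"
        proof
          fix j assume j: "j \<in> G - {i}"
          then have "A j \<inter> A i = {}" using disj i G unfolding disjoint_family_on_def by blast
          then have "y \<notin> A j" using i by blast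
          then show "h y * indicator (A j) y = 0" by simp
        qed
      qed (use G i in auto)
      also have "\<dots> \<le> h y * indicator S y" using i S G by (auto simp: indicator_def)
      finally show ?thesis .
    next
      case False
      then have "(\<Sum>i\<in>G. h y * indicator (A i) y) = 0" by (intro sum.neutral) auto
      then show ?thesis by simp
    qed
  qed
  finally show ?thesis .
qed

lemma wmeas_UN_le:
  fixes w :: "real ^ 'n \<Rightarrow> real"
  assumes "is_weight w" "\<And>i. i \<in> I \<Longrightarrow> A i \<in> sets lebesgue" "countable I" "S \<subseteq> (\<Union>i\<in>I. A i)"
  shows "wmeas w S \<le> (\<integral>\<^sup>+i. wmeas w (A i) \<partial>count_space I)"
  unfolding wmeas_def using is_weight_measurable[OF assms(1)]
  by (intro nn_set_integral_UN_le assms) auto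

lemma wmeas_Un_le:
  fixes w :: "real ^ 'n \<Rightarrow> real"
  assumes "is_weight w" "A \<in> sets lebesgue" "B \<in> sets lebesgue" "S \<subseteq> A \<union> B"
  shows "wmeas w S \<le> wmeas w A + wmeas w B"
proof -
  note [measurable] = is_weight_measurable[OF assms(1)] assms(2,3)
  have "wmeas w S \<le> (\<integral>\<^sup>+x. ennreal (w x) * indicator A x + ennreal (w x) * indicator B x \<partial>lebesgue)"
    unfolding wmeas_def using assms(4)
    by (intro nn_integral_mono) (auto simp: indicator_def)
  also have "\<dots> = wmeas w A + wmeas w B"
    unfolding wmeas_def by (rule nn_integral_add) measurable
  finally show ?thesis .
qed

text \<open>Doubling with an explicit power: the small ball fills the share t^(-n) of the large one,
  so the loss is of order t^(n q). Through \<open>ball_weight_growth\<close> this exponent decides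
  the critical \<alpha>.\<close>

lemma wmeas_ball_scale:
  fixes w :: "real ^ 'n \<Rightarrow> real"
  assumes A: "avg_cond q w C" and "0 < q" "0 < r" "1 \<le> t"
  shows "wmeas w (ball z (t * r)) \<le> ennreal (C * (t ^ CARD('n) / unit_ball_vol (real CARD('n))) powr q) * wmeas w (ball z r)"
proof -
  let ?\<omega> = "unit_ball_vol (real CARD('n))"
  let ?a = "?\<omega> / t ^ CARD('n)"
  have C: "0 < C" using A by (simp add: avg_cond_def)
  have t: "0 < t" using \<open>1 \<le> t\<close> by simp
  have "ennreal (?a powr q) * wmeas w (ball z (t * r)) \<le> ennreal C * wmeas w (ball z r)"
    using assms t by (intro avg_cond_set[OF A \<open>0 < q\<close>])
      (auto simp: emeasure_ball power_mult_distrib subset_ball mult_left_mono)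
  then have "ennreal ((1 / ?a) powr q) * (ennreal (?a powr q) * wmeas w (ball z (t * r)))
      \<le> ennreal ((1 / ?a) powr q) * (ennreal C * wmeas w (ball z r))"
    by (rule mult_left_mono) simp
  moreover have "ennreal ((1 / ?a) powr q) * ennreal (?a powr q) = 1"
  proof -
    have "(1 / ?a) powr q * ?a powr q = ((1 / ?a) * ?a) powr q" by (rule powr_mult[symmetric])
    also have "(1 / ?a) * ?a = 1" using t less_imp_neq[of 0 ?\<omega>] by simp
    finally show ?thesis by (simp flip: ennreal_mult)
  qed
  moreover have "ennreal ((1 / ?a) powr q) * ennreal C = ennreal (C * (t ^ CARD('n) / ?\<omega>) powr q)"
    using C by (simp add: mult.commute flip: ennreal_mult)
  ultimately show ?thesis by (simp only: mult.assoc[symmetric] mult_1)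
qed

text \<open>The superlevel set of the uncentred Hardy-Littlewood maximal function, with averages
  normalised by r^n.\<close>

definition max_set :: "(real ^ 'n \<Rightarrow> complex) \<Rightarrow> real \<Rightarrow> (real ^ 'n) set" where
  "max_set g a = (\<Union>(z, r)\<in>{(z, r). 0 < r \<and> ennreal (a * r ^ CARD('n)) < mass g (ball z r)}. ball z r)"

lemma open_max_set: "open (max_set g a)"
  unfolding max_set_def by auto

lemma notin_max_set:
  fixes x :: "real ^ 'n"
  assumes "x \<notin> max_set g a" "0 < r"
  shows "mass g (cball x r) \<le> ennreal (2 ^ CARD('n) * a * r ^ CARD('n))"
proof -
  have "mass g (cball x r) \<le> mass g (ball x (2 * r))"
    using \<open>0 < r\<close> by (intro nn_integral_mono) (auto simp: indicator_def)
  also have "\<dots> \<le> ennreal (a * (2 * r) ^ CARD('n))"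
  proof (rule ccontr)
    assume "\<not> ?thesis"
    then have "x \<in> max_set g a"
      using \<open>0 < r\<close> unfolding max_set_def by (intro UN_I[of "(x, 2 * r)"]) auto
    then show False using assms by simp
  qed
  finally show ?thesis by (simp add: power_mult_distrib mult_ac)
qed

definition max_const :: "nat \<Rightarrow> real \<Rightarrow> real \<Rightarrow> real" where
  "max_const N q C = C * (5 ^ N / unit_ball_vol (real N)) powr q * C"

text \<open>Vitali's lemma selects disjoint balls whose five-fold dilates cover the set. Doubling
  removes the dilation, and \<open>avg_cond\<close> bounds the weight of each selected ball by the
  integral over it.\<close>

lemma maximal_weak_type:
  fixes w :: "real ^ 'n \<Rightarrow> real"
  assumes A: "avg_cond q w C" and "0 < q" and W: "is_weight w" and g: "integrable lebesgue g" and "0 < a"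
  shows "wmeas w (max_set g a) \<le> ennreal (max_const CARD('n) q C * a powr (- q)) *
    (\<integral>\<^sup>+x. ennreal (norm (g x) powr q) * ennreal (w x) \<partial>lebesgue)"
proof -
  let ?N = "CARD('n)"
  note [measurable] = is_weight_measurable[OF W] borel_measurable_integrable[OF g]
  have C: "0 < C" using A by (simp add: avg_cond_def)
  define h where "h x = ennreal (norm (g x) powr q) * ennreal (w x)" for x
  have [measurable]: "h \<in> borel_measurable lebesgue" unfolding h_def by measurable
  define S where "S = {(z :: real ^ 'n, r). 0 < r \<and> ennreal (a * r ^ ?N) < mass g (ball z r)}"
  define L where "L = (LINT x|lebesgue. norm (g x))"
  have L: "(\<integral>\<^sup>+y. ennreal (norm (g y)) \<partial>lebesgue) = ennreal L" "0 \<le> L"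
    unfolding L_def using g by (auto intro: nn_integral_eq_integral)
  \<comment> \<open>Vitali's lemma requires bounded radii; integrability of g provides them, since
    r^n < L / a.\<close>
  have r_bound: "0 < snd i \<and> snd i \<le> max 1 (L / a)" if i: "i \<in> S" for i
  proof -
    obtain z r where zr: "i = (z, r)" by force
    have r: "0 < r" and "ennreal (a * r ^ ?N) < mass g (ball z r)"
      using i by (auto simp: S_def zr)
    note this(2)
    also have "mass g (ball z r) \<le> (\<integral>\<^sup>+y. ennreal (norm (g y)) \<partial>lebesgue)"
      by (intro nn_integral_mono) (auto simp: indicator_def)
    finally have "a * r ^ ?N < L"
      using L \<open>0 < a\<close> r by (simp add: ennreal_less_iff)
    then have rL: "r ^ ?N < L / a" using \<open>0 < a\<close> by (simp add: pos_less_divide_eq mult.commute)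
    have "r \<le> max 1 (L / a)"
    proof (cases "r \<le> 1")
      case False
      then have "r ^ 1 \<le> r ^ ?N" by (intro power_increasing) (auto simp: Suc_le_eq)
      then show ?thesis using rL by simp
    qed simp
    then show ?thesis using r zr by simp
  qed
  have cover: "max_set g a \<subseteq> (\<Union>i\<in>S. ball (fst i) (snd i))"
    unfolding max_set_def S_def by auto
  obtain T where T: "countable T" "T \<subseteq> S"
      and disj: "pairwise (\<lambda>i j. disjnt (ball (fst i) (snd i)) (ball (fst j) (snd j))) T"
      and cov: "max_set g a \<subseteq> (\<Union>i\<in>T. ball (fst i) (5 * snd i))"
    by (rule Vitali_covering_lemma_balls[OF cover r_bound]) (assumption, rule that, assumption+)
  define D where "D = max_const ?N q C * a powr (- q)"
  have "wmeas w (max_set g a) \<le> (\<integral>\<^sup>+i. wmeas w (ball (fst i) (5 * snd i)) \<partial>count_space T)"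
    using cov T by (intro wmeas_UN_le[OF W]) auto
  also have "\<dots> \<le> (\<integral>\<^sup>+i. ennreal D * (\<integral>\<^sup>+y\<in>ball (fst i) (snd i). h y \<partial>lebesgue) \<partial>count_space T)"
  proof (rule nn_integral_mono)
    fix i assume "i \<in> space (count_space T)"
    then have i: "i \<in> S" using T by auto
    define z r where "z = fst i" and "r = snd i"
    have r: "0 < r" and big: "ennreal (a * r ^ ?N) \<le> mass g (ball z r)"
      using i by (auto simp: S_def z_def r_def)
    define B where "B = C * (5 ^ ?N / unit_ball_vol (real ?N)) powr q"
    have B: "0 \<le> B" using C by (simp add: B_def)
    have 1: "wmeas w (ball z (5 * r)) \<le> ennreal B * wmeas w (ball z r)"
      unfolding B_def using r by (intro wmeas_ball_scale[OF A \<open>0 < q\<close>]) auto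
    have 2: "ennreal (a powr q) * wmeas w (ball z r) \<le> ennreal C * (\<integral>\<^sup>+y\<in>ball z r. h y \<partial>lebesgue)"
      using avg_cond_D[OF A r _ _ _ big] \<open>0 < a\<close> by (simp add: h_def)
    have inv: "a powr (- q) * a powr q = 1" using \<open>0 < a\<close> by (simp flip: powr_add)
    have "wmeas w (ball z r) = ennreal (a powr (- q)) * (ennreal (a powr q) * wmeas w (ball z r))"
      by (simp add: inv mult.assoc[symmetric] flip: ennreal_mult)
    also have "\<dots> \<le> ennreal (a powr (- q)) * (ennreal C * (\<integral>\<^sup>+y\<in>ball z r. h y \<partial>lebesgue))"
      by (intro mult_left_mono 2) simp
    finally have "wmeas w (ball z (5 * r)) \<le> ennreal B * (ennreal (a powr (- q)) * (ennreal C * (\<integral>\<^sup>+y\<in>ball z r. h y \<partial>lebesgue)))"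
      using 1 by (meson mult_left_mono order_trans zero_le)
    also have "\<dots> = ennreal D * (\<integral>\<^sup>+y\<in>ball z r. h y \<partial>lebesgue)"
    proof -
      have "B * (a powr (- q) * C) = D" by (simp add: D_def B_def max_const_def)
      then show ?thesis using B C by (simp add: mult.assoc[symmetric] flip: ennreal_mult)
    qed
    finally show "wmeas w (ball (fst i) (5 * snd i)) \<le> ennreal D * (\<integral>\<^sup>+y\<in>ball (fst i) (snd i). h y \<partial>lebesgue)"
      by (simp add: z_def r_def)
  qed
  also have "\<dots> = ennreal D * (\<integral>\<^sup>+i. (\<integral>\<^sup>+y\<in>ball (fst i) (snd i). h y \<partial>lebesgue) \<partial>count_space T)"
    by (rule nn_integral_cmult) simp
  also have "\<dots> \<le> ennreal D * (\<integral>\<^sup>+y\<in>UNIV. h y \<partial>lebesgue)"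
  proof (intro mult_left_mono nn_set_integral_disjoint_le)
    show "disjoint_family_on (\<lambda>i. ball (fst i) (snd i)) T"
      using disj unfolding disjoint_family_on_def pairwise_def disjnt_def by blast
  qed (use T in auto)
  finally show ?thesis by (simp add: D_def h_def)
qed

text \<open>After m iterations the a priori bound M enters only with the factor
  \<open>\<theta> ^ m\<close>, which tends to 0; what remains is the fixed point of x = \<theta> x +
  b.\<close>

lemma iterate_contraction:
  fixes f :: "nat \<Rightarrow> real"
  assumes "0 \<le> \<theta>" "\<theta> < 1" "\<And>m. f m \<le> \<theta> * f (Suc m) + b" "\<And>m. f m \<le> M"
  shows "f 0 \<le> b / (1 - \<theta>)"
proof -
  define d where "d = b / (1 - \<theta>)"
  have d: "\<theta> * d + b = d" using assms by (simp add: d_def field_simps)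
  have "f 0 - d \<le> \<theta> ^ m * (f m - d)" for m
  proof (induction m)
    case (Suc m)
    have "f m - d \<le> \<theta> * (f (Suc m) - d)" using assms(3)[of m] d by (simp add: algebra_simps)
    then have "\<theta> ^ m * (f m - d) \<le> \<theta> ^ m * (\<theta> * (f (Suc m) - d))"
      using assms(1) by (intro mult_left_mono) auto
    with Suc show ?case by (simp add: mult_ac)
  qed simp
  then have "f 0 - d \<le> \<theta> ^ m * (M - d)" for m
    using assms(1,4) by (meson diff_right_mono mult_left_mono order_trans zero_le_power)
  moreover have "(\<lambda>m. \<theta> ^ m * (M - d)) \<longlonglongrightarrow> 0 * (M - d)"
    using assms by (intro tendsto_intros LIMSEQ_power_zero) auto
  ultimately have "f 0 - d \<le> 0"
    using LIMSEQ_le_const[of "\<lambda>m. \<theta> ^ m * (M - d)" 0 "f 0 - d"] by auto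
  then show ?thesis by (simp add: d_def)
qed

text \<open>1 + D for the constant D with \<open>wmeas w U \<le> D * wmeas w (U - bad)\<close> in
  \<open>good_lambda\<close>; the bad points then carry at most the share 1 - 1 / (1 + D) of the
  weight.\<close>

definition goodset_const :: "nat \<Rightarrow> real \<Rightarrow> real \<Rightarrow> real" where
  "goodset_const N q C = 1 + C * (5 ^ N / unit_ball_vol (real N)) powr q * (C * (2 / unit_ball_vol (real N)) powr q)"

context adapted_family
begin

text \<open>
  Disjoint Vitali balls suffice, without a Whitney covering: one only has to show that the points
  of U outside the exceptional set carry a fixed share of the weight of U.\<close>

lemma good_lambda:
  fixes w :: "real ^ 'n \<Rightarrow> real"
  assumes A: "avg_cond q w C" and "0 < q" and W: "is_weight w" and g: "integrable lebesgue g"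
    and "0 < s" "0 < \<eta>" "0 < \<gamma>"
    and \<gamma>1: "drift_const * 4 ^ CARD('n) * \<gamma>\<^sup>2 \<le> \<eta> / 2"
    and \<gamma>2: "carleson_const * 4 ^ CARD('n) * (2 * R + 3) ^ CARD('n) * \<gamma>\<^sup>2 \<le> \<eta> / 2 * (unit_ball_vol (real CARD('n)) / 2)"
    and bdd: "bounded {x. ennreal s < square_sum g x}"
  shows "wmeas w {x. ennreal ((1 + \<eta>) * s) < square_sum g x}
    \<le> ennreal (1 - 1 / goodset_const CARD('n) q C) * wmeas w {x. ennreal s < square_sum g x}
      + wmeas w (max_set g (\<gamma> * sqrt s))"
proof -
  let ?N = "CARD('n)"
  define \<omega> where "\<omega> = unit_ball_vol (real ?N)"
  have \<omega>: "0 < \<omega>" by (simp add: \<omega>_def)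
  have C: "0 < C" using A by (simp add: avg_cond_def)
  note [measurable] = is_weight_measurable[OF W] borel_measurable_integrable[OF g]
  define U where "U = {x. ennreal s < square_sum g x}"
  define a where "a = \<gamma> * sqrt s"
  \<comment> \<open>The bound on centred averages off \<open>max_set\<close>, given by
    \<open>notin_max_set\<close>; the factor comes from enclosing a closed ball in an open ball of
    twice the radius.\<close>
  define AA where "AA = 2 ^ ?N * a"
  define F where "F = - max_set g a"
  define bad where "bad = {x. ennreal ((1 + \<eta>) * s) < square_sum g x} \<inter> F"
  have a: "0 < a" using \<open>0 < \<gamma>\<close> \<open>0 < s\<close> by (simp add: a_def)
  have "((2::real) ^ ?N)\<^sup>2 = (2\<^sup>2) ^ ?N"
    by (simp only: power_mult[symmetric] mult.commute)
  then have AA: "0 \<le> AA" "AA\<^sup>2 = 4 ^ ?N * \<gamma>\<^sup>2 * s"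
    using a \<open>0 < s\<close> by (auto simp: AA_def a_def power_mult_distrib)
  have U_open: "open U" unfolding U_def by (rule open_square_sum_level)
  have U_meas [measurable]: "U \<in> sets lebesgue" using U_open by simp
  have F_meas [measurable]: "F \<in> sets lebesgue" using open_max_set[of g a] by (simp add: F_def Compl_in_sets_lebesgue)
  have lev_meas [measurable]: "{x. ennreal ((1 + \<eta>) * s) < square_sum g x} \<in> sets lebesgue"
    using open_square_sum_level by simp
  have bad_meas [measurable]: "bad \<in> sets lebesgue" unfolding bad_def by measurable
  have "bad \<subseteq> U"
    unfolding bad_def U_def using \<open>0 < s\<close> \<open>0 < \<eta>\<close>
    by (auto intro: le_less_trans[rotated] simp: ennreal_leI)
  \<comment> \<open>Finiteness allows the comparison of \<open>bad\<close> with U to be carried out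
    in real numbers, in \<open>bad_le\<close>.\<close>
  have W_U: "wmeas w U < \<infinity>"
  proof -
    obtain \<rho> where "U \<subseteq> ball 0 \<rho>" using bdd unfolding U_def[symmetric] by (meson bounded_subset_ballD)
    then show ?thesis using wmeas_mono wmeas_ball_finite[OF W] le_less_trans by blast
  qed
  have F_max: "mass g (cball x \<rho>) \<le> ennreal (AA * \<rho> ^ ?N)" if "x \<in> F" "0 < \<rho>" for x \<rho>
    using notin_max_set[of x g a \<rho>] that by (simp add: F_def AA_def)
  \<comment> \<open>At bad points of the ball the localised part of g alone reaches the level \<eta>
    s / 2. The tent estimate on F turns this into a bound on their measure, and
    \<open>\<gamma>2\<close> makes it at most half the volume of the ball.\<close>
  have half: "emeasure lebesgue (ball x0 r \<inter> bad) \<le> ennreal (\<omega> / 2 * r ^ ?N)"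
    if "0 < r" and z: "z \<notin> U" "dist x0 z = 10 * r" for x0 r z
  proof (cases "ball x0 r \<inter> bad = {}")
    case False
    \<comment> \<open>Any bad point in the ball serves as the centre of controlled averages, since
      bad points lie in F.\<close>
    then obtain p where p: "p \<in> ball x0 r" "p \<in> bad" by blast
    then have pF: "p \<in> F" by (simp add: bad_def)
    let ?B = "cball x0 ((2 * R + 2) * r)"
    let ?g = "\<lambda>y. g y * indicator ?B y"
    have int_g: "integrable lebesgue ?g"
      using g by (rule Bochner_Integration.integrable_bound) (auto simp: indicator_def norm_mult)
    have big: "ennreal (\<eta> / 2 * s) \<le> square_sum ?g x" if x: "x \<in> ball x0 r \<inter> bad" for x
    proof -
      have "square_sum g x \<le> square_sum ?g x + square_sum g z + ennreal (drift_const * AA\<^sup>2)"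
      proof (rule square_sum_localise[of g r AA x0 x z p])
        show "dist x z \<le> 12 * r"
          using x z dist_triangle3[of x z x0] \<open>0 < r\<close> by simp
        show "dist p x \<le> 2 * r"
          using x p dist_triangle3[of p x x0] by simp
      qed (use x AA \<open>0 < r\<close> F_max[OF pF] in auto)
      also have "square_sum g z \<le> ennreal s" using z by (simp add: U_def not_less)
      also have "drift_const * AA\<^sup>2 \<le> \<eta> / 2 * s"
        unfolding AA(2) using mult_right_mono[OF \<gamma>1, of s] \<open>0 < s\<close> by (simp add: mult_ac)
      finally have "square_sum g x \<le> square_sum ?g x + ennreal s + ennreal (\<eta> / 2 * s)"
        by (simp add: add_left_mono add_right_mono ennreal_leI)
      moreover have "ennreal ((1 + \<eta>) * s) \<le> square_sum g x" using x by (simp add: bad_def less_imp_le)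
      moreover have "ennreal ((1 + \<eta>) * s) = (ennreal s + ennreal (\<eta> / 2 * s)) + ennreal (\<eta> / 2 * s)"
        using \<open>0 < s\<close> \<open>0 < \<eta>\<close> by (simp add: algebra_simps flip: ennreal_plus)
      ultimately have "(ennreal s + ennreal (\<eta> / 2 * s)) + ennreal (\<eta> / 2 * s) \<le> square_sum ?g x + (ennreal s + ennreal (\<eta> / 2 * s))"
        unfolding add.assoc by (metis order_trans)
      then have "(ennreal s + ennreal (\<eta> / 2 * s)) + ennreal (\<eta> / 2 * s) \<le> (ennreal s + ennreal (\<eta> / 2 * s)) + square_sum ?g x"
        by (simp only: add.commute)
      then show ?thesis
        unfolding ennreal_add_left_cancel_le by simp
    qed
    have "ennreal (\<eta> / 2 * s) * emeasure lebesgue (ball x0 r \<inter> bad)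
        = (\<integral>\<^sup>+x. ennreal (\<eta> / 2 * s) * indicator (ball x0 r \<inter> bad) x \<partial>lebesgue)"
      by (rule nn_integral_cmult_indicator[symmetric]) measurable
    also have "\<dots> \<le> (\<integral>\<^sup>+x\<in>F. square_sum ?g x \<partial>lebesgue)"
      using big by (intro nn_integral_mono) (auto simp: indicator_def bad_def)
    also have "\<dots> \<le> ennreal (carleson_const * AA) * (\<integral>\<^sup>+x. ennreal (norm (?g x)) \<partial>lebesgue)" (is "_ \<le> _ * ?J")
    proof (rule tent_estimate[OF int_g _ F_meas AA(1)])
      fix x \<rho> assume "x \<in> F" "0 < (\<rho>::real)"
      have "mass ?g (cball x \<rho>) \<le> mass g (cball x \<rho>)"
        by (intro nn_integral_mono) (auto simp: indicator_def)
      also have "\<dots> \<le> ennreal (AA * \<rho> ^ ?N)" by (rule F_max) fact+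
      finally show "mass ?g (cball x \<rho>) \<le> ennreal (AA * \<rho> ^ ?N)" .
    qed (use pF in auto)
    finally have est: "ennreal (\<eta> / 2 * s) * emeasure lebesgue (ball x0 r \<inter> bad) \<le> ennreal (carleson_const * AA) * ?J" .
    have "?J \<le> mass g (cball p ((2 * R + 3) * r))"
    proof (rule nn_integral_mono)
      fix y
      show "ennreal (norm (?g y)) \<le> ennreal (norm (g y)) * indicator (cball p ((2 * R + 3) * r)) y"
      proof (cases "y \<in> ?B")
        case True
        then have "dist p y \<le> (2 * R + 3) * r"
          using p dist_triangle3[of p y x0] by (simp add: algebra_simps)
        then show ?thesis using True by simp
      qed simp
    qed
    also have "\<dots> \<le> ennreal (AA * ((2 * R + 3) * r) ^ ?N)"
      using R \<open>0 < r\<close> by (intro F_max pF) auto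
    finally have J: "?J \<le> ennreal (AA * ((2 * R + 3) * r) ^ ?N)" .
    have "ennreal (\<eta> / 2 * s) * emeasure lebesgue (ball x0 r \<inter> bad)
        \<le> ennreal (carleson_const * AA) * ennreal (AA * ((2 * R + 3) * r) ^ ?N)"
      by (rule order_trans[OF est]) (rule mult_left_mono[OF J zero_le])
    also have "ennreal (carleson_const * AA) * ennreal (AA * ((2 * R + 3) * r) ^ ?N)
        = ennreal (carleson_const * AA\<^sup>2 * (2 * R + 3) ^ ?N * r ^ ?N)"
      using AA(1) carleson_const_nonneg R \<open>0 < r\<close>
      by (simp add: power_mult_distrib power2_eq_square mult_ac flip: ennreal_mult)
    also have "\<dots> \<le> ennreal (\<eta> / 2 * s * (\<omega> / 2 * r ^ ?N))"
    proof (rule ennreal_leI)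
      have "carleson_const * AA\<^sup>2 * (2 * R + 3) ^ ?N * r ^ ?N
          = carleson_const * 4 ^ ?N * (2 * R + 3) ^ ?N * \<gamma>\<^sup>2 * (s * r ^ ?N)"
        unfolding AA(2) by (simp only: mult_ac)
      also have "\<dots> \<le> \<eta> / 2 * (\<omega> / 2) * (s * r ^ ?N)"
        unfolding \<omega>_def using \<open>0 < s\<close> \<open>0 < r\<close> by (intro mult_right_mono \<gamma>2) auto
      finally show "carleson_const * AA\<^sup>2 * (2 * R + 3) ^ ?N * r ^ ?N \<le> \<eta> / 2 * s * (\<omega> / 2 * r ^ ?N)"
        by (simp only: mult_ac)
    qed
    also have "ennreal (\<eta> / 2 * s * (\<omega> / 2 * r ^ ?N)) = ennreal (\<eta> / 2 * s) * ennreal (\<omega> / 2 * r ^ ?N)"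
      using \<open>0 < s\<close> \<open>0 < \<eta>\<close> \<omega> \<open>0 < r\<close> by (intro ennreal_mult) auto
    finally show ?thesis
      using \<open>0 < s\<close> \<open>0 < \<eta>\<close> ennreal_mult_le_mult_iff[of "ennreal (\<eta> / 2 * s)"] by auto
  qed simp
  define D where "D = C * (5 ^ ?N / \<omega>) powr q * (C * (2 / \<omega>) powr q)"
  have D: "0 \<le> D" using C by (simp add: D_def)
  have key: "wmeas w U \<le> ennreal D * wmeas w (U - bad)"
  proof (cases "U = {}")
    case False
    have "- U \<noteq> {}" using bdd not_bounded_UNIV unfolding U_def[symmetric] by (metis Compl_empty_eq double_compl)
    \<comment> \<open>One tenth of the distance to the complement: the ball stays inside U, and a
      nearest point outside U lies at distance exactly 10 radii, as \<open>half\<close>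
      requires.\<close>
    define \<rho> where "\<rho> x = infdist x (- U) / 10" for x
    have closed: "closed (- U)" using U_open by (simp add: closed_def)
    have \<rho>_pos: "0 < \<rho> x" if "x \<in> U" for x
      using infdist_pos_not_in_closed[OF closed \<open>- U \<noteq> {}\<close>] that by (simp add: \<rho>_def)
    have ball_U: "ball x (\<rho> x) \<subseteq> U" if "x \<in> U" for x
    proof
      fix y assume y: "y \<in> ball x (\<rho> x)"
      show "y \<in> U"
      proof (rule ccontr)
        assume "y \<notin> U"
        then have "infdist x (- U) \<le> dist x y" by (intro infdist_le) auto
        then show False using y \<rho>_pos[OF that] by (simp add: \<rho>_def)
      qed
    qed
    obtain u where u: "u \<in> - U" using \<open>- U \<noteq> {}\<close> by blast
    obtain M where M: "\<And>x. x \<in> U \<Longrightarrow> dist u x \<le> M"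
      using bdd unfolding U_def[symmetric] bounded_any_center[of _ u] by blast
    have \<rho>_bd: "0 < \<rho> x \<and> \<rho> x \<le> M" if "x \<in> U" for x
      using \<rho>_pos[OF that] M[OF that] infdist_le[OF u, of x] infdist_nonneg[of x "- U"] by (simp add: \<rho>_def dist_commute)
    have cover: "U \<subseteq> (\<Union>x\<in>U. ball x (\<rho> x))"
    proof
      fix x assume "x \<in> U"
      then show "x \<in> (\<Union>x\<in>U. ball x (\<rho> x))" using \<rho>_pos by (intro UN_I[of x]) auto
    qed
    obtain T where T: "countable T" "T \<subseteq> U"
        and disj: "pairwise (\<lambda>i j. disjnt (ball i (\<rho> i)) (ball j (\<rho> j))) T"
        and cov: "U \<subseteq> (\<Union>i\<in>T. ball i (5 * \<rho> i))"
      by (rule Vitali_covering_lemma_balls[OF cover \<rho>_bd]) (assumption, rule that, assumption+)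
    have "wmeas w U \<le> (\<integral>\<^sup>+i. wmeas w (ball i (5 * \<rho> i)) \<partial>count_space T)"
      using cov T by (intro wmeas_UN_le[OF W]) auto
    also have "\<dots> \<le> (\<integral>\<^sup>+i. ennreal D * wmeas w (ball i (\<rho> i) - bad) \<partial>count_space T)"
    proof (rule nn_integral_mono)
      fix i assume "i \<in> space (count_space T)"
      then have i: "i \<in> U" using T by auto
      note r = \<rho>_pos[OF i]
      obtain z where z: "z \<in> - U" "infdist i (- U) = dist i z"
        using infdist_attains_inf[OF closed \<open>- U \<noteq> {}\<close>] by blast
      have "emeasure lebesgue (ball i (\<rho> i) \<inter> bad) \<le> ennreal (\<omega> / 2 * \<rho> i ^ ?N)"
        using z r by (intro half[of _ z]) (auto simp: \<rho>_def)
      moreover have "ennreal (\<omega> / 2 * \<rho> i ^ ?N) + ennreal (\<omega> / 2 * \<rho> i ^ ?N) = emeasure lebesgue (ball i (\<rho> i))"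
        using r \<omega> by (simp add: emeasure_ball \<omega>_def flip: ennreal_plus)
      moreover have "emeasure lebesgue (ball i (\<rho> i)) = emeasure lebesgue (ball i (\<rho> i) \<inter> bad) + emeasure lebesgue (ball i (\<rho> i) - bad)"
      proof -
        have "emeasure lebesgue (ball i (\<rho> i) \<inter> bad) + emeasure lebesgue (ball i (\<rho> i) - bad)
            = emeasure lebesgue ((ball i (\<rho> i) \<inter> bad) \<union> (ball i (\<rho> i) - bad))"
          by (rule plus_emeasure) auto
        also have "(ball i (\<rho> i) \<inter> bad) \<union> (ball i (\<rho> i) - bad) = ball i (\<rho> i)" by blast
        finally show ?thesis by (rule sym)
      qed
      ultimately have "ennreal (\<omega> / 2 * \<rho> i ^ ?N) + ennreal (\<omega> / 2 * \<rho> i ^ ?N)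
          \<le> ennreal (\<omega> / 2 * \<rho> i ^ ?N) + emeasure lebesgue (ball i (\<rho> i) - bad)"
        by (simp add: add_right_mono)
      then have E: "ennreal (\<omega> / 2 * \<rho> i ^ ?N) \<le> emeasure lebesgue (ball i (\<rho> i) - bad)"
        by (subst (asm) ennreal_add_left_cancel_le) auto
      have 1: "wmeas w (ball i (5 * \<rho> i)) \<le> ennreal (C * (5 ^ ?N / \<omega>) powr q) * wmeas w (ball i (\<rho> i))"
        unfolding \<omega>_def using r by (intro wmeas_ball_scale[OF A \<open>0 < q\<close>]) auto
      have 2: "ennreal ((\<omega> / 2) powr q) * wmeas w (ball i (\<rho> i)) \<le> ennreal C * wmeas w (ball i (\<rho> i) - bad)"
        using E r \<omega> by (intro avg_cond_set[OF A \<open>0 < q\<close>]) auto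
      have inv: "(2 / \<omega>) powr q * (\<omega> / 2) powr q = 1" using \<omega> by (simp flip: powr_mult)
      have "wmeas w (ball i (\<rho> i)) = ennreal ((2 / \<omega>) powr q) * (ennreal ((\<omega> / 2) powr q) * wmeas w (ball i (\<rho> i)))"
        by (simp add: inv mult.assoc[symmetric] flip: ennreal_mult)
      also have "\<dots> \<le> ennreal ((2 / \<omega>) powr q) * (ennreal C * wmeas w (ball i (\<rho> i) - bad))"
        by (intro mult_left_mono 2) simp
      finally have "wmeas w (ball i (5 * \<rho> i)) \<le> ennreal (C * (5 ^ ?N / \<omega>) powr q) *
          (ennreal ((2 / \<omega>) powr q) * (ennreal C * wmeas w (ball i (\<rho> i) - bad)))"
        using 1 by (meson mult_left_mono order_trans zero_le)
      also have "\<dots> = ennreal D * wmeas w (ball i (\<rho> i) - bad)"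
      proof -
        have "C * (5 ^ ?N / \<omega>) powr q * ((2 / \<omega>) powr q * C) = D" by (simp add: D_def)
        then show ?thesis using C by (simp add: mult.assoc[symmetric] flip: ennreal_mult)
      qed
      finally show "wmeas w (ball i (5 * \<rho> i)) \<le> ennreal D * wmeas w (ball i (\<rho> i) - bad)" .
    qed
    also have "\<dots> = ennreal D * (\<integral>\<^sup>+i. wmeas w (ball i (\<rho> i) - bad) \<partial>count_space T)"
      by (rule nn_integral_cmult) simp
    also have "\<dots> \<le> ennreal D * wmeas w (U - bad)"
      unfolding wmeas_def
    proof (intro mult_left_mono nn_set_integral_disjoint_le)
      show "disjoint_family_on (\<lambda>i. ball i (\<rho> i) - bad) T"
        using disj unfolding disjoint_family_on_def pairwise_def disjnt_def by blast
      show "ball i (\<rho> i) - bad \<subseteq> U - bad" if "i \<in> T" for i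
        using ball_U T that by blast
    qed (use T in auto)
    finally show ?thesis .
  qed (simp add: wmeas_def)
  have split: "wmeas w U = wmeas w bad + wmeas w (U - bad)"
    unfolding wmeas_def using \<open>bad \<subseteq> U\<close>
    by (subst nn_integral_add[symmetric]) (auto intro!: nn_integral_cong simp: indicator_def)
  have bad_le: "wmeas w bad \<le> ennreal (1 - 1 / goodset_const ?N q C) * wmeas w U"
  proof -
    obtain x y where xy: "wmeas w bad = ennreal x" "0 \<le> x" "wmeas w (U - bad) = ennreal y" "0 \<le> y"
      using W_U split by (cases "wmeas w bad"; cases "wmeas w (U - bad)") auto
    have u: "wmeas w U = ennreal (x + y)" using split xy by (simp add: ennreal_plus)
    have "ennreal (x + y) \<le> ennreal (D * y)"
      using key unfolding u xy(3) using xy D by (simp add: ennreal_mult del: ennreal_plus)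
    then have "x + y \<le> D * y"
      using xy D by (simp add: ennreal_le_iff del: ennreal_plus)
    also have "\<dots> \<le> (1 + D) * y" using xy by (simp add: distrib_right)
    finally have "(x + y) / (1 + D) \<le> y" using D by (simp add: pos_divide_le_eq mult.commute)
    then have "x \<le> (1 - 1 / (1 + D)) * (x + y)" by (simp add: left_diff_distrib)
    then have "ennreal x \<le> ennreal (1 - 1 / (1 + D)) * ennreal (x + y)"
      using xy D by (subst ennreal_mult[symmetric]) (auto intro!: ennreal_leI simp: field_simps)
    then show ?thesis unfolding u xy(1) by (simp add: goodset_const_def D_def \<omega>_def)
  qed
  have "wmeas w {x. ennreal ((1 + \<eta>) * s) < square_sum g x} \<le> wmeas w bad + wmeas w (max_set g a)"
    using open_max_set[of g a] by (intro wmeas_Un_le[OF W]) (auto simp: bad_def F_def)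
  also have "\<dots> \<le> ennreal (1 - 1 / goodset_const ?N q C) * wmeas w U + wmeas w (max_set g a)"
    by (intro add_right_mono bad_le)
  finally show ?thesis by (simp add: U_def a_def)
qed

end

section \<open>The weighted weak type estimate\<close>

context adapted_family
begin

text \<open>Beyond twice the radius of the support, the mass of g lies at distance at least |x| / 2
  from x; \<open>square_sum_far\<close> with a single piece then gives decay like |x|^(-2n).\<close>

lemma square_sum_level_subset_ball:
  assumes g: "integrable lebesgue g" and supp_g: "\<And>y. g y \<noteq> 0 \<Longrightarrow> norm y \<le> \<rho>0" and "0 \<le> \<rho>0" "0 < s"
    and \<rho>: "2 * \<rho>0 + 1 \<le> \<rho>"
      "far_const * 4 ^ CARD('n) * (LINT y|lebesgue. norm (g y))\<^sup>2 \<le> s * \<rho> ^ (2 * CARD('n))"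
  shows "{x. ennreal s < square_sum g x} \<subseteq> ball 0 \<rho>"
proof
  let ?N = "CARD('n)"
  define L where "L = (LINT y|lebesgue. norm (g y))"
  have L: "(\<integral>\<^sup>+y. ennreal (norm (g y)) \<partial>lebesgue) = ennreal L" "0 \<le> L"
    unfolding L_def using g by (auto intro: nn_integral_eq_integral)
  note [measurable] = borel_measurable_integrable[OF g]
  fix x assume x: "x \<in> {x. ennreal s < square_sum g x}"
  show "x \<in> ball 0 \<rho>"
  proof (rule ccontr)
    assume "x \<notin> ball 0 \<rho>"
    then have nx: "\<rho> \<le> norm x" by simp
    have x0: "0 < norm x" using nx \<rho> \<open>0 \<le> \<rho>0\<close> by linarith
    have "square_sum g x \<le> ennreal far_const * (\<integral>\<^sup>+i. ennreal (1 / (norm x / 2) ^ ?N) *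
        mass g UNIV \<partial>count_space {0::nat})\<^sup>2"
    proof (rule square_sum_far)
      fix y assume "g y \<noteq> 0"
      then have "norm y \<le> \<rho>0" by (rule supp_g)
      then show "norm x / 2 \<le> dist x y"
        using nx \<rho> norm_triangle_ineq2[of x y] by (simp add: dist_norm)
    qed (use x0 in auto)
    also have "\<dots> = ennreal (far_const * ((1 / (norm x / 2) ^ ?N) * L)\<^sup>2)"
      using L far_const_nonneg by (simp add: nn_integral_count_space_finite ennreal_power flip: ennreal_mult)
    also have "\<dots> \<le> ennreal s"
    proof (rule ennreal_leI)
      have "far_const * ((1 / (norm x / 2) ^ ?N) * L)\<^sup>2 = far_const * 4 ^ ?N * L\<^sup>2 / norm x ^ (2 * ?N)"
      proof -
        have "((norm x / 2) ^ ?N)\<^sup>2 = norm x ^ (2 * ?N) / 4 ^ ?N"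
          by (simp add: power_divide power_mult power2_eq_square flip: power_mult_distrib)
        moreover have "(1 / d * L)\<^sup>2 = L\<^sup>2 / d\<^sup>2" for d :: real
          by (simp add: power2_eq_square)
        ultimately show ?thesis by simp
      qed
      also have "\<dots> \<le> s * \<rho> ^ (2 * ?N) / norm x ^ (2 * ?N)"
        using \<rho>(2) by (intro divide_right_mono) (auto simp: L_def)
      also have "\<dots> \<le> s * norm x ^ (2 * ?N) / norm x ^ (2 * ?N)"
        using nx \<rho>(1) \<open>0 \<le> \<rho>0\<close> \<open>0 < s\<close> by (intro divide_right_mono mult_left_mono power_mono) auto
      also have "\<dots> = s" using x0 by simp
      finally show "far_const * ((1 / (norm x / 2) ^ ?N) * L)\<^sup>2 \<le> s" .
    qed
    finally show False using x by simp
  qed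
qed

text \<open>The step factor \<open>1 + good_step\<close> is so close to 1 that its power q/2 does not outweigh
  the gain \<open>1 - 1 / goodset_const\<close> of the good-lambda inequality.\<close>

definition good_step :: "real \<Rightarrow> real \<Rightarrow> real" where
  "good_step q C = (1 / (1 - 1 / (2 * goodset_const CARD('n) q C))) powr (2 / q) - 1"

text \<open>The square of the parameter \<gamma> of \<open>good_lambda\<close>. The minimum and the
  sum in the denominator make one choice serve both smallness conditions.\<close>

definition good_ratio :: "real \<Rightarrow> real \<Rightarrow> real" where
  "good_ratio q C = good_step q C * min 1 (unit_ball_vol (real CARD('n))) /
     (4 * 4 ^ CARD('n) * (1 + drift_const + carleson_const * (2 * R + 3) ^ CARD('n)))"

text \<open>The bound \<open>b / (1 - \<theta>)\<close> supplied by
  \<open>iterate_contraction\<close>, per unit of the weighted integral of |g|^q.\<close>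

definition weak_const :: "real \<Rightarrow> real \<Rightarrow> real" where
  "weak_const q C = (1 / (1 - 1 / (2 * goodset_const CARD('n) q C))) *
     (max_const CARD('n) q C * good_ratio q C powr (- q / 2)) /
     (1 - (1 - 1 / goodset_const CARD('n) q C) / (1 - 1 / (2 * goodset_const CARD('n) q C)))"

text \<open>The good-lambda inequality is iterated towards lower levels \<open>\<sigma> m\<close>:
  the weights of the level sets, multiplied by \<open>\<sigma> m powr (q / 2)\<close>, satisfy a
  contraction. It needs an a priori bound, which holds because the level sets lie in balls of radius
  of order \<sigma>^(-1/(2n)) for small levels \<sigma>, and the weight of such balls is at most of
  order \<sigma>^(-q/2).\<close>

lemma weighted_weak_type:
  fixes w :: "real ^ 'n \<Rightarrow> real"
  assumes A: "avg_cond q w C" and "0 < q" and W: "is_weight w" and g: "integrable lebesgue g"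
    and supp_g: "\<And>y. g y \<noteq> 0 \<Longrightarrow> norm y \<le> \<rho>0" and "0 < s"
  shows "wmeas w {x. ennreal s < square_sum g x} \<le> ennreal (weak_const q C * s powr (- q / 2)) *
    (\<integral>\<^sup>+x. ennreal (norm (g x) powr q) * ennreal (w x) \<partial>lebesgue)"
    and "0 < weak_const q C"
proof -
  let ?N = "CARD('n)"
  define c where "c = goodset_const ?N q C"
  define \<omega> where "\<omega> = unit_ball_vol (real ?N)"
  define \<kappa> where "\<kappa> = 1 - 1 / (2 * c)"
  define \<eta> where "\<eta> = good_step q C"
  define \<gamma> where "\<gamma> = sqrt (good_ratio q C)"
  define \<theta> where "\<theta> = (1 - 1 / c) / \<kappa>"
  define E where "E = 1 + drift_const + carleson_const * (2 * R + 3) ^ ?N"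
  have \<omega>: "0 < \<omega>" by (simp add: \<omega>_def)
  have C: "0 < C" using A by (simp add: avg_cond_def)
  have c: "1 < c" using C \<omega> by (simp add: c_def goodset_const_def \<omega>_def[symmetric])
  have \<kappa>: "0 < \<kappa>" "\<kappa> < 1" using c by (auto simp: \<kappa>_def field_simps)
  have \<theta>: "0 \<le> \<theta>" "\<theta> < 1" using c \<kappa> by (auto simp: \<theta>_def \<kappa>_def field_simps)
  have \<eta>_eq: "1 + \<eta> = (1 / \<kappa>) powr (2 / q)" by (simp add: \<eta>_def good_step_def \<kappa>_def c_def)
  have "1 < (1 / \<kappa>) powr (2 / q)" using \<kappa> \<open>0 < q\<close> by (intro gr_one_powr) auto
  then have \<eta>: "0 < \<eta>" using \<eta>_eq by simp
  have \<eta>_powr: "(1 + \<eta>) powr (q / 2) = 1 / \<kappa>"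
    unfolding \<eta>_eq powr_powr using \<kappa> \<open>0 < q\<close> by simp
  have E: "1 \<le> E" unfolding E_def using drift_const_nonneg carleson_const_nonneg R by simp
  have ratio: "good_ratio q C = \<eta> * min 1 \<omega> / (4 * 4 ^ ?N * E)"
    by (simp add: good_ratio_def \<eta>_def \<omega>_def E_def)
  have ratio_pos: "0 < good_ratio q C" unfolding ratio using \<eta> \<omega> E by simp
  have \<gamma>: "0 < \<gamma>" "\<gamma>\<^sup>2 = good_ratio q C" using ratio_pos by (auto simp: \<gamma>_def)
  have \<gamma>E: "4 ^ ?N * \<gamma>\<^sup>2 * X \<le> \<eta> / 4 * min 1 \<omega>" if "X \<le> E" for X
  proof -
    have "4 ^ ?N * \<gamma>\<^sup>2 * X \<le> 4 ^ ?N * \<gamma>\<^sup>2 * E" using that by (intro mult_left_mono) auto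
    also have "\<dots> = \<eta> / 4 * min 1 \<omega>" unfolding \<gamma>(2) ratio using E by simp
    finally show ?thesis .
  qed
  have \<gamma>1: "drift_const * 4 ^ ?N * \<gamma>\<^sup>2 \<le> \<eta> / 2"
  proof -
    have "4 ^ ?N * \<gamma>\<^sup>2 * drift_const \<le> \<eta> / 4 * min 1 \<omega>"
      using carleson_const_nonneg R by (intro \<gamma>E) (simp add: E_def)
    also have "\<dots> \<le> \<eta> / 4 * 1" using \<eta> by (intro mult_left_mono) auto
    also have "\<dots> \<le> \<eta> / 2" using \<eta> by simp
    finally show ?thesis by (simp only: mult_ac)
  qed
  have \<gamma>2: "carleson_const * 4 ^ ?N * (2 * R + 3) ^ ?N * \<gamma>\<^sup>2 \<le> \<eta> / 2 * (unit_ball_vol (real ?N) / 2)"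
  proof -
    have "4 ^ ?N * \<gamma>\<^sup>2 * (carleson_const * (2 * R + 3) ^ ?N) \<le> \<eta> / 4 * min 1 \<omega>"
      using drift_const_nonneg by (intro \<gamma>E) (simp add: E_def)
    also have "\<dots> \<le> \<eta> / 4 * \<omega>" using \<eta> by (intro mult_left_mono) auto
    finally show ?thesis by (simp add: \<omega>_def mult_ac)
  qed
  have max_pos: "0 < max_const ?N q C" using C \<omega> by (simp add: max_const_def \<omega>_def[symmetric])
  define b where "b = 1 / \<kappa> * (max_const ?N q C * good_ratio q C powr (- q / 2))"
  have b: "0 < b" unfolding b_def using \<kappa> max_pos ratio_pos by simp
  have weak_eq: "weak_const q C = b / (1 - \<theta>)"
    by (simp add: weak_const_def b_def \<theta>_def \<kappa>_def c_def)
  show pos: "0 < weak_const q C" unfolding weak_eq using b \<theta> by simp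
  define Y where "Y = (\<integral>\<^sup>+x. ennreal (norm (g x) powr q) * ennreal (w x) \<partial>lebesgue)"
  have "wmeas w {x. ennreal s < square_sum g x} \<le> ennreal (weak_const q C * s powr (- q / 2)) * Y"
  proof (cases "Y = \<infinity>")
    case True
    then show ?thesis using pos \<open>0 < s\<close> by (simp add: ennreal_mult_top)
  next
    case False
    then obtain y where y: "Y = ennreal y" "0 \<le> y" by (cases Y) auto
    define \<rho>1 where "\<rho>1 = max 0 \<rho>0"
    have \<rho>1: "0 \<le> \<rho>1" "\<And>y. g y \<noteq> 0 \<Longrightarrow> norm y \<le> \<rho>1" using supp_g by (auto simp: \<rho>1_def le_max_iff_disj)
    define B where "B = far_const * 4 ^ ?N * (LINT y|lebesgue. norm (g y))\<^sup>2"
    have B: "0 \<le> B" using far_const_nonneg by (simp add: B_def)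
    define \<sigma> where "\<sigma> m = s / (1 + \<eta>) ^ m" for m
    have \<sigma>: "0 < \<sigma> m" "\<sigma> m \<le> s" for m
      using \<open>0 < s\<close> \<eta> by (auto simp: \<sigma>_def divide_le_eq_1 pos_divide_le_eq intro!: mult_left_le[of _ s, simplified mult.commute] one_le_power)
    have \<sigma>_Suc: "\<sigma> m = (1 + \<eta>) * \<sigma> (Suc m)" for m
      using \<eta> by (simp add: \<sigma>_def)
    \<comment> \<open>The 2n-th power of the radius is a sum of two terms, one for each condition of
      \<open>square_sum_level_subset_ball\<close>.\<close>
    define \<rho> where "\<rho> m = ((2 * \<rho>1 + 1) ^ (2 * ?N) + B / \<sigma> m) powr (1 / real (2 * ?N))" for m
    have \<rho>_pow: "\<rho> m ^ (2 * ?N) = (2 * \<rho>1 + 1) ^ (2 * ?N) + B / \<sigma> m" for m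
    proof -
      have "0 < (2 * \<rho>1 + 1) ^ (2 * ?N) + B / \<sigma> m"
        using \<rho>1(1) B \<sigma>[of m] by (intro add_pos_nonneg) auto
      moreover from this have "0 < \<rho> m" by (simp add: \<rho>_def)
      ultimately show ?thesis
        by (subst powr_realpow[symmetric]) (auto simp: \<rho>_def powr_powr)
    qed
    have \<rho>_ge: "2 * \<rho>1 + 1 \<le> \<rho> m" for m
    proof (rule power_le_imp_le_base)
      have "2 * ?N = Suc (2 * ?N - 1)" by simp
      moreover have "(2 * \<rho>1 + 1) ^ (2 * ?N) \<le> \<rho> m ^ (2 * ?N)"
        unfolding \<rho>_pow using B \<sigma>[of m] by simp
      ultimately show "(2 * \<rho>1 + 1) ^ Suc (2 * ?N - 1) \<le> \<rho> m ^ Suc (2 * ?N - 1)" by metis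
      show "0 \<le> \<rho> m" by (simp add: \<rho>_def)
    qed
    define U where "U m = {x. ennreal (\<sigma> m) < square_sum g x}" for m
    have U_ball: "U m \<subseteq> ball 0 (\<rho> m)" for m
      unfolding U_def
    proof (rule square_sum_level_subset_ball[OF g \<rho>1(2,1) \<sigma>(1) \<rho>_ge])
      show "far_const * 4 ^ ?N * (LINT y|lebesgue. norm (g y))\<^sup>2 \<le> \<sigma> m * \<rho> m ^ (2 * ?N)"
        unfolding \<rho>_pow B_def[symmetric] using \<sigma>[of m] \<rho>1(1) by (simp add: distrib_left)
    qed
    define u where "u m = enn2real (wmeas w (U m))" for m
    have wU: "wmeas w (U m) = ennreal (u m)" for m
    proof -
      have "wmeas w (U m) < \<infinity>"
        using wmeas_mono[OF U_ball] wmeas_ball_finite[OF W] le_less_trans by blast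
      then show ?thesis by (simp add: u_def)
    qed
    have u0: "0 \<le> u m" for m by (simp add: u_def)
    obtain v where v: "wmeas w (ball 0 1) = ennreal v" "0 \<le> v"
      using wmeas_ball_finite[OF W, of 0 1] by (cases "wmeas w (ball 0 1)") auto
    \<comment> \<open>\<open>\<sigma> m * \<rho> m ^ (2 * ?N)\<close> is bounded uniformly in m, and
      by doubling f is controlled by its power q / 2.\<close>
    define M where "M = C * (1 / \<omega>) powr q * v * (s * (2 * \<rho>1 + 1) ^ (2 * ?N) + B) powr (q / 2)"
    define f where "f m = \<sigma> m powr (q / 2) * u m" for m
    have "f 0 \<le> b * y / (1 - \<theta>)"
    proof (rule iterate_contraction[OF \<theta>])
      fix m
      have "wmeas w (U m) \<le> ennreal (1 - 1 / c) * wmeas w (U (Suc m)) + wmeas w (max_set g (\<gamma> * sqrt (\<sigma> (Suc m))))"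
        unfolding U_def \<sigma>_Suc[of m] c_def
        using U_ball[of "Suc m"] bounded_subset[OF bounded_ball]
        by (intro good_lambda[OF A \<open>0 < q\<close> W g \<sigma>(1) \<eta> \<gamma>(1) \<gamma>1 \<gamma>2]) (auto simp: U_def)
      also have "wmeas w (max_set g (\<gamma> * sqrt (\<sigma> (Suc m))))
          \<le> ennreal (max_const ?N q C * (\<gamma> * sqrt (\<sigma> (Suc m))) powr (- q)) * Y"
        unfolding Y_def using \<gamma> \<sigma>[of "Suc m"] by (intro maximal_weak_type[OF A \<open>0 < q\<close> W g]) auto
      finally have "ennreal (u m) \<le> ennreal ((1 - 1 / c) * u (Suc m) + max_const ?N q C * (\<gamma> * sqrt (\<sigma> (Suc m))) powr (- q) * y)"
        unfolding wU y(1) using c u0 y max_pos by (simp add: ennreal_mult add_left_mono)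
      then have 1: "u m \<le> (1 - 1 / c) * u (Suc m) + max_const ?N q C * (\<gamma> * sqrt (\<sigma> (Suc m))) powr (- q) * y"
        using c u0 y max_pos by (subst (asm) ennreal_le_iff) auto
      have 2: "(\<gamma> * sqrt (\<sigma> (Suc m))) powr (- q) = good_ratio q C powr (- q / 2) * \<sigma> (Suc m) powr (- q / 2)"
        using ratio_pos \<sigma>[of "Suc m"]
        by (simp add: \<gamma>_def powr_mult powr_half_sqrt[symmetric] powr_powr)
      have 3: "\<sigma> m powr (q / 2) = 1 / \<kappa> * \<sigma> (Suc m) powr (q / 2)"
        unfolding \<sigma>_Suc[of m] powr_mult \<eta>_powr by simp
      have 4: "\<sigma> (Suc m) powr (q / 2) * \<sigma> (Suc m) powr (- q / 2) = 1"
        using \<sigma>[of "Suc m"] by (simp flip: powr_add)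
      have "f m \<le> \<sigma> m powr (q / 2) * ((1 - 1 / c) * u (Suc m) + max_const ?N q C * (\<gamma> * sqrt (\<sigma> (Suc m))) powr (- q) * y)"
        unfolding f_def by (intro mult_left_mono 1) simp
      also have "\<dots> = \<theta> * f (Suc m) + b * y * (\<sigma> (Suc m) powr (q / 2) * \<sigma> (Suc m) powr (- q / 2))"
        unfolding 2 3 f_def \<theta>_def b_def by (simp add: algebra_simps add_divide_distrib diff_divide_distrib)
      finally show "f m \<le> \<theta> * f (Suc m) + b * y" unfolding 4 by simp
    next
      fix m
      have "wmeas w (U m) \<le> wmeas w (ball 0 (\<rho> m * 1))"
        using U_ball by (simp add: wmeas_mono)
      also have "\<dots> \<le> ennreal (C * (\<rho> m ^ ?N / \<omega>) powr q) * wmeas w (ball 0 1)"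
        unfolding \<omega>_def using \<rho>_ge[of m] \<rho>1(1) by (intro wmeas_ball_scale[OF A \<open>0 < q\<close>]) auto
      finally have "u m \<le> C * (\<rho> m ^ ?N / \<omega>) powr q * v"
        unfolding wU v(1) using C v(2) by (simp add: ennreal_le_iff flip: ennreal_mult)
      then have "f m \<le> \<sigma> m powr (q / 2) * (C * (\<rho> m ^ ?N / \<omega>) powr q * v)"
        unfolding f_def by (rule mult_left_mono) simp
      also have "\<dots> = C * (1 / \<omega>) powr q * v * (\<sigma> m powr (q / 2) * ((\<rho> m ^ ?N) powr 2) powr (q / 2))"
        by (simp add: powr_divide powr_powr)
      also have "\<sigma> m powr (q / 2) * ((\<rho> m ^ ?N) powr 2) powr (q / 2) = (\<sigma> m * \<rho> m ^ (2 * ?N)) powr (q / 2)"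
        using \<rho>_ge[of m] \<rho>1(1) by (simp add: powr_mult power_mult mult.commute[of 2] powr_numeral)
      also have "C * (1 / \<omega>) powr q * v * \<dots> \<le> M"
        unfolding M_def
      proof (intro mult_left_mono powr_mono2)
        show "\<sigma> m * \<rho> m ^ (2 * ?N) \<le> s * (2 * \<rho>1 + 1) ^ (2 * ?N) + B"
        proof -
          have "\<sigma> m * \<rho> m ^ (2 * ?N) = \<sigma> m * (2 * \<rho>1 + 1) ^ (2 * ?N) + B"
            unfolding \<rho>_pow using \<sigma>(1)[of m] by (simp add: distrib_left)
          also have "\<dots> \<le> s * (2 * \<rho>1 + 1) ^ (2 * ?N) + B"
            using \<sigma>(2)[of m] \<rho>1(1) by (intro add_right_mono mult_right_mono) auto
          finally show ?thesis .
        qed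
      qed (use \<sigma>[of m] \<rho>_ge[of m] \<rho>1(1) C v \<open>0 < q\<close> in auto)
      finally show "f m \<le> M" .
    qed
    then have "s powr (- q / 2) * (s powr (q / 2) * u 0) \<le> s powr (- q / 2) * (weak_const q C * y)"
      unfolding weak_eq f_def by (intro mult_left_mono) (auto simp: \<sigma>_def)
    moreover have "s powr (- q / 2) * s powr (q / 2) = 1" using \<open>0 < s\<close> by (simp flip: powr_add)
    then have "s powr (- q / 2) * (s powr (q / 2) * u 0) = u 0"
      by (simp only: mult.assoc[symmetric] mult_1)
    ultimately have "u 0 \<le> weak_const q C * s powr (- q / 2) * y"
      by (simp only: mult_ac)
    then have "ennreal (u 0) \<le> ennreal (weak_const q C * s powr (- q / 2)) * ennreal y"
      using y pos by (simp add: ennreal_leI flip: ennreal_mult)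
    then show ?thesis unfolding y(1) wU[symmetric] by (simp add: U_def \<sigma>_def)
  qed
  then show "wmeas w {x. ennreal s < square_sum g x} \<le> ennreal (weak_const q C * s powr (- q / 2)) *
    (\<integral>\<^sup>+x. ennreal (norm (g x) powr q) * ennreal (w x) \<partial>lebesgue)" by (simp add: Y_def)
qed

end

section \<open>Discretisation of the intrinsic square function\<close>

text \<open>The conditions of \<open>adapted_family\<close> for a single cube, so that near-extremal
  functions can be chosen cube by cube.\<close>

definition adapted :: "real \<Rightarrow> real \<Rightarrow> real \<Rightarrow> int \<times> (int ^ 'n) \<Rightarrow> (real ^ 'n \<Rightarrow> complex) \<Rightarrow> bool" where
  "adapted \<beta> K R Q \<psi> \<longleftrightarrow> (\<forall>x. R * side Q < dist x (center Q) \<longrightarrow> \<psi> x = 0) \<and>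
     (LINT x|lebesgue. \<psi> x) = 0 \<and>
     (\<forall>x z. norm (\<psi> x - \<psi> z) \<le> K / side Q ^ CARD('n) * (dist x z / side Q) powr \<beta>) \<and>
     (\<forall>x. norm (\<psi> x) \<le> K / side Q ^ CARD('n))"

lemma adapted_familyI:
  assumes "0 < \<beta>" "\<beta> \<le> 1" "0 < K" "1 \<le> R" "\<And>Q. adapted \<beta> K R Q (\<phi> Q)"
  shows "adapted_family \<beta> K R \<phi>"
  using assms by unfold_locales (auto simp: adapted_def)

lemma adapted_zero: "0 < K \<Longrightarrow> adapted \<beta> K R Q (\<lambda>x. 0)"
  by (simp add: adapted_def)

lemma test_family_eq_0:
  assumes "\<phi> \<in> test_family \<beta>" "1 < norm u" shows "\<phi> u = 0"
proof (rule ccontr)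
  assume "\<phi> u \<noteq> 0"
  then have "u \<in> closure {x. \<phi> x \<noteq> 0}" by (intro closure_subset[THEN subsetD]) simp
  then have "norm u \<le> 1" using assms(1) unfolding test_family_def by blast
  then show False using assms(2) by simp
qed

lemma test_family_hoelder:
  "\<phi> \<in> test_family \<beta> \<Longrightarrow> norm (\<phi> x - \<phi> z) \<le> norm (x - z) powr \<beta>"
  by (simp add: test_family_def)

text \<open>The size bound follows from support and smoothness: a step of length 3 from the unit
  ball leaves the support, and the Hoelder condition gives 3^\<beta> \<le> 3.\<close>

lemma test_family_bound:
  fixes \<phi> :: "real ^ 'n \<Rightarrow> complex"
  assumes \<phi>: "\<phi> \<in> test_family \<beta>" and \<beta>: "0 < \<beta>" "\<beta> \<le> 1"
  shows "norm (\<phi> u) \<le> 3"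
proof (cases "norm u \<le> 1")
  case True
  obtain v :: "real ^ 'n" where v: "norm v = 3" using vector_choose_size[of 3] by auto
  have "1 < norm (u + v)" using True v norm_triangle_ineq2[of v "- u"] by (simp add: add.commute)
  then have "\<phi> (u + v) = 0" by (rule test_family_eq_0[OF \<phi>])
  then have "norm (\<phi> u) \<le> norm (u - (u + v)) powr \<beta>" using test_family_hoelder[OF \<phi>, of u "u + v"] by simp
  also have "\<dots> = 3 powr \<beta>" using v by simp
  also have "\<dots> \<le> 3 powr 1" using \<beta> by (intro powr_mono) auto
  finally show ?thesis by simp
qed (use test_family_eq_0[OF \<phi>] in auto)

lemma test_family_continuous:
  fixes \<phi> :: "real ^ 'n \<Rightarrow> complex"
  assumes \<phi>: "\<phi> \<in> test_family \<beta>" and \<beta>: "0 < \<beta>"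
  shows "continuous_on UNIV \<phi>"
  using test_family_hoelder[OF \<phi>] by (intro hoelder_imp_continuous[OF \<beta>, of _ 1]) (simp add: dist_norm)

lemma integral_dilate:
  fixes \<phi> :: "real ^ 'n \<Rightarrow> complex"
  assumes \<phi>: "\<phi> \<in> test_family \<beta>" and \<beta>: "0 < \<beta>" and t: "0 < t"
  shows "(LINT z|lebesgue. dilate t \<phi> (y - z)) = 0"
proof -
  have meas [measurable]: "\<phi> \<in> borel_measurable borel"
    using test_family_continuous[OF \<phi> \<beta>] by (rule borel_measurable_continuous_onI)
  have [measurable]: "(\<lambda>z. dilate t \<phi> (y - z)) \<in> borel_measurable borel"
    unfolding dilate_def by measurable
  have "(LINT z|lebesgue. dilate t \<phi> (y - z)) = (LINT z|lborel. dilate t \<phi> (y - z))"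
    by (rule integral_completion) simp
  also have "\<dots> = (LINT z|density (distr lborel borel (\<lambda>x. y + (- t) *\<^sub>R x)) (\<lambda>_. ennreal (\<bar>- t\<bar> ^ DIM(real ^ 'n))). dilate t \<phi> (y - z))"
    using t by (subst lborel_affine[of "- t" y]) auto
  also have "\<dots> = (LINT z|distr lborel borel (\<lambda>x. y + (- t) *\<^sub>R x). \<bar>- t\<bar> ^ DIM(real ^ 'n) *\<^sub>R dilate t \<phi> (y - z))"
    by (subst integral_density) auto
  also have "\<dots> = (LINT x|lborel. \<bar>- t\<bar> ^ DIM(real ^ 'n) *\<^sub>R dilate t \<phi> (y - (y + (- t) *\<^sub>R x)))"
    by (subst integral_distr) auto
  also have "\<dots> = (LINT x|lborel. \<phi> x)"
    using t by (simp add: dilate_def)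
  also have "\<dots> = (LINT x|lebesgue. \<phi> x)"
    by (rule integral_completion[symmetric]) simp
  also have "\<dots> = 0" using \<phi> by (simp add: test_family_def)
  finally show ?thesis .
qed

text \<open>The radius n + 1 adds the distance of y from the center to t \<le> side Q. In the size
  constant, 2^n comes from t \<ge> side Q / 2, and 4 covers both the bound 3 on the test functions
  and the Hoelder factor 2^\<beta>.\<close>

lemma adapted_dilate:
  fixes \<phi> :: "real ^ 'n \<Rightarrow> complex"
  assumes \<phi>: "\<phi> \<in> test_family \<beta>" and \<beta>: "0 < \<beta>" "\<beta> \<le> 1"
    and t: "side Q / 2 \<le> t" "t \<le> side Q"
    and y: "dist y (center Q) \<le> real CARD('n) * side Q"
  shows "adapted \<beta> (4 * 2 ^ CARD('n)) (real CARD('n) + 1) Q (\<lambda>z. dilate t \<phi> (y - z))"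
proof -
  let ?N = "CARD('n)" and ?l = "side Q"
  have l: "0 < ?l" by simp
  have t0: "0 < t" using t l by linarith
  have inv: "1 / t ^ ?N \<le> 2 ^ ?N / ?l ^ ?N"
  proof -
    have "1 / t ^ ?N \<le> 1 / (?l / 2) ^ ?N"
      using t l zero_less_power[OF t0, of ?N] by (intro divide_left_mono power_mono mult_pos_pos) auto
    then show ?thesis by (simp add: power_divide)
  qed
  show ?thesis
    unfolding adapted_def
  proof (intro conjI allI impI)
    fix x assume x: "(real ?N + 1) * ?l < dist x (center Q)"
    have "?l < dist y x"
      using x y dist_triangle2[of x "center Q" y] unfolding distrib_right
      by (simp add: dist_commute)
    then have "1 < norm ((y - x) /\<^sub>R t)"
      using t t0 by (simp add: dist_norm pos_less_divide_eq flip: divide_inverse_commute)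
    then show "dilate t \<phi> (y - x) = 0"
      using test_family_eq_0[OF \<phi>] by (simp add: dilate_def)
  next
    show "(LINT z|lebesgue. dilate t \<phi> (y - z)) = 0"
      by (rule integral_dilate[OF \<phi> \<beta>(1) t0])
  next
    fix x z
    have "norm (\<phi> ((y - x) /\<^sub>R t) - \<phi> ((y - z) /\<^sub>R t)) \<le> norm ((y - x) /\<^sub>R t - (y - z) /\<^sub>R t) powr \<beta>"
      by (rule test_family_hoelder[OF \<phi>])
    also have "(y - x) /\<^sub>R t - (y - z) /\<^sub>R t = (z - x) /\<^sub>R t"
      unfolding scaleR_diff_right[symmetric] by simp
    also have "norm ((z - x) /\<^sub>R t) powr \<beta> \<le> (2 * (dist x z / ?l)) powr \<beta>"
    proof (rule powr_mono2)
      have "dist x z / t \<le> dist x z / (?l / 2)"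
        using t l mult_pos_pos[OF t0 l] by (intro divide_left_mono) auto
      moreover have "norm ((z - x) /\<^sub>R t) = dist x z / t"
      proof -
        have "norm ((z - x) /\<^sub>R t) = inverse t * dist z x"
          using t0 by (simp add: dist_norm)
        then show ?thesis by (simp only: dist_commute[of z x] divide_inverse mult.commute)
      qed
      ultimately show "norm ((z - x) /\<^sub>R t) \<le> 2 * (dist x z / ?l)"
        by (simp add: mult.commute[of _ 2])
    qed (use \<beta> in auto)
    also have "\<dots> = 2 powr \<beta> * (dist x z / ?l) powr \<beta>" by (rule powr_mult)
    also have "\<dots> \<le> 2 powr 1 * (dist x z / ?l) powr \<beta>"
      using \<beta> by (intro mult_right_mono powr_mono) auto
    finally have *: "norm (\<phi> ((y - x) /\<^sub>R t) - \<phi> ((y - z) /\<^sub>R t)) \<le> 2 * (dist x z / ?l) powr \<beta>" by simp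
    have "norm (dilate t \<phi> (y - x) - dilate t \<phi> (y - z)) = 1 / t ^ ?N * norm (\<phi> ((y - x) /\<^sub>R t) - \<phi> ((y - z) /\<^sub>R t))"
      unfolding dilate_def scaleR_diff_right[symmetric] using t0 by simp
    also have "\<dots> \<le> 2 ^ ?N / ?l ^ ?N * (2 * (dist x z / ?l) powr \<beta>)"
      using t0 by (intro mult_mono inv *) auto
    also have "\<dots> \<le> 4 * 2 ^ ?N / ?l ^ ?N * (dist x z / ?l) powr \<beta>"
      by (simp add: mult_right_mono divide_right_mono)
    finally show "norm (dilate t \<phi> (y - x) - dilate t \<phi> (y - z)) \<le> 4 * 2 ^ ?N / ?l ^ ?N * (dist x z / ?l) powr \<beta>" .
  next
    fix x
    have "norm (dilate t \<phi> (y - x)) = 1 / t ^ ?N * norm (\<phi> ((y - x) /\<^sub>R t))"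
      using t0 by (simp add: dilate_def)
    also have "\<dots> \<le> 2 ^ ?N / ?l ^ ?N * 4"
      using t0 test_family_bound[OF \<phi> \<beta>, of "(y - x) /\<^sub>R t"] by (intro mult_mono inv) auto
    finally show "norm (dilate t \<phi> (y - x)) \<le> 4 * 2 ^ ?N / ?l ^ ?N" by (simp add: mult.commute)
  qed
qed

text \<open>The supremum need not be attained, so half of it is aimed at. It is finite because f is
  locally integrable, and if it is 0 the zero function serves.\<close>

lemma exists_near_extremal:
  fixes f :: "real ^ 'n \<Rightarrow> complex"
  assumes \<beta>: "0 < \<beta>" "\<beta> \<le> 1" and K: "0 < K" and R: "1 \<le> R" and f: "f \<in> borel_measurable lebesgue"
    and loc: "\<And>c r. mass f (cball c r) < \<infinity>"
  shows "\<exists>\<psi>. adapted \<beta> K R Q \<psi> \<and>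
    (\<forall>\<psi>'. adapted \<beta> K R Q \<psi>' \<longrightarrow> norm (LINT x|lebesgue. f x * \<psi>' x) \<le> 2 * norm (LINT x|lebesgue. f x * \<psi> x))"
proof -
  define X where "X = {norm (LINT x|lebesgue. f x * \<psi> x) |\<psi>. adapted \<beta> K R Q \<psi>}"
  define B where "B = ennreal (K / side Q ^ CARD('n)) *
     mass f (cball (center Q) (R * side Q))"
  have "B < \<infinity>" unfolding B_def using loc by (simp add: ennreal_mult_less_top)
  have "ennreal x \<le> B" if "x \<in> X" for x
  proof -
    from that obtain \<psi> where \<psi>: "adapted \<beta> K R Q \<psi>" and x: "x = norm (LINT x|lebesgue. f x * \<psi> x)"
      by (auto simp: X_def)
    \<comment> \<open>A family that vanishes for all other cubes makes
      \<open>norm_pairing_le\<close> applicable to the single function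
      \<open>\<psi>\<close>.\<close>
    define \<phi> where "\<phi> Q' = (if Q' = Q then \<psi> else (\<lambda>x. 0))" for Q'
    interpret adapted_family \<beta> K R \<phi>
      using \<psi> adapted_zero[OF K] by (intro adapted_familyI \<beta> K R) (auto simp: \<phi>_def)
    show ?thesis
      using norm_pairing_le[OF f, of Q] by (simp add: pairing_def \<phi>_def B_def x)
  qed
  then have B_bound: "x \<le> enn2real B" if "x \<in> X" for x
    using that \<open>B < \<infinity>\<close> by (cases B) (auto simp: X_def ennreal_le_iff)
  have zero: "0 \<in> X" using adapted_zero[OF K, of \<beta> R Q] by (force simp: X_def)
  have bdd: "bdd_above X" using B_bound by (rule bdd_aboveI)
  show ?thesis
  proof (cases "Sup X \<le> 0")
    case True
    then have "x \<le> 0" if "x \<in> X" for x using cSup_upper[OF that bdd] by simp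
    then have "norm (LINT x|lebesgue. f x * \<psi>' x) \<le> 0" if "adapted \<beta> K R Q \<psi>'" for \<psi>'
      using that unfolding X_def by blast
    then show ?thesis
      using adapted_zero[OF K, of \<beta> R Q] by (intro exI[of _ "\<lambda>x. 0"]) simp
  next
    case False
    then have "Sup X / 2 < Sup X" by simp
    then obtain x where "x \<in> X" "Sup X / 2 < x"
      using less_cSup_iff[OF _ bdd] zero by blast
    then obtain \<psi> where \<psi>: "adapted \<beta> K R Q \<psi>" "Sup X / 2 < norm (LINT x|lebesgue. f x * \<psi> x)"
      by (auto simp: X_def)
    have "norm (LINT x|lebesgue. f x * \<psi>' x) \<le> Sup X" if "adapted \<beta> K R Q \<psi>'" for \<psi>'
      using that by (intro cSup_upper bdd) (auto simp: X_def)
    then show ?thesis using \<psi> by (intro exI[of _ \<psi>]) force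
  qed
qed

text \<open>Rounding up the logarithm of t gives the scale, rounding the coordinates gives the
  position; the factor n comes from bounding the norm by the sum of the coordinates.\<close>

lemma exists_dyadic_index:
  fixes y :: "real ^ 'n"
  assumes "0 < t"
  shows "\<exists>Q. side Q / 2 \<le> t \<and> t \<le> side Q \<and> dist y (center Q) \<le> real CARD('n) * side Q"
proof -
  define k where "k = \<lceil>log 2 t\<rceil>"
  define Q :: "int \<times> (int ^ 'n)" where "Q = (k, \<chi> i. round (y $ i / 2 powi k))"
  have side: "side Q = 2 powr real_of_int k"
    by (simp add: side_def Q_def powr_real_of_int')
  have tl: "t = 2 powr (log 2 t)" using assms by simp
  have "t \<le> side Q"
    unfolding side by (subst tl, rule powr_mono) (auto simp: k_def)
  moreover have "side Q / 2 \<le> t"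
  proof -
    have "side Q / 2 = 2 powr (real_of_int k - 1)" by (simp add: side powr_diff)
    also have "\<dots> \<le> 2 powr (log 2 t)" unfolding k_def by (intro powr_mono) linarith+
    finally show ?thesis using assms by simp
  qed
  moreover have "dist y (center Q) \<le> real CARD('n) * side Q"
  proof -
    have "dist y (center Q) \<le> (\<Sum>i\<in>UNIV. \<bar>(y - center Q) $ i\<bar>)"
      unfolding dist_norm by (rule norm_le_l1_cart)
    also have "\<dots> \<le> (\<Sum>i\<in>(UNIV :: 'n set). side Q)"
    proof (rule sum_mono)
      fix i :: 'n
      define p :: real where "p = 2 powi k"
      have p: "0 < p" by (simp add: p_def)
      have "\<bar>(y - center Q) $ i\<bar> = p * \<bar>of_int (round (y $ i / p)) - y $ i / p\<bar>"
      proof -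
        have "(y - center Q) $ i = - (p * (of_int (round (y $ i / p)) - y $ i / p))"
          using p by (simp add: center_def Q_def p_def right_diff_distrib)
        then show ?thesis using p by (simp only: abs_minus_cancel abs_mult abs_of_pos)
      qed
      also have "\<dots> \<le> p * (1 / 2)"
        using of_int_round_abs_le[of "y $ i / p"] p by (intro mult_left_mono) auto
      also have "\<dots> \<le> side Q" using p by (simp add: side_def Q_def p_def)
      finally show "\<bar>(y - center Q) $ i\<bar> \<le> side Q" .
    qed
    finally show ?thesis by simp
  qed
  ultimately show ?thesis by blast
qed

text \<open>4 is the squared loss of the near-extremal choice; the rest is the volume of the box
  \<open>T Q\<close> times (2 / side)^(n + 1), the bound for t^(-n-1) on that box.\<close>

definition discretisation_const :: "nat \<Rightarrow> real" where
  "discretisation_const N = 4 * 2 ^ N * unit_ball_vol (real N) * real N ^ N"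

text \<open>The square of \<open>intrinsic_square\<close>, kept without the root for comparison with
  \<open>square_sum\<close>.\<close>

definition area_integral :: "real \<Rightarrow> (real ^ 'n \<Rightarrow> complex) \<Rightarrow> real ^ 'n \<Rightarrow> ennreal" where
  "area_integral \<beta> f x = (\<integral>\<^sup>+z\<in>cone x. (case z of (y, t) \<Rightarrow>
              (A_max \<beta> f y t)\<^sup>2 / ennreal (t ^ (CARD('n) + 1))) \<partial>lebesgue)"

text \<open>The family depends on f, but its constants do not. Each (y, t) of the cone lies in some
  box \<open>T Q\<close>, for which every dilated test function is adapted to Q, so
  \<open>A_max\<close> is at most twice the coefficient of the near-extremal function of Q.\<close>

lemma area_integral_le_square_sum:
  fixes f :: "real ^ 'n \<Rightarrow> complex"
  assumes \<beta>: "0 < \<beta>" "\<beta> \<le> 1" and f: "f \<in> borel_measurable lebesgue"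
    and loc: "\<And>c r. mass f (cball c r) < \<infinity>"
  shows "\<exists>\<phi>. adapted_family \<beta> (4 * 2 ^ CARD('n)) (real CARD('n) + 1) \<phi> \<and>
    (\<forall>x. area_integral \<beta> f x \<le> ennreal (discretisation_const CARD('n)) *
       adapted_family.square_sum (real CARD('n) + 1) \<phi> f x)"
proof -
  let ?N = "CARD('n)"
  let ?K = "4 * 2 ^ ?N :: real" and ?R = "real ?N + 1"
  define good where "good Q \<psi> \<longleftrightarrow> adapted \<beta> ?K ?R Q \<psi> \<and>
    (\<forall>\<psi>'. adapted \<beta> ?K ?R Q \<psi>' \<longrightarrow> norm (LINT x|lebesgue. f x * \<psi>' x) \<le> 2 * norm (LINT x|lebesgue. f x * \<psi> x))" for Q \<psi>
  define \<phi> where "\<phi> Q = (SOME \<psi>. good Q \<psi>)" for Q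
  have "\<exists>\<psi>. good Q \<psi>" for Q
    unfolding good_def by (intro exists_near_extremal \<beta> f loc) auto
  then have good: "good Q (\<phi> Q)" for Q
    unfolding \<phi>_def by (rule someI_ex)
  then have \<phi>: "adapted \<beta> ?K ?R Q (\<phi> Q)" for Q
    by (simp add: good_def)
  have ext: "norm (LINT x|lebesgue. f x * \<psi> x) \<le> 2 * norm (LINT x|lebesgue. f x * \<phi> Q x)" if "adapted \<beta> ?K ?R Q \<psi>" for Q \<psi>
    using good[of Q] that unfolding good_def by blast
  interpret adapted_family \<beta> ?K ?R \<phi>
    by (intro adapted_familyI \<beta> \<phi>) auto
  define T where "T Q = cball (center Q) (real ?N * side Q) \<times> {side Q / 2..side Q}" for Q :: "int \<times> (int ^ 'n)"
  have T_closed: "closed (T Q)" for Q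
    unfolding T_def by (intro closed_Times) auto
  then have T_meas [measurable]: "T Q \<in> sets lebesgue" for Q
    by (simp add: borel_closed)
  have T_emeasure: "emeasure lebesgue (T Q) = ennreal (unit_ball_vol (real ?N) * (real ?N * side Q) ^ ?N * (side Q / 2))" for Q
  proof -
    have "emeasure lebesgue (T Q) = emeasure (lborel \<Otimes>\<^sub>M lborel) (T Q)"
      using T_closed[of Q] by (simp add: lborel_prod borel_closed)
    also have "\<dots> = emeasure lborel (cball (center Q) (real ?N * side Q)) * emeasure lborel {side Q / 2..side Q}"
      unfolding T_def by (intro lborel.emeasure_pair_measure_Times) auto
    finally show ?thesis
      by (simp add: emeasure_cball flip: ennreal_mult)
  qed
  have "area_integral \<beta> f x \<le> ennreal (discretisation_const ?N) * square_sum f x" for x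
  proof -
    define D where "D Q = 4 * (norm (pairing f Q))\<^sup>2 * bump Q x * (2 / side Q) ^ (?N + 1)" for Q
    have D0: "0 \<le> D Q" for Q by (simp add: D_def)
    have pointwise: "(A_max \<beta> f y t)\<^sup>2 / ennreal (t ^ (?N + 1)) \<le> ennreal (D Q)"
      if "(y, t) \<in> T Q" "norm (x - y) < t" for y t Q
    proof -
      have y: "dist y (center Q) \<le> real ?N * side Q"
        and t: "side Q / 2 \<le> t" "t \<le> side Q"
        using that by (auto simp: T_def dist_commute)
      have t0: "0 < t" using t side_pos[of Q] by linarith
      have "A_max \<beta> f y t \<le> ennreal (2 * norm (pairing f Q))"
        unfolding A_max_def
      proof (rule SUP_least, rule ennreal_leI)
        fix \<psi> :: "real ^ 'n \<Rightarrow> complex" assume "\<psi> \<in> test_family \<beta>"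
        then show "norm (convolve f (dilate t \<psi>) y) \<le> 2 * norm (pairing f Q)"
          unfolding convolve_def pairing_def by (intro ext adapted_dilate \<beta> t y)
      qed
      then have "(A_max \<beta> f y t)\<^sup>2 \<le> (ennreal (2 * norm (pairing f Q)))\<^sup>2"
        by (rule power_mono) simp
      also have "\<dots> = ennreal ((2 * norm (pairing f Q))\<^sup>2)"
        by (rule ennreal_power) simp
      finally have "(A_max \<beta> f y t)\<^sup>2 \<le> ennreal ((2 * norm (pairing f Q))\<^sup>2)" .
      then have "(A_max \<beta> f y t)\<^sup>2 / ennreal (t ^ (?N + 1)) \<le> ennreal ((2 * norm (pairing f Q))\<^sup>2) / ennreal (t ^ (?N + 1))"
        by (rule divide_right_mono_ennreal)
      also have "\<dots> = ennreal ((2 * norm (pairing f Q))\<^sup>2 * (1 / t ^ (?N + 1)))"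
        using t0 by (simp add: divide_ennreal)
      also have "\<dots> \<le> ennreal (4 * (norm (pairing f Q))\<^sup>2 * bump Q x * (2 / side Q) ^ (?N + 1))"
      proof (rule ennreal_leI, rule mult_mono)
        \<comment> \<open>x is within t \<le> side Q of y, and y within n sides of the center; this
          is why the bump is at least 1 at x.\<close>
        have "dist x (center Q) \<le> ?R * side Q"
          using that(2) t y dist_triangle[of x "center Q" y] unfolding distrib_right
          by (simp add: dist_norm)
        then have "1 \<le> bump Q x" by (rule bump_ge_1)
        then show "(2 * norm (pairing f Q))\<^sup>2 \<le> 4 * (norm (pairing f Q))\<^sup>2 * bump Q x"
          using mult_left_mono[of 1 "bump Q x" "4 * (norm (pairing f Q))\<^sup>2"] by (simp add: power_mult_distrib)
        have "1 / t ^ (?N + 1) = (1 / t) ^ (?N + 1)" by (simp add: power_one_over)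
        also have "\<dots> \<le> (2 / side Q) ^ (?N + 1)"
          using t t0 by (intro power_mono) (auto simp: field_simps)
        finally show "1 / t ^ (?N + 1) \<le> (2 / side Q) ^ (?N + 1)" .
      qed (use t0 in auto)
      finally show ?thesis by (simp add: D_def)
    qed
    have "area_integral \<beta> f x \<le> (\<integral>\<^sup>+z. (\<integral>\<^sup>+Q. ennreal (D Q) * indicator (T Q) z \<partial>count_space UNIV) \<partial>lebesgue)"
      unfolding area_integral_def
    proof (rule nn_integral_mono)
      fix z :: "(real ^ 'n) \<times> real"
      obtain y t where z: "z = (y, t)" by force
      show "(case z of (y, t) \<Rightarrow> (A_max \<beta> f y t)\<^sup>2 / ennreal (t ^ (?N + 1))) * indicator (cone x) z
          \<le> (\<integral>\<^sup>+Q. ennreal (D Q) * indicator (T Q) z \<partial>count_space UNIV)"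
      proof (cases "z \<in> cone x")
        case True
        then have t: "0 < t" "norm (x - y) < t" by (auto simp: cone_def z)
        obtain Q where Q: "(y, t) \<in> T Q"
          using exists_dyadic_index[OF t(1), of y] by (auto simp: T_def dist_commute)
        have "(A_max \<beta> f y t)\<^sup>2 / ennreal (t ^ (?N + 1)) \<le> ennreal (D Q) * indicator (T Q) z"
          using pointwise[OF Q t(2)] Q z by simp
        also have "\<dots> \<le> (\<integral>\<^sup>+Q. ennreal (D Q) * indicator (T Q) z \<partial>count_space UNIV)"
          by (rule nn_integral_ge_point) simp
        finally show ?thesis using True z by simp
      qed simp
    qed
    also have "\<dots> = (\<integral>\<^sup>+Q. (\<integral>\<^sup>+z. ennreal (D Q) * indicator (T Q) z \<partial>lebesgue) \<partial>count_space UNIV)"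
      by (rule nn_integral_count_space_nn_integral) auto
    also have "\<dots> = (\<integral>\<^sup>+Q. ennreal (discretisation_const ?N) * ennreal ((norm (pairing f Q))\<^sup>2 * bump Q x) \<partial>count_space UNIV)"
    proof (rule nn_integral_cong)
      fix Q
      have "(\<integral>\<^sup>+z. ennreal (D Q) * indicator (T Q) z \<partial>lebesgue) = ennreal (D Q) * emeasure lebesgue (T Q)"
        by (rule nn_integral_cmult_indicator) simp
      also have "\<dots> = ennreal (D Q * (unit_ball_vol (real ?N) * (real ?N * side Q) ^ ?N * (side Q / 2)))"
        unfolding T_emeasure using D0 by (intro ennreal_mult[symmetric]) auto
      also have "D Q * (unit_ball_vol (real ?N) * (real ?N * side Q) ^ ?N * (side Q / 2))
          = discretisation_const ?N * ((norm (pairing f Q))\<^sup>2 * bump Q x)"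
        by (simp add: D_def discretisation_const_def power_mult_distrib power_divide)
      finally show "(\<integral>\<^sup>+z. ennreal (D Q) * indicator (T Q) z \<partial>lebesgue)
          = ennreal (discretisation_const ?N) * ennreal ((norm (pairing f Q))\<^sup>2 * bump Q x)"
        by (simp add: ennreal_mult discretisation_const_def)
    qed
    also have "\<dots> = ennreal (discretisation_const ?N) * square_sum f x"
      unfolding square_sum_def by (rule nn_integral_cmult) simp
    finally show ?thesis .
  qed
  then show ?thesis using adapted_family_axioms by blast
qed

section \<open>Measurability of the square function\<close>

lemma norm_scaleR_inverse: "0 < t \<Longrightarrow> norm (v /\<^sub>R t) = norm v / t"
  by (simp add: divide_inverse mult.commute)

text \<open>Dominated convergence: along a convergent sequence with t bounded away from 0 the
  kernels are uniformly bounded and supported in one ball. Continuity is what makes the uncountable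
  supremum in \<open>A_max\<close> measurable.\<close>

lemma continuous_convolve_dilate:
  fixes f :: "real ^ 'n \<Rightarrow> complex"
  assumes f: "f \<in> borel_measurable lebesgue"
    and loc: "\<And>c r. mass f (cball c r) < \<infinity>"
    and \<phi>: "\<phi> \<in> test_family \<beta>" and \<beta>: "0 < \<beta>" "\<beta> \<le> 1"
  shows "continuous_on {z. 0 < snd z} (\<lambda>z. convolve f (dilate (snd z) \<phi>) (fst z))"
  unfolding continuous_on_sequentially
proof (intro allI ballI impI)
  fix X :: "nat \<Rightarrow> (real ^ 'n) \<times> real" and a
  assume a: "a \<in> {z. 0 < snd z}" and X: "(\<forall>n. X n \<in> {z. 0 < snd z}) \<and> X \<longlonglongrightarrow> a"
  let ?N = "CARD('n)"
  note [measurable] = f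
  have \<phi>_cont: "continuous_on UNIV \<phi>" by (rule test_family_continuous[OF \<phi> \<beta>(1)])
  then have [measurable]: "\<phi> \<in> borel_measurable borel" by (rule borel_measurable_continuous_onI)
  define y where "y n = fst (X n)" for n
  define t where "t n = snd (X n)" for n
  have y: "y \<longlonglongrightarrow> fst a" and t: "t \<longlonglongrightarrow> snd a"
    unfolding y_def t_def using X by (auto intro: tendsto_intros)
  have t0: "0 < t n" "0 < snd a" for n using X a by (auto simp: t_def)
  have "(\<lambda>n. 1 / t n) \<longlonglongrightarrow> 1 / snd a" using t t0 by (intro tendsto_intros) auto
  then have "Bseq (\<lambda>n. 1 / t n)" by (rule convergent_imp_Bseq[OF convergentI])
  then obtain M where M: "\<And>n. 1 / t n \<le> M" "0 < M"
    unfolding Bseq_def using t0 by (metis abs_le_D1 real_norm_def)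
  have "Bseq t" using t by (rule convergent_imp_Bseq[OF convergentI])
  then obtain M1 where M1: "\<And>n. t n \<le> M1" unfolding Bseq_def by (metis abs_le_D1 real_norm_def)
  have "Bseq y" using y by (rule convergent_imp_Bseq[OF convergentI])
  then obtain M2 where M2: "\<And>n. norm (y n) \<le> M2" unfolding Bseq_def by blast
  define g where "g z = M ^ ?N * 3 * (norm (f z) * indicator (cball 0 (M1 + M2)) z)" for z
  have "(\<lambda>n. LINT z|lebesgue. f z * dilate (t n) \<phi> (y n - z)) \<longlonglongrightarrow> (LINT z|lebesgue. f z * dilate (snd a) \<phi> (fst a - z))"
  proof (rule integral_dominated_convergence)
    have *: "(\<lambda>z. dilate s \<phi> (v - z)) \<in> borel_measurable lebesgue" for s v
    proof -
      have "(\<lambda>z. dilate s \<phi> (v - z)) \<in> borel_measurable borel" unfolding dilate_def by measurable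
      then show ?thesis by (simp add: measurable_completion)
    qed
    show "(\<lambda>z. f z * dilate (snd a) \<phi> (fst a - z)) \<in> borel_measurable lebesgue"
      "(\<lambda>z. f z * dilate (t n) \<phi> (y n - z)) \<in> borel_measurable lebesgue" for n
      by (intro borel_measurable_times f *)+
    have "integrable lebesgue (\<lambda>z. norm (f z) * indicator (cball 0 (M1 + M2)) z)"
    proof (rule integrableI_bounded)
      have "(\<integral>\<^sup>+z. ennreal (norm (norm (f z) * indicator (cball 0 (M1 + M2)) z)) \<partial>lebesgue)
          = mass f (cball 0 (M1 + M2))"
        by (intro nn_integral_cong) (auto simp: indicator_def)
      then show "(\<integral>\<^sup>+z. ennreal (norm (norm (f z) * indicator (cball 0 (M1 + M2)) z)) \<partial>lebesgue) < \<infinity>"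
        using loc by simp
    qed measurable
    then show "integrable lebesgue g" unfolding g_def by (rule integrable_mult_right)
    show "AE z in lebesgue. (\<lambda>n. f z * dilate (t n) \<phi> (y n - z)) \<longlonglongrightarrow> f z * dilate (snd a) \<phi> (fst a - z)"
    proof (intro AE_I2)
      fix z
      have "(\<lambda>n. (y n - z) /\<^sub>R t n) \<longlonglongrightarrow> (fst a - z) /\<^sub>R snd a"
        using y t t0 by (intro tendsto_intros) auto
      then have "(\<lambda>n. \<phi> ((y n - z) /\<^sub>R t n)) \<longlonglongrightarrow> \<phi> ((fst a - z) /\<^sub>R snd a)"
        using \<phi>_cont by (intro continuous_on_tendsto_compose[OF \<phi>_cont]) auto
      then show "(\<lambda>n. f z * dilate (t n) \<phi> (y n - z)) \<longlonglongrightarrow> f z * dilate (snd a) \<phi> (fst a - z)"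
        unfolding dilate_def using t t0 by (intro tendsto_intros) auto
    qed
    show "AE z in lebesgue. norm (f z * dilate (t n) \<phi> (y n - z)) \<le> g z" for n
    proof (intro AE_I2)
      fix z
      show "norm (f z * dilate (t n) \<phi> (y n - z)) \<le> g z"
      proof (cases "norm z \<le> M1 + M2")
        case True
        have "norm (dilate (t n) \<phi> (y n - z)) = (1 / t n) ^ ?N * norm (\<phi> ((y n - z) /\<^sub>R t n))"
          using t0(1)[of n] by (simp add: dilate_def power_one_over abs_of_pos)
        also have "\<dots> \<le> M ^ ?N * 3"
          using M t0 less_imp_le[OF t0(1)] by (intro mult_mono power_mono test_family_bound[OF \<phi> \<beta>]) auto
        finally have "norm (f z) * norm (dilate (t n) \<phi> (y n - z)) \<le> norm (f z) * (M ^ ?N * 3)"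
          by (rule mult_left_mono) simp
        then show ?thesis using True by (simp add: g_def norm_mult mult_ac)
      next
        case False
        have "t n < norm (y n - z)"
          using False M1[of n] M2[of n] norm_triangle_ineq2[of z "y n"] by (simp add: norm_minus_commute)
        then have "1 < norm ((y n - z) /\<^sub>R t n)"
          using t0(1)[of n] by (simp only: norm_scaleR_inverse pos_less_divide_eq mult_1)
        then have "dilate (t n) \<phi> (y n - z) = 0"
          using test_family_eq_0[OF \<phi>] by (simp add: dilate_def)
        then show ?thesis using M by (simp add: g_def)
      qed
    qed
  qed
  then show "((\<lambda>z. convolve f (dilate (snd z) \<phi>) (fst z)) \<circ> X) \<longlonglongrightarrow> convolve f (dilate (snd a) \<phi>) (fst a)"
    by (simp add: convolve_def comp_def y_def t_def)
qed

text \<open>A supremum of functions continuous on the open half-space has open superlevel sets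
  there, even over an uncountable family; Tonelli's theorem with the indicator of the cones does the
  rest.\<close>

lemma borel_measurable_area_integral:
  fixes f :: "real ^ 'n \<Rightarrow> complex"
  assumes f: "f \<in> borel_measurable lebesgue"
    and loc: "\<And>c r. mass f (cball c r) < \<infinity>"
    and \<beta>: "0 < \<beta>" "\<beta> \<le> 1"
  shows "area_integral \<beta> f \<in> borel_measurable borel"
proof -
  let ?P = "{z :: (real ^ 'n) \<times> real. 0 < snd z}"
  have P_open: "open ?P" by (intro open_Collect_less continuous_intros)
  define A where "A z = A_max \<beta> f (fst z) (snd z) * indicator ?P z" for z
  have A_meas [measurable]: "A \<in> borel_measurable borel"
  proof (rule borel_measurableI_greater)
    fix c
    have "open {z \<in> ?P. c < ennreal (norm (convolve f (dilate (snd z) \<phi>) (fst z)))}" if "\<phi> \<in> test_family \<beta>" for \<phi>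
    proof -
      have "continuous_on ?P (\<lambda>z. ennreal (norm (convolve f (dilate (snd z) \<phi>) (fst z))))"
        by (intro continuous_on_ennreal continuous_on_norm continuous_convolve_dilate[OF f loc that \<beta>])
      then have "open (?P \<inter> (\<lambda>z. ennreal (norm (convolve f (dilate (snd z) \<phi>) (fst z)))) -` {c<..})"
        using P_open by (intro continuous_open_preimage) auto
      also have "?P \<inter> (\<lambda>z. ennreal (norm (convolve f (dilate (snd z) \<phi>) (fst z)))) -` {c<..}
          = {z \<in> ?P. c < ennreal (norm (convolve f (dilate (snd z) \<phi>) (fst z)))}" by auto
      finally show ?thesis .
    qed
    then have "open (\<Union>\<phi>\<in>test_family \<beta>. {z \<in> ?P. c < ennreal (norm (convolve f (dilate (snd z) \<phi>) (fst z)))})"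
      by auto
    moreover have "{z \<in> space borel. c < A z} = (\<Union>\<phi>\<in>test_family \<beta>. {z \<in> ?P. c < ennreal (norm (convolve f (dilate (snd z) \<phi>) (fst z)))})"
      by (auto simp: A_def A_max_def less_SUP_iff indicator_def split: if_splits)
    ultimately show "{z \<in> space borel. c < A z} \<in> sets borel" by simp
  qed
  define G where "G z = (A z)\<^sup>2 / ennreal (snd z ^ (CARD('n) + 1))" for z
  have [measurable]: "(\<lambda>z :: (real ^ 'n) \<times> real. snd z) \<in> borel_measurable borel"
    by (intro borel_measurable_continuous_onI continuous_intros)
  have G_meas: "G \<in> borel_measurable borel" unfolding G_def by measurable
  define S where "S = {p :: (real ^ 'n) \<times> (real ^ 'n) \<times> real. 0 < snd (snd p) \<and> norm (fst p - fst (snd p)) < snd (snd p)}"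
  have "open S" unfolding S_def by (intro open_Collect_conj open_Collect_less continuous_intros)
  then have "S \<in> sets borel" by simp
  have "(\<lambda>p. G (snd p) * indicator S p) \<in> borel_measurable (borel \<Otimes>\<^sub>M lborel)"
  proof -
    have "snd \<in> borel_measurable (borel :: ((real ^ 'n) \<times> (real ^ 'n) \<times> real) measure)"
      by (intro borel_measurable_continuous_onI continuous_intros)
    then have "(\<lambda>p. G (snd p) * indicator S p) \<in> borel_measurable borel"
      using \<open>S \<in> sets borel\<close>
      by (intro borel_measurable_times_ennreal measurable_compose[OF _ G_meas] borel_measurable_indicator)
    moreover have "sets (borel \<Otimes>\<^sub>M lborel) = sets (borel :: ((real ^ 'n) \<times> (real ^ 'n) \<times> real) measure)"
      by (simp add: borel_prod[symmetric] cong: sets_pair_measure_cong)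
    ultimately show ?thesis using measurable_cong_sets by blast
  qed
  then have "(\<lambda>x. \<integral>\<^sup>+z. G z * indicator S (x, z) \<partial>lborel) \<in> borel_measurable borel"
    using lborel.borel_measurable_nn_integral[of "\<lambda>x z. G z * indicator S (x, z)" borel] by (simp add: split_beta')
  also have "(\<lambda>x. \<integral>\<^sup>+z. G z * indicator S (x, z) \<partial>lborel) = area_integral \<beta> f"
  proof
    fix x
    have "(\<integral>\<^sup>+z. G z * indicator S (x, z) \<partial>lborel) = (\<integral>\<^sup>+z. G z * indicator S (x, z) \<partial>lebesgue)"
      by (rule nn_integral_completion[symmetric])
    also have "\<dots> = area_integral \<beta> f x"
      unfolding area_integral_def
      by (intro nn_integral_cong) (auto simp: G_def A_def S_def cone_def indicator_def)
    finally show "(\<integral>\<^sup>+z. G z * indicator S (x, z) \<partial>lborel) = area_integral \<beta> f x" .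
  qed
  finally show ?thesis .
qed

lemma intrinsic_square_eq: "intrinsic_square \<beta> f x = epowr (area_integral \<beta> f x) (1 / 2)"
  by (simp add: intrinsic_square_def area_integral_def)

lemma level_intrinsic_square:
  assumes "0 < \<sigma>"
  shows "\<bar>enn2ereal (intrinsic_square \<beta> f x)\<bar> > ereal \<sigma> \<longleftrightarrow> ennreal (\<sigma>\<^sup>2) < area_integral \<beta> f x"
proof (cases "area_integral \<beta> f x")
  case (real a)
  show ?thesis
  proof (cases "a = 0")
    case True
    then show ?thesis using assms real by (simp add: intrinsic_square_eq epowr_0 zero_ennreal.rep_eq)
  next
    case False
    then have a: "0 < a" using real by simp
    then have "intrinsic_square \<beta> f x = ennreal (sqrt a)"
      using real by (simp add: intrinsic_square_eq epowr_ennreal powr_half_sqrt)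
    moreover have "\<sigma> < sqrt a \<longleftrightarrow> \<sigma>\<^sup>2 < a"
      using assms a real_less_rsqrt[of \<sigma> a] real_sqrt_less_iff[of "\<sigma>\<^sup>2" a] by auto
    ultimately show ?thesis using a real by (simp add: enn2ereal_ennreal ennreal_less_iff)
  qed
next
  case top
  then show ?thesis by (simp add: intrinsic_square_eq epowr_top enn2ereal_top)
qed

lemma measurable_intrinsic_square:
  fixes f :: "real ^ 'n \<Rightarrow> complex"
  assumes "f \<in> borel_measurable lebesgue"
    and "\<And>c r. mass f (cball c r) < \<infinity>"
    and "0 < \<beta>" "\<beta> \<le> 1"
  shows "(\<lambda>x. enn2ereal (intrinsic_square \<beta> f x)) \<in> borel_measurable lebesgue"
proof -
  have "(\<lambda>x. enn2ereal (epowr (area_integral \<beta> f x) (1 / 2))) \<in> borel_measurable borel"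
    using borel_measurable_epowr[OF borel_measurable_area_integral[OF assms], of "1 / 2"] by measurable
  then show ?thesis by (simp add: intrinsic_square_eq measurable_completion)
qed

section \<open>Sums over annuli\<close>

lemma powr_add_le:
  fixes x y p :: real
  assumes "0 \<le> x" "0 \<le> y" "0 < p" "p \<le> 1"
  shows "(x + y) powr p \<le> x powr p + y powr p"
proof (cases "x + y = 0")
  case False
  then have s: "0 < x + y" using assms by linarith
  have *: "z / (x + y) \<le> (z / (x + y)) powr p" if "0 \<le> z" "z \<le> x + y" for z
  proof (cases "z = 0")
    case False
    have "(z / (x + y)) powr 1 \<le> (z / (x + y)) powr p"
      using that s assms by (intro powr_mono') (auto simp: pos_divide_le_eq)
    then show ?thesis using that s by simp
  qed simp
  have "1 = x / (x + y) + y / (x + y)" using s by (simp flip: add_divide_distrib)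
  also have "\<dots> \<le> (x / (x + y)) powr p + (y / (x + y)) powr p"
    using assms by (intro add_mono *) auto
  also have "\<dots> = (x powr p + y powr p) / (x + y) powr p"
    by (simp add: powr_divide add_divide_distrib)
  finally show ?thesis using s by (simp add: pos_le_divide_eq)
qed (use assms in auto)

lemma powr_sum_le:
  fixes f :: "'a \<Rightarrow> real"
  assumes "finite A" "\<And>i. i \<in> A \<Longrightarrow> 0 \<le> f i" "0 < p" "p \<le> 1"
  shows "(\<Sum>i\<in>A. f i) powr p \<le> (\<Sum>i\<in>A. f i powr p)"
  using assms(1,2)
proof (induction A rule: finite_induct)
  case (insert a A)
  have "(f a + (\<Sum>i\<in>A. f i)) powr p \<le> f a powr p + (\<Sum>i\<in>A. f i) powr p"
    using insert.prems assms by (intro powr_add_le sum_nonneg) auto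
  also have "\<dots> \<le> f a powr p + (\<Sum>i\<in>A. f i powr p)"
    using insert.IH insert.prems by simp
  finally show ?case using insert.hyps by simp
qed simp

lemma epowr_mono: "x \<le> y \<Longrightarrow> 0 < r \<Longrightarrow> epowr x r \<le> epowr y r"
  by (cases x; cases y) (auto simp: epowr_def powr_mono2 ennreal_leI top_unique)

lemma epowr_epowr:
  assumes "0 < r" "0 < s" shows "epowr (epowr x r) s = epowr x (r * s)"
proof -
  have "0 < r * s" using assms by simp
  then show ?thesis using assms by (cases x) (auto simp: epowr_def powr_powr mult_less_0_iff)
qed

lemma epowr_ennreal_nonneg: "0 \<le> x \<Longrightarrow> 0 < r \<Longrightarrow> epowr (ennreal x) r = ennreal (x powr r)"
  by (simp add: epowr_def)

text \<open>The embedding of l^p into l^1 for p \<le> 1, from the subadditivity of t^p on finite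
  sums.\<close>

lemma nn_integral_le_epowr:
  fixes a :: "'a \<Rightarrow> real"
  assumes "countable I" "\<And>i. i \<in> I \<Longrightarrow> 0 \<le> a i" "0 < p" "p \<le> 1"
    and "(\<integral>\<^sup>+i. ennreal (a i powr p) \<partial>count_space I) \<le> ennreal (H powr p)" "0 \<le> H"
  shows "(\<integral>\<^sup>+i. ennreal (a i) \<partial>count_space I) \<le> ennreal H"
proof (rule nn_integral_count_space_le[OF \<open>countable I\<close>])
  fix G assume G: "finite G" "G \<subseteq> I"
  have "ennreal (\<Sum>i\<in>G. a i powr p) = (\<Sum>i\<in>G. ennreal (a i powr p))" by (simp add: sum_ennreal)
  also have "\<dots> \<le> (\<integral>\<^sup>+i. ennreal (a i powr p) \<partial>count_space I)"
    unfolding nn_integral_count_space_eq_SUP[OF \<open>countable I\<close>] using G by (intro SUP_upper) auto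
  also have "\<dots> \<le> ennreal (H powr p)" by fact
  finally have "(\<Sum>i\<in>G. a i powr p) \<le> H powr p" by (simp add: ennreal_le_iff)
  moreover have "(\<Sum>i\<in>G. a i) powr p \<le> (\<Sum>i\<in>G. a i powr p)"
    using G assms by (intro powr_sum_le) auto
  ultimately have "(\<Sum>i\<in>G. a i) powr p \<le> H powr p" by simp
  then have "(\<Sum>i\<in>G. a i) \<le> H"
    using \<open>0 < p\<close> \<open>0 \<le> H\<close> by (meson not_le powr_less_mono2)
  then have "ennreal (\<Sum>i\<in>G. a i) \<le> ennreal H" by (rule ennreal_leI)
  then show "(\<Sum>i\<in>G. ennreal (a i)) \<le> ennreal H"
    using G assms(2) by (subst sum_ennreal) auto
qed

lemma geometric_growth_sum_le:
  fixes z :: "int \<Rightarrow> real"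
  assumes "0 \<le> \<delta>" "\<delta> < 1" "0 \<le> M" "\<And>i k. i \<le> k \<Longrightarrow> z i \<le> \<delta> ^ nat (k - i) * z k"
    and "finite G" "\<And>k. k \<in> G \<Longrightarrow> z k \<le> M"
  shows "(\<Sum>k\<in>G. z k) \<le> M / (1 - \<delta>)"
proof (cases "G = {}")
  case False
  define m where "m = Max G"
  have m: "m \<in> G" "\<And>k. k \<in> G \<Longrightarrow> k \<le> m" using False \<open>finite G\<close> by (auto simp: m_def)
  have "(\<Sum>k\<in>G. z k) \<le> (\<Sum>k\<in>G. M * \<delta> ^ nat (- k - (- m)))"
  proof (rule sum_mono)
    fix k assume k: "k \<in> G"
    have "z k \<le> \<delta> ^ nat (m - k) * z m" using m k assms(4) by blast
    also have "\<dots> \<le> \<delta> ^ nat (m - k) * M" using assms m by (intro mult_left_mono) auto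
    finally show "z k \<le> M * \<delta> ^ nat (- k - (- m))" by (simp add: mult.commute)
  qed
  also have "\<dots> = M * (\<Sum>k\<in>uminus ` G. \<delta> ^ nat (k - (- m)))"
    by (subst sum.reindex) (auto simp: sum_distrib_left)
  also have "\<dots> \<le> M * (1 / (1 - \<delta>))"
    using assms m by (intro mult_left_mono sum_geometric_int_le) auto
  finally show ?thesis by simp
qed (use assms in auto)

section \<open>Growth of the weights of dyadic balls\<close>

lemma Bk_eq_cball: "Bk k = cball 0 (2 powi k)"
  by (auto simp: Bk_def)

lemma sets_Bk [measurable, simp]: "Bk k \<in> sets lebesgue"
  by (simp add: Bk_eq_cball)

definition ball_weight :: "(real ^ 'n \<Rightarrow> real) \<Rightarrow> int \<Rightarrow> real" where
  "ball_weight w k = enn2real (wmeas w (Bk k))"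

lemma wmeas_Bk:
  fixes w :: "real ^ 'n \<Rightarrow> real"
  assumes "is_weight w" shows "wmeas w (Bk k) = ennreal (ball_weight w k)"
  using wmeas_cball_finite[OF assms, of 0 "2 powi k"] by (simp add: ball_weight_def Bk_eq_cball)

lemma ball_weight_pos:
  fixes w :: "real ^ 'n \<Rightarrow> real"
  assumes "avg_cond s w C" "0 < s" "is_weight w"
  shows "0 < ball_weight w k"
proof -
  have "0 < wmeas w (ball 0 (2 powi k))" by (rule wmeas_ball_pos[OF assms]) simp
  also have "\<dots> \<le> ennreal (ball_weight w k)"
    unfolding wmeas_Bk[OF assms(3), symmetric] by (rule wmeas_mono) (auto simp: Bk_eq_cball)
  finally show ?thesis by simp
qed

text \<open>Doubling from one dyadic ball to another: the first power absorbs the passage to an open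
  ball of twice the radius, while the second, of exponent n s, is the one to be matched with the
  decay of the kernel.\<close>

lemma ball_weight_growth:
  fixes w :: "real ^ 'n \<Rightarrow> real"
  assumes A: "avg_cond s w C" "0 < s" and W: "is_weight w" and "i \<le> k"
  shows "ball_weight w k \<le> C * (2 ^ CARD('n) / unit_ball_vol (real CARD('n))) powr s *
     ((2 powi (k - i)) ^ CARD('n)) powr s * ball_weight w i"
proof -
  have C: "0 < C" using A by (simp add: avg_cond_def)
  define t :: real where "t = 2 * 2 powi (k - i)"
  have "2 powi (k - i) * 2 powi i = (2::real) powi k"
    by (simp flip: power_int_add)
  then have tk: "t * 2 powi i = 2 * 2 powi k" by (simp add: t_def)
  have "1 \<le> (2::real) powi (k - i)" using \<open>i \<le> k\<close> by (simp add: power_int_def)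
  then have t: "1 \<le> t" by (simp add: t_def)
  have "ennreal (ball_weight w k) \<le> wmeas w (ball 0 (t * 2 powi i))"
    unfolding wmeas_Bk[OF W, symmetric] tk Bk_eq_cball
    by (intro wmeas_mono) (simp add: cball_subset_ball_iff)
  also have "\<dots> \<le> ennreal (C * (t ^ CARD('n) / unit_ball_vol (real CARD('n))) powr s) * wmeas w (ball 0 (2 powi i))"
    using t by (intro wmeas_ball_scale[OF A]) auto
  also have "\<dots> \<le> ennreal (C * (t ^ CARD('n) / unit_ball_vol (real CARD('n))) powr s) * ennreal (ball_weight w i)"
    unfolding wmeas_Bk[OF W, symmetric] by (intro mult_left_mono wmeas_mono) (auto simp: Bk_eq_cball)
  also have "\<dots> = ennreal (C * (t ^ CARD('n) / unit_ball_vol (real CARD('n))) powr s * ball_weight w i)"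
    using C by (intro ennreal_mult[symmetric]) (auto simp: ball_weight_def)
  finally have "ball_weight w k \<le> C * (t ^ CARD('n) / unit_ball_vol (real CARD('n))) powr s * ball_weight w i"
    using C by (subst (asm) ennreal_le_iff) (auto simp: ball_weight_def)
  also have "t ^ CARD('n) / unit_ball_vol (real CARD('n)) = (2 ^ CARD('n) / unit_ball_vol (real CARD('n))) * (2 powi (k - i)) ^ CARD('n)"
    by (simp add: t_def power_mult_distrib)
  finally show ?thesis by (simp only: powr_mult mult.assoc)
qed

lemma ball_weight_mono:
  fixes w :: "real ^ 'n \<Rightarrow> real"
  assumes "is_weight w" "i \<le> k" shows "ball_weight w i \<le> ball_weight w k"
proof -
  have "(2::real) powi i \<le> 2 powi k" using \<open>i \<le> k\<close> by (intro power_int_increasing) auto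
  then have "wmeas w (Bk i) \<le> wmeas w (Bk k)" by (intro wmeas_mono) (auto simp: Bk_def)
  then show ?thesis unfolding wmeas_Bk[OF assms(1)] by (simp add: ennreal_le_iff ball_weight_def)
qed

text \<open>The shell between consecutive balls has at least the volume of the inner ball. It
  therefore carries a fixed share of the weight, and passing to the inner ball loses a fixed
  factor.\<close>

lemma ball_weight_reverse_doubling:
  fixes w :: "real ^ 'n \<Rightarrow> real"
  assumes A: "avg_cond s w C" "0 < s" and W: "is_weight w"
  obtains \<delta> where "0 < \<delta>" "\<delta> < 1" "\<And>i k. i \<le> k \<Longrightarrow> ball_weight w i \<le> \<delta> ^ nat (k - i) * ball_weight w k"
proof -
  let ?N = "CARD('n)"
  define \<omega> where "\<omega> = unit_ball_vol (real ?N)"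
  have \<omega>: "0 < \<omega>" by (simp add: \<omega>_def)
  have C: "0 < C" using A by (simp add: avg_cond_def)
  \<comment> \<open>The share of the shell, whose volume is at least \<omega> r^n, in the ball of
    radius 4 r that contains it.\<close>
  define a where "a = \<omega> / 4 ^ ?N"
  have a: "0 < a" using \<omega> by (simp add: a_def)
  define D where "D = 1 + C / a powr s"
  have D: "1 < D" using a C by (simp add: D_def)
  have step: "ball_weight w i \<le> (1 - 1 / D) * ball_weight w (i + 1)" for i
  proof -
    let ?r = "(2::real) powi i"
    have r: "0 < ?r" by simp
    have r1: "2 powi (i + 1) = 2 * ?r" by (simp add: power_int_add)
    let ?E = "Bk (i + 1) - Bk i :: (real ^ 'n) set"
    have sub: "Bk i \<subseteq> (Bk (i + 1) :: (real ^ 'n) set)"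
      unfolding Bk_eq_cball r1 by (simp add: cball_subset_cball_iff)
    have sub4: "Bk (i + 1) \<subseteq> (ball 0 (4 * ?r) :: (real ^ 'n) set)"
      unfolding Bk_eq_cball r1 by (simp add: cball_subset_ball_iff)
    have "ennreal (\<omega> * ?r ^ ?N) + ennreal (\<omega> * ?r ^ ?N) \<le> emeasure lebesgue (Bk i :: (real ^ 'n) set) + emeasure lebesgue ?E"
    proof -
      have "emeasure lebesgue (Bk i :: (real ^ 'n) set) + emeasure lebesgue ?E = emeasure lebesgue (Bk i \<union> ?E)"
        by (rule plus_emeasure) auto
      also have "Bk i \<union> ?E = Bk (i + 1)" using sub by blast
      also have "emeasure lebesgue (Bk (i + 1) :: (real ^ 'n) set) = ennreal (\<omega> * (2 * ?r) ^ ?N)"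
        unfolding Bk_eq_cball r1 by (simp add: emeasure_cball \<omega>_def)
      also have "\<dots> \<ge> ennreal (2 * (\<omega> * ?r ^ ?N))"
      proof (rule ennreal_leI)
        have "(2::real) ^ 1 \<le> 2 ^ ?N" by (intro power_increasing) (auto simp: Suc_le_eq)
        then have "2 * (\<omega> * ?r ^ ?N) \<le> 2 ^ ?N * (\<omega> * ?r ^ ?N)" using \<omega> by (intro mult_right_mono) auto
        then show "2 * (\<omega> * ?r ^ ?N) \<le> \<omega> * (2 * ?r) ^ ?N" by (simp add: power_mult_distrib mult_ac)
      qed
      finally show ?thesis using \<omega> by (simp flip: ennreal_plus)
    qed
    moreover have "emeasure lebesgue (Bk i :: (real ^ 'n) set) = ennreal (\<omega> * ?r ^ ?N)"
      unfolding Bk_eq_cball by (simp add: emeasure_cball \<omega>_def)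
    ultimately have E: "ennreal (\<omega> * ?r ^ ?N) \<le> emeasure lebesgue ?E"
      by (simp add: ennreal_add_left_cancel_le)
    have "ennreal (a powr s) * wmeas w (ball 0 (4 * ?r)) \<le> ennreal C * wmeas w ?E"
    proof (rule avg_cond_set[OF A])
      show "?E \<subseteq> ball 0 (4 * ?r)" using sub4 by blast
      show "ennreal (a * (4 * ?r) ^ ?N) \<le> emeasure lebesgue ?E"
        using E by (simp add: a_def power_mult_distrib)
    qed (use a in auto)
    moreover have "wmeas w (Bk (i + 1)) \<le> wmeas w (ball 0 (4 * ?r))"
      using sub4 by (rule wmeas_mono)
    ultimately have 1: "ennreal (a powr s) * wmeas w (Bk (i + 1)) \<le> ennreal C * wmeas w ?E"
      by (meson mult_left_mono order_trans zero_le)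
    have 2: "wmeas w (Bk i) + wmeas w ?E = wmeas w (Bk (i + 1))"
    proof -
      note [measurable] = is_weight_measurable[OF W]
      show ?thesis
        unfolding wmeas_def using sub
        by (subst nn_integral_add[symmetric]) (auto intro!: nn_integral_cong simp: indicator_def)
    qed
    obtain e where e: "wmeas w ?E = ennreal e" "0 \<le> e"
      using 2 wmeas_Bk[OF W, of "i + 1"] by (cases "wmeas w ?E") auto
    have 3: "ball_weight w i + e = ball_weight w (i + 1)"
      using 2 e unfolding wmeas_Bk[OF W] by (simp add: ball_weight_def flip: ennreal_plus)
    have "a powr s * ball_weight w (i + 1) \<le> C * e"
      using 1 e C unfolding wmeas_Bk[OF W] by (simp add: ball_weight_def ennreal_le_iff flip: ennreal_mult)
    then have "ball_weight w (i + 1) \<le> C / a powr s * e"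
      using a by (simp add: field_simps)
    also have "\<dots> \<le> D * e" using e by (simp add: D_def distrib_right)
    finally have "ball_weight w (i + 1) / D \<le> e" using D by (simp add: pos_divide_le_eq mult.commute)
    then show ?thesis using 3 by (simp add: left_diff_distrib)
  qed
  define \<delta> where "\<delta> = 1 - 1 / D"
  have \<delta>: "0 < \<delta>" "\<delta> < 1" using D by (auto simp: \<delta>_def field_simps)
  have geo: "ball_weight w (k - int m) \<le> \<delta> ^ m * ball_weight w k" for k m
  proof (induction m)
    case (Suc m)
    have "ball_weight w (k - int (Suc m)) \<le> \<delta> * ball_weight w (k - int m)"
      using step[of "k - int (Suc m)"] by (simp add: \<delta>_def)
    also have "\<dots> \<le> \<delta> * (\<delta> ^ m * ball_weight w k)" using Suc \<delta> by (intro mult_left_mono) auto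
    finally show ?case by simp
  qed simp
  have "ball_weight w i \<le> \<delta> ^ nat (k - i) * ball_weight w k" if "i \<le> k" for i k
    using geo[of k "nat (k - i)"] that by simp
  with \<delta> show ?thesis by (rule that)
qed

lemma epowr_add_le:
  assumes "0 < r" "r \<le> 1" shows "epowr (x + y) r \<le> epowr x r + epowr y r"
proof (cases "x = top \<or> y = top")
  case True
  then show ?thesis using assms by (auto simp: epowr_top)
next
  case False
  then obtain a b where "x = ennreal a" "0 \<le> a" "y = ennreal b" "0 \<le> b"
    by (cases x; cases y) auto
  then show ?thesis
    using powr_add_le[of a b r] assms
    by (simp add: epowr_ennreal_nonneg ennreal_leI flip: ennreal_plus)
qed

text \<open>
  Here \<open>u k = w1(Bk k) powr (\<alpha> / n)\<close>, \<open>v k = w2(Bk k) powr (1 / q)\<close>, \<open>F i\<close> is the weighted norm of f on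
  the i-th annulus and \<open>e k\<close> the weight of the part of the k-th annulus where the square
  function exceeds \<open>\<sigma>\<close>.\<close>

lemma herz_weak_sum:
  fixes u v F :: "int \<Rightarrow> real" and e :: "int \<Rightarrow> ennreal"
  assumes p: "0 < p" "p \<le> 1" and q: "1 < q" and \<sigma>: "0 < \<sigma>" and "0 \<le> H" "0 \<le> ca" "0 < cb" "0 < E"
    and D: "1 \<le> D" and \<delta>: "0 < \<delta>" "\<delta> < 1"
    and u: "\<And>k. 0 < u k" "\<And>i k. i \<le> k \<Longrightarrow> u i \<le> u k" "\<And>k. u k \<le> D * u (k - 1)"
    and v: "\<And>k. 0 < v k" "\<And>i k. i \<le> k \<Longrightarrow> v i \<le> \<delta> ^ nat (k - i) * v k"
    and uv: "\<And>i k. i \<le> k \<Longrightarrow> u k * v k \<le> E * (2 powi (k - i)) ^ N * (u i * v i)"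
    and F: "\<And>i. 0 \<le> F i"
    and H: "(\<integral>\<^sup>+i. ennreal ((u i * F i) powr p) \<partial>count_space I) \<le> ennreal (H powr p)"
    and e: "\<And>k. k \<in> I \<Longrightarrow> e k \<le> ennreal (ca * \<sigma> powr (- q)) * ennreal (\<Sum>i\<in>I \<inter> {k-1..k+1}. F i powr q)
      + (if ennreal (\<sigma> / cb) < (\<integral>\<^sup>+i. ennreal ((2 powi (i - max i k)) ^ N * (F i / v i)) \<partial>count_space I)
         then ennreal (v k powr q) else 0)"
  shows "(\<integral>\<^sup>+k. ennreal (u k powr p) * epowr (e k) (p / q) \<partial>count_space I)
    \<le> ennreal ((3 * D powr p * ca powr (p / q) + ((2 * cb * E) powr p + (2 * cb) powr p) / (1 - \<delta> powr p)) * (H / \<sigma>) powr p)"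
proof -
  have pq: "0 < p / q" "p / q \<le> 1" using p q by (auto simp: pos_divide_le_eq)
  have cI: "countable I" by simp
  \<comment> \<open>Half of the level \<open>\<sigma> / cb\<close>, because the sum over distant
    annuli is split into an inner part \<open>T1\<close> and an outer part
    \<open>T2\<close>.\<close>
  define \<tau> where "\<tau> = \<sigma> / (2 * cb)"
  have \<tau>: "0 < \<tau>" "\<tau> + \<tau> = \<sigma> / cb" using \<sigma> \<open>0 < cb\<close> by (auto simp: \<tau>_def)
  define d where "d = \<delta> powr p"
  have d: "0 < d" "d < 1" unfolding d_def using \<delta> p powr_less_mono2[of p \<delta> 1] by auto
  define T1 where "T1 k = (\<integral>\<^sup>+i. ennreal (of_bool (i \<le> k) * ((2 powi (i - k)) ^ N * (F i / v i))) \<partial>count_space I)" for k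
  define T2 where "T2 k = (\<integral>\<^sup>+i. ennreal (of_bool (k < i) * (F i / v i)) \<partial>count_space I)" for k
  \<comment> \<open>The outer sum with p-th powers: it controls \<open>T2\<close> through the
    embedding of l^p into l^1, and unlike \<open>T2\<close> it can be exchanged with the p-th power
    sum over k.\<close>
  define S where "S k = (\<integral>\<^sup>+i. ennreal (of_bool (k < i) * (F i / v i) powr p) \<partial>count_space I)" for k
  \<comment> \<open>By \<open>T1_le\<close> the inner part can exceed \<tau> only for these
    k.\<close>
  define B where "B k \<longleftrightarrow> u k * v k \<le> E * H / \<tau>" for k
  have u0: "0 \<le> u k" for k using u(1)[of k] by simp
  have v0: "0 \<le> v k" for k using v(1)[of k] by simp
  have Fv: "0 \<le> F i / v i" for i using F[of i] v0[of i] by simp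
  have sumH: "(\<integral>\<^sup>+i. ennreal (u i * F i) \<partial>count_space I) \<le> ennreal H"
    by (rule nn_integral_le_epowr[OF cI _ p H \<open>0 \<le> H\<close>]) (simp add: u0 F)
  have T: "(\<integral>\<^sup>+i. ennreal ((2 powi (i - max i k)) ^ N * (F i / v i)) \<partial>count_space I) = T1 k + T2 k" for k
    unfolding T1_def T2_def
    by (subst nn_integral_add[symmetric]) (auto intro!: nn_integral_cong simp: max_def)
  \<comment> \<open>By \<open>uv\<close> the kernel factor absorbs exactly the growth of
    \<open>u k * v k\<close> from i to k. Each inner term is then at most a constant over
    \<open>u k * v k\<close> times \<open>u i * F i\<close>, and these terms have sum at most
    H.\<close>
  have T1_le: "T1 k \<le> ennreal (E * H / (u k * v k))" for k
  proof -
    have "T1 k \<le> (\<integral>\<^sup>+i. ennreal (E / (u k * v k)) * ennreal (u i * F i) \<partial>count_space I)"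
      unfolding T1_def
    proof (rule nn_integral_mono)
      fix i
      have "of_bool (i \<le> k) * ((2 powi (i - k)) ^ N * (F i / v i)) \<le> E / (u k * v k) * (u i * F i)"
      proof (cases "i \<le> k")
        case True
        define P :: real where "P = (2 powi (k - i)) ^ N"
        have P: "0 < P" by (simp add: P_def)
        have "(2::real) powi (i - k) = 1 / 2 powi (k - i)"
          by (metis minus_diff_eq power_int_minus_divide)
        then have Pinv: "((2::real) powi (i - k)) ^ N = 1 / P" by (simp add: P_def power_one_over)
        have "u k * v k * (1 / P / v i) \<le> E * P * (u i * v i) * (1 / P / v i)"
          using uv[OF True] v0[of i] P by (intro mult_right_mono) (auto simp: P_def)
        also have "\<dots> = E * u i" using P v(1)[of i] by simp
        finally have "1 / P / v i \<le> E * u i / (u k * v k)"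
          using u(1)[of k] v(1)[of k] by (simp add: pos_le_divide_eq mult.commute)
        then have "1 / P / v i * F i \<le> E * u i / (u k * v k) * F i"
          using F by (rule mult_right_mono)
        then show ?thesis using True by (simp add: Pinv mult_ac)
      qed (use u0 v0 F \<open>0 < E\<close> in simp)
      then show "ennreal (of_bool (i \<le> k) * ((2 powi (i - k)) ^ N * (F i / v i))) \<le> ennreal (E / (u k * v k)) * ennreal (u i * F i)"
        using u0 v0 F \<open>0 < E\<close> by (simp add: ennreal_leI flip: ennreal_mult)
    qed
    also have "\<dots> = ennreal (E / (u k * v k)) * (\<integral>\<^sup>+i. ennreal (u i * F i) \<partial>count_space I)"
      by (rule nn_integral_cmult) simp
    also have "\<dots> \<le> ennreal (E / (u k * v k)) * ennreal H"
      by (intro mult_left_mono sumH) simp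
    also have "\<dots> = ennreal (E * H / (u k * v k))"
      using u0[of k] v0[of k] \<open>0 < E\<close> \<open>0 \<le> H\<close> by (simp flip: ennreal_mult)
    finally show ?thesis .
  qed
  have T2_S: "T2 k \<le> ennreal \<tau>" if "S k \<le> ennreal (\<tau> powr p)" for k
    unfolding T2_def
  proof (rule nn_integral_le_epowr[OF cI _ p _ less_imp_le[OF \<tau>(1)]])
    have "(of_bool (k < i) * (F i / v i)) powr p = of_bool (k < i) * (F i / v i) powr p" for i
      by simp
    then show "(\<integral>\<^sup>+i. ennreal ((of_bool (k < i) * (F i / v i)) powr p) \<partial>count_space I) \<le> ennreal (\<tau> powr p)"
      using that unfolding S_def by (simp only:)
  qed (use Fv in simp)
  have point: "ennreal (u k powr p) * epowr (e k) (p / q)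
      \<le> ennreal (ca powr (p / q) * \<sigma> powr (- p) * D powr p) * (\<integral>\<^sup>+i. ennreal (of_bool (i \<in> {k-1..k+1}) * (u i * F i) powr p) \<partial>count_space I)
        + ennreal (of_bool (B k) * (u k * v k) powr p)
        + ennreal (\<tau> powr (- p)) * (ennreal ((u k * v k) powr p) * S k)" if k: "k \<in> I" for k
  proof -
    define x where "x = ennreal (ca * \<sigma> powr (- q)) * ennreal (\<Sum>i\<in>I \<inter> {k-1..k+1}. F i powr q)"
    define y where "y = ennreal (of_bool (B k) * v k powr q)"
    define z where "z = (if ennreal (\<tau> powr p) < S k then ennreal (v k powr q) else 0)"
    have "e k \<le> x + (y + z)"
    proof (cases "ennreal (\<sigma> / cb) < T1 k + T2 k")
      case True
      have "ennreal (\<sigma> / cb) = ennreal \<tau> + ennreal \<tau>" using \<tau> by (simp flip: ennreal_plus)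
      then have "ennreal \<tau> < T1 k \<or> ennreal \<tau> < T2 k"
        using True add_mono[of "T1 k" "ennreal \<tau>" "T2 k" "ennreal \<tau>"] by (auto simp: not_less[symmetric])
      then have "B k \<or> ennreal (\<tau> powr p) < S k"
      proof
        assume "ennreal \<tau> < T1 k"
        also note T1_le
        finally have "\<tau> \<le> E * H / (u k * v k)" using \<tau> by (simp add: ennreal_less_iff)
        then have "B k" using u(1)[of k] v(1)[of k] \<tau> by (simp add: B_def field_simps)
        then show ?thesis ..
      next
        assume "ennreal \<tau> < T2 k"
        then have "\<not> S k \<le> ennreal (\<tau> powr p)" using T2_S[of k] by (simp only: not_le[symmetric]) blast
        then show ?thesis by (simp only: not_le) simp
      qed
      then have "ennreal (v k powr q) \<le> y + z"
        by (auto simp: y_def z_def add_increasing2 add_increasing)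
      then show ?thesis using e[OF k] True unfolding T x_def by (auto intro: order_trans add_left_mono)
    next
      case False
      then have "e k \<le> x" using e[OF k] unfolding T x_def by simp
      then show ?thesis by (simp add: add_increasing2)
    qed
    then have "epowr (e k) (p / q) \<le> epowr x (p / q) + (epowr y (p / q) + epowr z (p / q))"
      using pq by (meson add_left_mono epowr_add_le epowr_mono order_trans)
    then have "ennreal (u k powr p) * epowr (e k) (p / q)
        \<le> ennreal (u k powr p) * epowr x (p / q) + ennreal (u k powr p) * epowr y (p / q) + ennreal (u k powr p) * epowr z (p / q)"
      by (simp add: mult_left_mono distrib_left[symmetric] add.assoc)
    moreover have "ennreal (u k powr p) * epowr x (p / q)
        \<le> ennreal (ca powr (p / q) * \<sigma> powr (- p) * D powr p) * (\<integral>\<^sup>+i. ennreal (of_bool (i \<in> {k-1..k+1}) * (u i * F i) powr p) \<partial>count_space I)"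
    proof -
      let ?n = "I \<inter> {k-1..k+1}"
      have s0: "0 \<le> (\<Sum>i\<in>?n. F i powr q)" by (intro sum_nonneg) simp
      have "epowr x (p / q) = ennreal ((ca * \<sigma> powr (- q) * (\<Sum>i\<in>?n. F i powr q)) powr (p / q))"
        unfolding x_def using \<open>0 \<le> ca\<close> s0 pq by (simp add: epowr_ennreal_nonneg flip: ennreal_mult)
      also have "(ca * \<sigma> powr (- q) * (\<Sum>i\<in>?n. F i powr q)) powr (p / q)
          = ca powr (p / q) * \<sigma> powr (- p) * (\<Sum>i\<in>?n. F i powr q) powr (p / q)"
        using q by (simp add: powr_mult powr_powr)
      also have "(\<Sum>i\<in>?n. F i powr q) powr (p / q) \<le> (\<Sum>i\<in>?n. (F i powr q) powr (p / q))"
        using pq by (intro powr_sum_le) auto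
      also have "(\<Sum>i\<in>?n. (F i powr q) powr (p / q)) = (\<Sum>i\<in>?n. F i powr p)"
        using q by (simp add: powr_powr)
      finally have x_le: "epowr x (p / q) \<le> ennreal (ca powr (p / q) * \<sigma> powr (- p) * (\<Sum>i\<in>?n. F i powr p))"
        by (simp add: ennreal_leI mult_left_mono)
      have "ennreal (u k powr p) * epowr x (p / q)
          \<le> ennreal (u k powr p) * ennreal (ca powr (p / q) * \<sigma> powr (- p) * (\<Sum>i\<in>?n. F i powr p))"
        by (intro mult_left_mono x_le) simp
      also have "\<dots> = ennreal (ca powr (p / q) * \<sigma> powr (- p) * (\<Sum>i\<in>?n. u k powr p * F i powr p))"
        by (simp add: sum_distrib_left mult_ac sum_nonneg flip: ennreal_mult)
      also have "\<dots> \<le> ennreal (ca powr (p / q) * \<sigma> powr (- p) * (\<Sum>i\<in>?n. D powr p * (u i * F i) powr p))"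
      proof (intro ennreal_leI mult_left_mono sum_mono)
        fix i assume i: "i \<in> ?n"
        \<comment> \<open>Doubling is needed for i = k - 1 only; for the other neighbours u is
          monotone.\<close>
        have "u k \<le> D * u i"
        proof (cases "i = k - 1")
          case False
          then have "k \<le> i" using i by auto
          then have "1 * u k \<le> D * u i" using u(2)[of k i] u0 D by (intro mult_mono) auto
          then show ?thesis by simp
        qed (use u(3) in simp)
        then have "u k powr p \<le> (D * u i) powr p" using u(1)[of k] p by (intro powr_mono2) auto
        then have "u k powr p * F i powr p \<le> (D * u i) powr p * F i powr p" by (rule mult_right_mono) simp
        then show "u k powr p * F i powr p \<le> D powr p * (u i * F i) powr p"
          by (simp add: powr_mult mult_ac)
      qed simp
      also have "\<dots> = ennreal (ca powr (p / q) * \<sigma> powr (- p) * D powr p) * ennreal (\<Sum>i\<in>?n. (u i * F i) powr p)"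
      proof -
        have "(\<Sum>i\<in>?n. D powr p * (u i * F i) powr p) = D powr p * (\<Sum>i\<in>?n. (u i * F i) powr p)"
          by (rule sum_distrib_left[symmetric])
        moreover have "0 \<le> (\<Sum>i\<in>?n. (u i * F i) powr p)" by (intro sum_nonneg) simp
        ultimately show ?thesis by (simp only: mult.assoc[symmetric]) (rule ennreal_mult, simp_all)
      qed
      also have "ennreal (\<Sum>i\<in>?n. (u i * F i) powr p) \<le> (\<integral>\<^sup>+i. ennreal (of_bool (i \<in> {k-1..k+1}) * (u i * F i) powr p) \<partial>count_space I)"
      proof -
        have "ennreal (\<Sum>i\<in>?n. (u i * F i) powr p) = (\<Sum>i\<in>?n. ennreal ((u i * F i) powr p))"
          by (rule sum_ennreal[symmetric]) simp
        also have "\<dots> = (\<Sum>i\<in>?n. ennreal (of_bool (i \<in> {k-1..k+1}) * (u i * F i) powr p))"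
          by (intro sum.cong) auto
        also have "\<dots> \<le> (\<integral>\<^sup>+i. ennreal (of_bool (i \<in> {k-1..k+1}) * (u i * F i) powr p) \<partial>count_space I)"
          unfolding nn_integral_count_space_eq_SUP[OF cI] by (intro SUP_upper) auto
        finally show ?thesis .
      qed
      finally show ?thesis by (simp add: mult_left_mono)
    qed
    moreover have "ennreal (u k powr p) * epowr y (p / q) \<le> ennreal (of_bool (B k) * (u k * v k) powr p)"
      using pq q v(1)[of k] by (auto simp: y_def epowr_ennreal_nonneg powr_powr powr_mult epowr_0 simp flip: ennreal_mult)
    \<comment> \<open>Chebyshev's inequality: where \<open>S k\<close> exceeds \<tau>^p, the
      quotient of the two is at least 1.\<close>
    moreover have "ennreal (u k powr p) * epowr z (p / q) \<le> ennreal (\<tau> powr (- p)) * (ennreal ((u k * v k) powr p) * S k)"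
    proof (cases "ennreal (\<tau> powr p) < S k")
      case True
      have "ennreal (u k powr p) * epowr z (p / q) = ennreal ((u k * v k) powr p)"
        using True pq q v(1)[of k] by (simp add: z_def epowr_ennreal_nonneg powr_powr powr_mult flip: ennreal_mult)
      also have "\<dots> = ennreal ((u k * v k) powr p) * (ennreal (\<tau> powr (- p)) * ennreal (\<tau> powr p))"
        using \<tau> by (simp flip: ennreal_mult powr_add)
      also have "\<dots> \<le> ennreal ((u k * v k) powr p) * (ennreal (\<tau> powr (- p)) * S k)"
        using True by (intro mult_left_mono) auto
      finally show ?thesis by (simp only: mult_ac)
    qed (use pq in \<open>simp add: z_def epowr_0\<close>)
    ultimately show ?thesis
      by (meson add_mono order_trans)
  qed
  have sum1: "(\<integral>\<^sup>+k. (\<integral>\<^sup>+i. ennreal (of_bool (i \<in> {k-1..k+1}) * (u i * F i) powr p) \<partial>count_space I) \<partial>count_space I)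
      \<le> 3 * ennreal (H powr p)"
  proof -
    have "(\<integral>\<^sup>+k. (\<integral>\<^sup>+i. ennreal (of_bool (i \<in> {k-1..k+1}) * (u i * F i) powr p) \<partial>count_space I) \<partial>count_space I)
        = (\<integral>\<^sup>+i. (\<integral>\<^sup>+k. ennreal (of_bool (i \<in> {k-1..k+1}) * (u i * F i) powr p) \<partial>count_space I) \<partial>count_space I)"
      by (rule nn_integral_count_space_nn_integral) auto
    also have "\<dots> \<le> (\<integral>\<^sup>+i. 3 * ennreal ((u i * F i) powr p) \<partial>count_space I)"
    proof (rule nn_integral_mono, rule nn_integral_count_space_le[OF cI])
      fix i G assume G: "finite G" "G \<subseteq> I"
      have "(\<Sum>k\<in>G. ennreal (of_bool (i \<in> {k-1..k+1}) * (u i * F i) powr p))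
          = (\<Sum>k\<in>G \<inter> {i-1..i+1}. ennreal ((u i * F i) powr p))"
        using G by (intro sum.mono_neutral_cong_right) auto
      also have "\<dots> = of_nat (card (G \<inter> {i-1..i+1})) * ennreal ((u i * F i) powr p)" by simp
      \<comment> \<open>Each i is a neighbour of at most three k.\<close>
      also have "\<dots> \<le> of_nat 3 * ennreal ((u i * F i) powr p)"
      proof (intro mult_right_mono of_nat_mono)
        have "card (G \<inter> {i-1..i+1}) \<le> card {i-1..i+1}" by (intro card_mono) auto
        then show "card (G \<inter> {i-1..i+1}) \<le> 3" by simp
      qed simp
      finally show "(\<Sum>k\<in>G. ennreal (of_bool (i \<in> {k-1..k+1}) * (u i * F i) powr p)) \<le> 3 * ennreal ((u i * F i) powr p)"
        by simp
    qed
    also have "\<dots> = 3 * (\<integral>\<^sup>+i. ennreal ((u i * F i) powr p) \<partial>count_space I)"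
      by (rule nn_integral_cmult) simp
    also have "\<dots> \<le> 3 * ennreal (H powr p)" by (intro mult_left_mono H) simp
    finally show ?thesis .
  qed
  have uv_growth: "(u i * v i) powr p \<le> d ^ nat (k - i) * (u k * v k) powr p" if "i \<le> k" for i k
  proof -
    have "u i * v i \<le> u k * (\<delta> ^ nat (k - i) * v k)"
      using u0[of k] v0[of i] u(2)[OF that] v(2)[OF that] by (intro mult_mono) auto
    then have "(u i * v i) powr p \<le> (\<delta> ^ nat (k - i) * (u k * v k)) powr p"
      using u(1)[of i] v(1)[of i] p by (intro powr_mono2) (auto simp: mult_ac)
    also have "\<dots> = (\<delta> ^ nat (k - i)) powr p * (u k * v k) powr p" by (rule powr_mult)
    also have "(\<delta> ^ nat (k - i)) powr p = d ^ nat (k - i)"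
      using \<delta> by (simp add: d_def powr_realpow[symmetric] powr_powr mult.commute)
    finally show ?thesis .
  qed
  \<comment> \<open>A geometrically growing sequence is summed only over those k at which it is at
    most \<open>E * H / \<tau>\<close>.\<close>
  have sum2: "(\<integral>\<^sup>+k. ennreal (of_bool (B k) * (u k * v k) powr p) \<partial>count_space I)
      \<le> ennreal ((E * H / \<tau>) powr p / (1 - d))"
  proof (rule nn_integral_count_space_le[OF cI])
    fix G assume G: "finite G" "G \<subseteq> I"
    have "(\<Sum>k\<in>G. ennreal (of_bool (B k) * (u k * v k) powr p)) = ennreal (\<Sum>k\<in>G. of_bool (B k) * (u k * v k) powr p)"
      by (rule sum_ennreal) simp
    also have "(\<Sum>k\<in>G. of_bool (B k) * (u k * v k) powr p) = (\<Sum>k\<in>{k\<in>G. B k}. (u k * v k) powr p)"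
      using G by (intro sum.mono_neutral_cong_right) auto
    also have "\<dots> \<le> (E * H / \<tau>) powr p / (1 - d)"
      using G d u0 v0 p
      by (intro geometric_growth_sum_le uv_growth) (auto simp: B_def intro!: powr_mono2)
    finally show "(\<Sum>k\<in>G. ennreal (of_bool (B k) * (u k * v k) powr p)) \<le> ennreal ((E * H / \<tau>) powr p / (1 - d))"
      by (simp add: ennreal_leI)
  qed
  \<comment> \<open>After the exchange of sums, the terms with k below i form a geometric series
    bounded by a multiple of the value at i, where the factor \<open>v i\<close> cancels against the
    denominator.\<close>
  have sum3: "(\<integral>\<^sup>+k. ennreal ((u k * v k) powr p) * S k \<partial>count_space I) \<le> ennreal (1 / (1 - d)) * ennreal (H powr p)"
  proof -
    have "(\<integral>\<^sup>+k. ennreal ((u k * v k) powr p) * S k \<partial>count_space I)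
        = (\<integral>\<^sup>+k. (\<integral>\<^sup>+i. ennreal ((u k * v k) powr p) * ennreal (of_bool (k < i) * (F i / v i) powr p) \<partial>count_space I) \<partial>count_space I)"
      unfolding S_def by (simp add: nn_integral_cmult)
    also have "\<dots> = (\<integral>\<^sup>+i. (\<integral>\<^sup>+k. ennreal ((u k * v k) powr p) * ennreal (of_bool (k < i) * (F i / v i) powr p) \<partial>count_space I) \<partial>count_space I)"
      by (rule nn_integral_count_space_nn_integral) auto
    also have "\<dots> \<le> (\<integral>\<^sup>+i. ennreal (1 / (1 - d)) * ennreal ((u i * F i) powr p) \<partial>count_space I)"
    proof (rule nn_integral_mono, rule nn_integral_count_space_le[OF cI])
      fix i G assume G: "finite G" "G \<subseteq> I"
      have "(\<Sum>k\<in>G. ennreal ((u k * v k) powr p) * ennreal (of_bool (k < i) * (F i / v i) powr p))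
          = ennreal (\<Sum>k\<in>G. (u k * v k) powr p * (of_bool (k < i) * (F i / v i) powr p))"
        by (subst sum_ennreal[symmetric]) (auto simp: ennreal_mult)
      also have "(\<Sum>k\<in>G. (u k * v k) powr p * (of_bool (k < i) * (F i / v i) powr p))
          = (\<Sum>k\<in>{k\<in>G. k < i}. (u k * v k) powr p * (F i / v i) powr p)"
        using G by (intro sum.mono_neutral_cong_right) auto
      also have "\<dots> \<le> (\<Sum>k\<in>{k\<in>G. k < i}. d ^ nat (- k - (- i)) * ((u i * v i) powr p * (F i / v i) powr p))"
      proof (rule sum_mono)
        fix k assume "k \<in> {k\<in>G. k < i}"
        then have "(u k * v k) powr p * (F i / v i) powr p \<le> (d ^ nat (i - k) * (u i * v i) powr p) * (F i / v i) powr p"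
          by (intro mult_right_mono uv_growth) auto
        then show "(u k * v k) powr p * (F i / v i) powr p \<le> d ^ nat (- k - (- i)) * ((u i * v i) powr p * (F i / v i) powr p)"
          by (simp add: mult.assoc)
      qed
      also have "\<dots> = (\<Sum>k\<in>uminus ` {k\<in>G. k < i}. d ^ nat (k - (- i))) * ((u i * v i) powr p * (F i / v i) powr p)"
        by (subst sum.reindex) (auto simp: sum_distrib_right)
      also have "\<dots> \<le> 1 / (1 - d) * ((u i * v i) powr p * (F i / v i) powr p)"
        using G d by (intro mult_right_mono sum_geometric_int_le) auto
      also have "(u i * v i) powr p * (F i / v i) powr p = (u i * F i) powr p"
        using v(1)[of i] by (simp flip: powr_mult)
      finally show "(\<Sum>k\<in>G. ennreal ((u k * v k) powr p) * ennreal (of_bool (k < i) * (F i / v i) powr p))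
          \<le> ennreal (1 / (1 - d)) * ennreal ((u i * F i) powr p)"
        using d by (simp add: ennreal_leI flip: ennreal_mult)
    qed
    also have "\<dots> = ennreal (1 / (1 - d)) * (\<integral>\<^sup>+i. ennreal ((u i * F i) powr p) \<partial>count_space I)"
      by (rule nn_integral_cmult) simp
    also have "\<dots> \<le> ennreal (1 / (1 - d)) * ennreal (H powr p)" by (intro mult_left_mono H) simp
    finally show ?thesis .
  qed
  define c1 where "c1 = ca powr (p / q) * \<sigma> powr (- p) * D powr p"
  have c1: "0 \<le> c1" by (simp add: c1_def)
  have "(\<integral>\<^sup>+k. ennreal (u k powr p) * epowr (e k) (p / q) \<partial>count_space I)
      \<le> (\<integral>\<^sup>+k. ennreal c1 * (\<integral>\<^sup>+i. ennreal (of_bool (i \<in> {k-1..k+1}) * (u i * F i) powr p) \<partial>count_space I)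
        + ennreal (of_bool (B k) * (u k * v k) powr p)
        + ennreal (\<tau> powr (- p)) * (ennreal ((u k * v k) powr p) * S k) \<partial>count_space I)"
    unfolding c1_def by (intro nn_integral_mono point) simp
  also have "\<dots> = ennreal c1 * (\<integral>\<^sup>+k. (\<integral>\<^sup>+i. ennreal (of_bool (i \<in> {k-1..k+1}) * (u i * F i) powr p) \<partial>count_space I) \<partial>count_space I)
        + (\<integral>\<^sup>+k. ennreal (of_bool (B k) * (u k * v k) powr p) \<partial>count_space I)
        + ennreal (\<tau> powr (- p)) * (\<integral>\<^sup>+k. ennreal ((u k * v k) powr p) * S k \<partial>count_space I)"
    by (subst nn_integral_add, simp, simp)+ (simp add: nn_integral_cmult)
  also have "\<dots> \<le> ennreal c1 * (3 * ennreal (H powr p)) + ennreal ((E * H / \<tau>) powr p / (1 - d))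
        + ennreal (\<tau> powr (- p)) * (ennreal (1 / (1 - d)) * ennreal (H powr p))"
    by (intro add_mono mult_left_mono sum1 sum2 sum3) auto
  also have "\<dots> = ennreal (c1 * (3 * H powr p) + (E * H / \<tau>) powr p / (1 - d) + \<tau> powr (- p) * (1 / (1 - d) * H powr p))"
  proof -
    have "3 * ennreal (H powr p) = ennreal (3 * H powr p)" by (simp add: ennreal_mult)
    then show ?thesis using c1 d by (simp add: ennreal_mult[symmetric] ennreal_plus[symmetric] del: ennreal_plus)
  qed
  also have "c1 * (3 * H powr p) + (E * H / \<tau>) powr p / (1 - d) + \<tau> powr (- p) * (1 / (1 - d) * H powr p)
      = (3 * D powr p * ca powr (p / q) + ((2 * cb * E) powr p + (2 * cb) powr p) / (1 - \<delta> powr p)) * (H / \<sigma>) powr p"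
  proof -
    have 1: "c1 * (3 * H powr p) = 3 * D powr p * ca powr (p / q) * (H / \<sigma>) powr p"
      by (simp add: c1_def powr_minus_divide powr_divide)
    have "E * H / \<tau> = (2 * cb * E) * (H / \<sigma>)" using \<sigma> \<open>0 < cb\<close> by (simp add: \<tau>_def)
    then have 2: "(E * H / \<tau>) powr p = (2 * cb * E) powr p * (H / \<sigma>) powr p" by (simp only: powr_mult)
    have "\<tau> powr (- p) * H powr p = ((2 * cb) * (H / \<sigma>)) powr p"
      using \<sigma> \<open>0 < cb\<close> by (simp add: \<tau>_def powr_minus_divide powr_divide powr_mult)
    then have 3: "\<tau> powr (- p) * H powr p = (2 * cb) powr p * (H / \<sigma>) powr p" by (simp only: powr_mult)
    have 4: "\<tau> powr (- p) * (1 / (1 - d) * H powr p) = (\<tau> powr (- p) * H powr p) / (1 - d)" by simp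
    show ?thesis
      unfolding 1 2 4 3 d_def[symmetric] by (simp add: distrib_right add_divide_distrib)
  qed
  finally show ?thesis .
qed

section \<open>Splitting into near and far annuli\<close>

lemma epowr_1 [simp]: "epowr x 1 = x"
  by (cases x) (auto simp: epowr_def)

context adapted_family
begin

lemma integrable_mult_adapted_local:
  assumes [measurable]: "f \<in> borel_measurable lebesgue"
    and loc: "\<And>c r. mass f (cball c r) < \<infinity>"
  shows "integrable lebesgue (\<lambda>x. f x * \<phi> Q x)"
proof -
  let ?B = "cball (center Q) (R * side Q)"
  have "integrable lebesgue (\<lambda>x. f x * indicator ?B x)"
  proof (rule integrableI_bounded)
    have "(\<integral>\<^sup>+x. ennreal (norm (f x * indicator ?B x)) \<partial>lebesgue) = mass f ?B"
      by (intro nn_integral_cong) (auto simp: indicator_def)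
    then show "(\<integral>\<^sup>+x. ennreal (norm (f x * indicator ?B x)) \<partial>lebesgue) < \<infinity>"
      using loc by simp
  qed measurable
  then have "integrable lebesgue (\<lambda>x. f x * indicator ?B x * \<phi> Q x)"
    by (rule integrable_mult_adapted)
  also have "(\<lambda>x. f x * indicator ?B x * \<phi> Q x) = (\<lambda>x. f x * \<phi> Q x)"
    using adapted_eq_0[of _ Q] by (auto simp: fun_eq_iff indicator_def)
  finally show ?thesis .
qed

lemma square_sum_split:
  assumes f: "f \<in> borel_measurable lebesgue"
    and loc: "\<And>c r. mass f (cball c r) < \<infinity>"
    and [measurable]: "A \<in> sets lebesgue" "B \<in> sets lebesgue"
    and AB: "AE y in lebesgue. f y = f y * indicator A y + f y * indicator B y"
  shows "square_sum f x \<le> 2 * square_sum (\<lambda>y. f y * indicator A y) x + 2 * square_sum (\<lambda>y. f y * indicator B y) x"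
proof -
  note [measurable] = f
  let ?f = "\<lambda>A y. f y * indicator A y"
  have int: "integrable lebesgue (\<lambda>y. ?f A y * \<phi> Q y)" if [measurable]: "A \<in> sets lebesgue" for A Q
    using integrable_mult_adapted_local[OF f loc, of Q]
    by (rule Bochner_Integration.integrable_bound) (auto simp: indicator_def norm_mult)
  have "square_sum f x \<le> (\<integral>\<^sup>+Q. 2 * ennreal ((norm (pairing (?f A) Q))\<^sup>2 * bump Q x)
      + 2 * ennreal ((norm (pairing (?f B) Q))\<^sup>2 * bump Q x) \<partial>count_space UNIV)"
    unfolding square_sum_def
  proof (rule nn_integral_mono)
    fix Q
    have "pairing f Q = (LINT y|lebesgue. ?f A y * \<phi> Q y + ?f B y * \<phi> Q y)"
      unfolding pairing_def
    proof (rule integral_cong_AE)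
      show "AE y in lebesgue. f y * \<phi> Q y = ?f A y * \<phi> Q y + ?f B y * \<phi> Q y"
        using AB by eventually_elim (simp flip: distrib_right)
    qed measurable
    also have "\<dots> = pairing (?f A) Q + pairing (?f B) Q"
      unfolding pairing_def by (intro Bochner_Integration.integral_add int) auto
    finally have "norm (pairing f Q) \<le> norm (pairing (?f A) Q) + norm (pairing (?f B) Q)"
      by (simp add: norm_triangle_ineq)
    then have "(norm (pairing f Q))\<^sup>2 \<le> (norm (pairing (?f A) Q) + norm (pairing (?f B) Q))\<^sup>2"
      by (rule power_mono) simp
    also have "\<dots> \<le> 2 * (norm (pairing (?f A) Q))\<^sup>2 + 2 * (norm (pairing (?f B) Q))\<^sup>2"
      using sum_squares_bound[of "norm (pairing (?f A) Q)" "norm (pairing (?f B) Q)"] by (simp add: power2_sum)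
    finally have "(norm (pairing f Q))\<^sup>2 * bump Q x
        \<le> (2 * (norm (pairing (?f A) Q))\<^sup>2 + 2 * (norm (pairing (?f B) Q))\<^sup>2) * bump Q x"
      by (rule mult_right_mono) simp
    then have "ennreal ((norm (pairing f Q))\<^sup>2 * bump Q x)
        \<le> ennreal (2 * ((norm (pairing (?f A) Q))\<^sup>2 * bump Q x) + 2 * ((norm (pairing (?f B) Q))\<^sup>2 * bump Q x))"
      by (intro ennreal_leI) (simp add: distrib_right mult.assoc)
    then show "ennreal ((norm (pairing f Q))\<^sup>2 * bump Q x) \<le> 2 * ennreal ((norm (pairing (?f A) Q))\<^sup>2 * bump Q x)
      + 2 * ennreal ((norm (pairing (?f B) Q))\<^sup>2 * bump Q x)"
      by (simp add: ennreal_mult)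
  qed
  also have "\<dots> = 2 * square_sum (?f A) x + 2 * square_sum (?f B) x"
    unfolding square_sum_def by (simp add: nn_integral_add nn_integral_cmult)
  finally show ?thesis .
qed

end

text \<open>If the mass exceeded the bound, its average over the ball of twice the radius would
  violate \<open>avg_cond\<close>; this takes the place of Hoelder's inequality.\<close>

lemma local_integral_bound:
  fixes w :: "real ^ 'n \<Rightarrow> real" and f :: "real ^ 'n \<Rightarrow> complex"
  assumes A: "avg_cond q w C" and "0 < q" and W: "is_weight w"
    and f: "f \<in> borel_measurable lebesgue" and S: "S \<in> sets lebesgue" "S \<subseteq> Bk i"
    and F: "(\<integral>\<^sup>+x. ennreal (norm (f x * indicator S x) powr q) * ennreal (w x) \<partial>lebesgue) = ennreal (F powr q)" "0 \<le> F"
  shows "mass f S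
    \<le> ennreal (C powr (1 / q) * 2 ^ CARD('n) * ((2 powi i) ^ CARD('n) * (F / ball_weight w i powr (1 / q))))"
proof (rule ccontr)
  let ?N = "CARD('n)"
  define J where "J = mass f S"
  define b where "b = ball_weight w i"
  have b: "0 < b" unfolding b_def by (rule ball_weight_pos[OF A \<open>0 < q\<close> W])
  have C: "0 < C" using A by (simp add: avg_cond_def)
  define X where "X = C powr (1 / q) * 2 ^ ?N * ((2 powi i) ^ ?N * (F / b powr (1 / q)))"
  have X: "0 \<le> X" using F by (simp add: X_def)
  assume "\<not> ?thesis"
  then have "ennreal X < J" by (simp add: X_def b_def J_def not_le)
  \<comment> \<open>\<open>avg_cond\<close> is stated for real averages, so a real number is placed
    between the bound and the possibly infinite mass.\<close>
  then obtain y where y: "X < y" "ennreal y \<le> J"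
  proof (cases J)
    case (real j)
    then show ?thesis using \<open>ennreal X < J\<close> X that[of j] by (simp add: ennreal_less_iff)
  next
    case top
    then show ?thesis using that[of "X + 1"] by simp
  qed
  define r :: real where "r = 2 * 2 powi i"
  have r: "0 < r" by (simp add: r_def)
  define a where "a = y / r ^ ?N"
  have a: "0 < a" using X y r by (simp add: a_def)
  define g where "g x = norm (f x * indicator S x)" for x
  have sub: "Bk i \<subseteq> (ball 0 r :: (real ^ 'n) set)"
    unfolding Bk_eq_cball r_def by (simp add: cball_subset_ball_iff)
  note [measurable] = f S(1)
  have "ennreal (a powr q) * wmeas w (ball 0 r) \<le> ennreal C * (\<integral>\<^sup>+x\<in>ball 0 r. ennreal (g x powr q) * ennreal (w x) \<partial>lebesgue)"
  proof (rule avg_cond_D[OF A r less_imp_le[OF a]])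
    show "g \<in> borel_measurable lebesgue" unfolding g_def by measurable
    have "J = (\<integral>\<^sup>+x\<in>ball 0 r. ennreal (g x) \<partial>lebesgue)"
      unfolding J_def using S sub by (intro nn_integral_cong) (auto simp: g_def indicator_def)
    then show "ennreal (a * r ^ ?N) \<le> (\<integral>\<^sup>+x\<in>ball 0 r. ennreal (g x) \<partial>lebesgue)"
      using y r by (simp add: a_def)
  qed (simp add: g_def)
  also have "(\<integral>\<^sup>+x\<in>ball 0 r. ennreal (g x powr q) * ennreal (w x) \<partial>lebesgue) \<le> ennreal (F powr q)"
    unfolding F(1)[symmetric] g_def by (intro nn_integral_mono) (auto simp: indicator_def)
  finally have "ennreal (a powr q) * wmeas w (ball 0 r) \<le> ennreal C * ennreal (F powr q)"
    by (simp add: mult_left_mono)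
  moreover have "ennreal b \<le> wmeas w (ball 0 r)"
    unfolding b_def wmeas_Bk[OF W, symmetric] using sub by (rule wmeas_mono)
  ultimately have "ennreal (a powr q) * ennreal b \<le> ennreal C * ennreal (F powr q)"
    by (meson mult_left_mono order_trans zero_le)
  then have "a powr q * b \<le> C * F powr q"
    using b C by (simp add: ennreal_le_iff flip: ennreal_mult)
  then have "(a powr q * b) powr (1 / q) \<le> (C * F powr q) powr (1 / q)"
    using b \<open>0 < q\<close> by (intro powr_mono2) auto
  then have "a * b powr (1 / q) \<le> C powr (1 / q) * F"
    using a F \<open>0 < q\<close> by (simp add: powr_mult powr_powr)
  then have "a \<le> C powr (1 / q) * (F / b powr (1 / q))"
    using b by (simp add: pos_le_divide_eq)
  then have "a * r ^ ?N \<le> C powr (1 / q) * (F / b powr (1 / q)) * r ^ ?N"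
    using r by (intro mult_right_mono) auto
  also have "\<dots> = X" by (simp add: X_def r_def power_mult_distrib)
  finally show False using y r by (simp add: a_def)
qed

lemma nn_integral_count_space_mono_set:
  fixes h :: "'a \<Rightarrow> ennreal"
  assumes "A \<subseteq> B" shows "(\<integral>\<^sup>+i. h i \<partial>count_space A) \<le> (\<integral>\<^sup>+i. h i \<partial>count_space B)"
proof -
  have "(\<integral>\<^sup>+i. h i \<partial>count_space A) = (\<integral>\<^sup>+i. h i * indicator A i \<partial>count_space UNIV)"
    by (simp add: nn_integral_count_space_indicator)
  also have "\<dots> \<le> (\<integral>\<^sup>+i. h i * indicator B i \<partial>count_space UNIV)"
    using assms by (intro nn_integral_mono) (auto simp: indicator_def)
  finally show ?thesis by (simp add: nn_integral_count_space_indicator)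
qed

text \<open>The common properties of the pieces in the homogeneous and the non-homogeneous case, so
  that one argument gives both bounds. \<open>S_sep\<close> supplies the distances in the far
  estimate; \<open>S_low\<close> and \<open>S_large\<close> serve the local integrability of
  f.\<close>

locale herz_sets =
  fixes I :: "int set" and S :: "int \<Rightarrow> (real ^ 'n) set"
  assumes S_meas: "\<And>i. i \<in> I \<Longrightarrow> S i \<in> sets lebesgue"
    and S_sub: "\<And>i. i \<in> I \<Longrightarrow> S i \<subseteq> Bk i"
    and S_disj: "disjoint_family_on S I"
    and S_cover: "AE y in lebesgue. \<exists>i\<in>I. y \<in> S i"
    and S_sep: "\<And>i k x y. i \<in> I \<Longrightarrow> k \<in> I \<Longrightarrow> 2 \<le> \<bar>i - k\<bar> \<Longrightarrow> x \<in> S k \<Longrightarrow> y \<in> S i \<Longrightarrow>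
        2 powi max i k \<le> 4 * dist x y"
    and S_low: "\<And>i k y. i \<in> I \<Longrightarrow> k \<in> I \<Longrightarrow> y \<in> S i \<Longrightarrow> y \<in> Bk k \<Longrightarrow> i \<le> k"
    and S_large: "\<And>m. \<exists>k\<in>I. m \<le> k"
begin

lemma nn_integral_cover:
  assumes [measurable]: "h \<in> borel_measurable lebesgue" and "B \<in> sets lebesgue"
  shows "(\<integral>\<^sup>+y\<in>B. h y \<partial>lebesgue) \<le> (\<integral>\<^sup>+i. (\<integral>\<^sup>+y\<in>S i \<inter> B. h y \<partial>lebesgue) \<partial>count_space I)"
proof -
  have "(\<integral>\<^sup>+y\<in>B. h y \<partial>lebesgue) = (\<integral>\<^sup>+y\<in>B \<inter> (\<Union>i\<in>I. S i). h y \<partial>lebesgue)"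
  proof (rule nn_integral_cong_AE)
    show "AE y in lebesgue. h y * indicator B y = h y * indicator (B \<inter> (\<Union>i\<in>I. S i)) y"
      using S_cover by eventually_elim (auto simp: indicator_def)
  qed
  also have "\<dots> \<le> (\<integral>\<^sup>+i. (\<integral>\<^sup>+y\<in>S i \<inter> B. h y \<partial>lebesgue) \<partial>count_space I)"
    using S_meas assms by (intro nn_set_integral_UN_le) auto
  finally show ?thesis .
qed

lemma sets_UN_S: "J \<subseteq> I \<Longrightarrow> (\<Union>i\<in>J. S i) \<in> sets lebesgue"
  using S_meas by (intro sets.countable_UN') (auto intro: countable_subset[OF subset_UNIV])

definition herz_sum :: "real \<Rightarrow> real \<Rightarrow> real \<Rightarrow> (real ^ 'n \<Rightarrow> real) \<Rightarrow> (real ^ 'n \<Rightarrow> real) \<Rightarrow> (real ^ 'n \<Rightarrow> complex) \<Rightarrow> ennreal" where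
  "herz_sum \<alpha> p q w1 w2 f = (\<integral>\<^sup>+k. epowr (wmeas w1 (Bk k)) (\<alpha> * p / real CARD('n)) *
     epowr (Lq_norm q w2 (\<lambda>x. f x * indicator (S k) x)) p \<partial>count_space I)"

definition weak_herz_sum :: "real \<Rightarrow> real \<Rightarrow> real \<Rightarrow> (real ^ 'n \<Rightarrow> real) \<Rightarrow> (real ^ 'n \<Rightarrow> real) \<Rightarrow> (real ^ 'n \<Rightarrow> ereal) \<Rightarrow> real \<Rightarrow> ennreal" where
  "weak_herz_sum \<alpha> p q w1 w2 f \<sigma> = (\<integral>\<^sup>+k. epowr (wmeas w1 (Bk k)) (\<alpha> * p / real CARD('n)) *
     epowr (wmeas w2 {x \<in> S k. \<bar>f x\<bar> > ereal \<sigma>}) (p / q) \<partial>count_space I)"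

end

context herz_sets
begin

lemma herz_weak_bound:
  fixes w1 w2 :: "real ^ 'n \<Rightarrow> real"
  assumes \<beta>: "0 < \<beta>" "\<beta> \<le> 1" and p: "0 < p" "p \<le> 1" and q: "1 < q" and q1: "1 \<le> q1" and q2: "1 \<le> q2" "q2 \<le> q"
    and w1: "w1 \<in> muckenhoupt q1" and w2: "w2 \<in> muckenhoupt q2"
    and \<alpha>: "\<alpha> * q1 = real CARD('n) * (1 - q2 / q)"
  shows "\<exists>C>0. \<forall>f. f \<in> borel_measurable lebesgue \<longrightarrow> epowr (herz_sum \<alpha> p q w1 w2 f) (1 / p) < \<infinity> \<longrightarrow>
    (\<lambda>x. enn2ereal (intrinsic_square \<beta> f x)) \<in> borel_measurable lebesgue \<and>
    (SUP \<sigma>\<in>{0<..}. ennreal \<sigma> *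
        epowr (weak_herz_sum \<alpha> p q w1 w2 (\<lambda>x. enn2ereal (intrinsic_square \<beta> f x)) \<sigma>) (1 / p))
      \<le> ennreal C * epowr (herz_sum \<alpha> p q w1 w2 f) (1 / p)"
proof -
  let ?N = "CARD('n)"
  have cI: "countable I" by simp
  have W1: "is_weight w1" and W2: "is_weight w2" using w1 w2 by (auto simp: muckenhoupt_def)
  note [measurable] = is_weight_measurable[OF W1] is_weight_measurable[OF W2]
  obtain C1 where C1: "avg_cond q1 w1 C1" using muckenhoupt_imp_avg_cond[OF w1 q1] .
  obtain C2 where C2: "avg_cond q2 w2 C2" using muckenhoupt_imp_avg_cond[OF w2 q2(1)] .
  \<comment> \<open>The weak type estimate takes place at the exponent q, the growth of w2 at the
    exponent q2; both conditions are kept.\<close>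
  obtain C0 where C0: "avg_cond q w2 C0" using avg_cond_mono[OF C2 q2 W2] .
  have C0_pos: "0 < C0" and C1_pos: "0 < C1" and C2_pos: "0 < C2" using C0 C1 C2 by (auto simp: avg_cond_def)
  have qpos: "0 < q" "0 < q1" "0 < q2" using q q1 q2 by auto
  \<comment> \<open>\<alpha> is nonnegative because q2 \<le> q; hence u is nondecreasing.\<close>
  have "0 \<le> \<alpha> * q1" unfolding \<alpha> using q q2 by simp
  then have \<alpha>0: "0 \<le> \<alpha>" using qpos by (simp add: zero_le_mult_iff)
  define \<omega> where "\<omega> = unit_ball_vol (real ?N)"
  have \<omega>: "0 < \<omega>" by (simp add: \<omega>_def)
  define b1 where "b1 k = ball_weight w1 k" for k
  define b2 where "b2 k = ball_weight w2 k" for k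
  have b1: "0 < b1 k" for k unfolding b1_def by (rule ball_weight_pos[OF C1 qpos(2) W1])
  have b2: "0 < b2 k" for k unfolding b2_def by (rule ball_weight_pos[OF C2 qpos(3) W2])
  define s where "s = \<alpha> / real ?N"
  have s0: "0 \<le> s" using \<alpha>0 by (simp add: s_def)
  define u where "u k = b1 k powr s" for k
  define v where "v k = b2 k powr (1 / q)" for k
  define K1 where "K1 = C1 * (2 ^ ?N / \<omega>) powr q1"
  define K2 where "K2 = C2 * (2 ^ ?N / \<omega>) powr q2"
  have K: "0 < K1" "0 < K2" using C1_pos C2_pos \<omega> by (auto simp: K1_def K2_def)
  define E where "E = K1 powr s * K2 powr (1 / q)"
  have E: "0 < E" using K by (simp add: E_def)
  define D where "D = max 1 ((K1 * (2 ^ ?N) powr q1) powr s)"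
  have D: "1 \<le> D" by (simp add: D_def)
  have u_pos: "0 < u k" for k using b1[of k] by (simp add: u_def)
  have v_pos: "0 < v k" for k using b2[of k] by (simp add: v_def)
  have u_mono: "u i \<le> u k" if "i \<le> k" for i k
    unfolding u_def using b1[of i] s0 ball_weight_mono[OF W1 that] by (intro powr_mono2) (auto simp: b1_def)
  have u_dbl: "u k \<le> D * u (k - 1)" for k
  proof -
    have "b1 k \<le> K1 * ((2 powi (k - (k - 1))) ^ ?N) powr q1 * b1 (k - 1)"
      unfolding b1_def K1_def \<omega>_def by (rule ball_weight_growth[OF C1 qpos(2) W1]) simp
    then have "u k \<le> (K1 * (2 ^ ?N) powr q1 * b1 (k - 1)) powr s"
      unfolding u_def using b1[of k] s0 by (intro powr_mono2) auto
    also have "\<dots> = (K1 * (2 ^ ?N) powr q1) powr s * u (k - 1)" by (simp add: u_def powr_mult)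
    also have "\<dots> \<le> D * u (k - 1)" using u_pos[of "k - 1"] by (intro mult_right_mono) (auto simp: D_def)
    finally show ?thesis .
  qed
  \<comment> \<open>The growth exponents of the two weights add up to q1 \<alpha> / n + q2 / q = 1,
    which is the hypothesis on \<alpha>.\<close>
  have uv: "u k * v k \<le> E * (2 powi (k - i)) ^ ?N * (u i * v i)" if "i \<le> k" for i k
  proof -
    define P :: real where "P = (2 powi (k - i)) ^ ?N"
    have P: "0 < P" by (simp add: P_def)
    have "b1 k \<le> K1 * P powr q1 * b1 i"
      unfolding b1_def K1_def \<omega>_def P_def by (rule ball_weight_growth[OF C1 qpos(2) W1 that])
    then have "u k \<le> (K1 * P powr q1 * b1 i) powr s"
      unfolding u_def using b1[of k] s0 by (intro powr_mono2) auto
    moreover have "b2 k \<le> K2 * P powr q2 * b2 i"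
      unfolding b2_def K2_def \<omega>_def P_def by (rule ball_weight_growth[OF C2 qpos(3) W2 that])
    then have "v k \<le> (K2 * P powr q2 * b2 i) powr (1 / q)"
      unfolding v_def using b2[of k] qpos by (intro powr_mono2) auto
    ultimately have "u k * v k \<le> (K1 * P powr q1 * b1 i) powr s * (K2 * P powr q2 * b2 i) powr (1 / q)"
      using v_pos[of k] by (intro mult_mono) auto
    also have "\<dots> = E * (P powr (q1 * s) * P powr (q2 / q)) * (u i * v i)"
      by (simp add: powr_mult powr_powr E_def u_def v_def)
    also have "P powr (q1 * s) * P powr (q2 / q) = P"
    proof -
      have "q1 * s = 1 - q2 / q" using \<alpha> by (simp add: s_def field_simps)
      then show ?thesis using P by (simp flip: powr_add)
    qed
    finally show ?thesis by (simp add: P_def)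
  qed
  obtain \<delta>0 where \<delta>0: "0 < \<delta>0" "\<delta>0 < 1" "\<And>i k. i \<le> k \<Longrightarrow> b2 i \<le> \<delta>0 ^ nat (k - i) * b2 k"
    unfolding b2_def using ball_weight_reverse_doubling[OF C2 qpos(3) W2] by blast
  define \<delta> where "\<delta> = \<delta>0 powr (1 / q)"
  have \<delta>: "0 < \<delta>" "\<delta> < 1" unfolding \<delta>_def using \<delta>0 qpos powr_less_mono2[of "1 / q" \<delta>0 1] by auto
  have v_dec: "v i \<le> \<delta> ^ nat (k - i) * v k" if "i \<le> k" for i k
  proof -
    have "v i \<le> (\<delta>0 ^ nat (k - i) * b2 k) powr (1 / q)"
      unfolding v_def using \<delta>0(3)[OF that] b2[of i] qpos by (intro powr_mono2) auto
    also have "\<dots> = (\<delta>0 ^ nat (k - i)) powr (1 / q) * v k" by (simp only: powr_mult v_def)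
    also have "(\<delta>0 ^ nat (k - i)) powr (1 / q) = \<delta> ^ nat (k - i)"
      using \<delta>0 by (simp add: \<delta>_def powr_realpow[symmetric] powr_powr)
    finally show ?thesis .
  qed
  have v_powr: "v k powr q = b2 k" for k using b2[of k] qpos by (simp add: v_def powr_powr)
  let ?K = "4 * 2 ^ ?N :: real" and ?R = "real ?N + 1"
  \<comment> \<open>The constants of the locale do not involve the family. The zero family gives
    access to them before f, and with it the actual family, is known.\<close>
  interpret Z: adapted_family \<beta> ?K ?R "\<lambda>Q x. 0"
    by (intro adapted_familyI \<beta> adapted_zero) auto
  define cw where "cw = Z.weak_const TYPE('n) q C0"
  define far where "far = Z.far_const TYPE('n)"
  define cd where "cd = discretisation_const ?N"
  have cw: "0 < cw"
    unfolding cw_def by (rule Z.weighted_weak_type(2)[OF C0 qpos(1) W2, of "\<lambda>y. 0" 0 1]) auto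
  have far: "0 \<le> far" unfolding far_def by (rule Z.far_const_nonneg)
  have cd: "0 < cd" by (simp add: cd_def discretisation_const_def)
  define cJ where "cJ = C0 powr (1 / q) * 2 ^ ?N"
  have cJ: "0 < cJ" using C0_pos by (simp add: cJ_def)
  \<comment> \<open>\<open>ca\<close> turns the weak type bound at the level
    \<open>\<sigma>\<^sup>2 / (4 * cd)\<close> into one at \<sigma>. \<open>cb\<close> is such that
    a far sum of at most \<open>\<sigma> / cb\<close> keeps the far part at or below that level;
    adding 1 to \<open>far\<close> avoids a zero denominator.\<close>
  define ca where "ca = cw * (4 * cd) powr (q / 2)"
  define cb where "cb = sqrt (4 * cd * (far + 1)) * (4 ^ ?N * cJ)"
  have ca: "0 < ca" using cw cd by (simp add: ca_def)
  have cb: "0 < cb" using cd far cJ by (simp add: cb_def)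
  define M where "M = 3 * D powr p * ca powr (p / q) + ((2 * cb * E) powr p + (2 * cb) powr p) / (1 - \<delta> powr p)"
  have dp: "\<delta> powr p < 1" using \<delta> p powr_less_mono2[of p \<delta> 1] by auto
  have M: "0 < M" unfolding M_def using D ca cb E dp by (intro add_pos_nonneg) auto
  show ?thesis
  proof (intro exI[of _ "M powr (1 / p)"] conjI allI impI)
    show "0 < M powr (1 / p)" using M by simp
    fix f :: "real ^ 'n \<Rightarrow> complex"
    assume f [measurable]: "f \<in> borel_measurable lebesgue"
      and norm_fin: "epowr (herz_sum \<alpha> p q w1 w2 f) (1 / p) < \<infinity>"
    have fin: "herz_sum \<alpha> p q w1 w2 f < \<infinity>"
      using norm_fin p by (cases "herz_sum \<alpha> p q w1 w2 f") (auto simp: epowr_top)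
    define A where "A i = (\<integral>\<^sup>+x. ennreal (norm (f x * indicator (S i) x) powr q) * ennreal (w2 x) \<partial>lebesgue)" for i
    define F where "F i = enn2real (epowr (A i) (1 / q))" for i
    have w1_Bk: "epowr (wmeas w1 (Bk k)) (\<alpha> * p / real ?N) = ennreal (u k powr p)" for k
      using b1[of k] unfolding wmeas_Bk[OF W1] b1_def[symmetric]
      by (simp add: epowr_ennreal u_def s_def powr_powr)
    have sum_eq: "herz_sum \<alpha> p q w1 w2 f = (\<integral>\<^sup>+k. ennreal (u k powr p) * epowr (epowr (A k) (1 / q)) p \<partial>count_space I)"
      unfolding herz_sum_def w1_Bk Lq_norm_def A_def ..
    have A_fin: "epowr (A i) (1 / q) = ennreal (F i)" if i: "i \<in> I" for i
    proof -
      have "ennreal (u i powr p) * epowr (epowr (A i) (1 / q)) p \<le> herz_sum \<alpha> p q w1 w2 f"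
        unfolding sum_eq by (rule nn_integral_ge_point) fact
      also note fin
      finally have "epowr (A i) (1 / q) \<noteq> top"
        using p u_pos[of i] by (auto simp: epowr_top ennreal_mult_top)
      then show ?thesis by (simp add: F_def less_top)
    qed
    have F0: "0 \<le> F i" for i by (simp add: F_def)
    have A_eq: "A i = ennreal (F i powr q)" if i: "i \<in> I" for i
    proof -
      have "A i = epowr (epowr (A i) (1 / q)) q" using qpos by (simp add: epowr_epowr)
      also have "\<dots> = ennreal (F i powr q)" unfolding A_fin[OF i] using F0 qpos by (simp add: epowr_ennreal_nonneg)
      finally show ?thesis .
    qed
    have sum_F: "herz_sum \<alpha> p q w1 w2 f = (\<integral>\<^sup>+k. ennreal ((u k * F k) powr p) \<partial>count_space I)"
      unfolding sum_eq
    proof (rule nn_integral_cong)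
      fix k assume "k \<in> space (count_space I)"
      then show "ennreal (u k powr p) * epowr (epowr (A k) (1 / q)) p = ennreal ((u k * F k) powr p)"
        using A_fin[of k] F0[of k] p by (simp add: epowr_ennreal_nonneg powr_mult ennreal_mult)
    qed
    define H where "H = enn2real (herz_sum \<alpha> p q w1 w2 f) powr (1 / p)"
    have H0: "0 \<le> H" by (simp add: H_def)
    have H: "herz_sum \<alpha> p q w1 w2 f = ennreal (H powr p)"
      using fin p by (simp add: H_def powr_powr)
    then have H_norm: "epowr (herz_sum \<alpha> p q w1 w2 f) (1 / p) = ennreal H"
      using p H0 by (simp add: epowr_ennreal_nonneg powr_powr)
    have sum_H: "(\<integral>\<^sup>+k. ennreal ((u k * F k) powr p) \<partial>count_space I) \<le> ennreal (H powr p)"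
      using H sum_F by simp
    have sumH: "(\<integral>\<^sup>+i. ennreal (u i * F i) \<partial>count_space I) \<le> ennreal H"
      by (rule nn_integral_le_epowr[OF cI _ p sum_H H0]) (simp add: less_imp_le[OF u_pos] F0)
    have J: "mass f (S i) \<le> ennreal (cJ * ((2 powi i) ^ ?N * (F i / v i)))" if i: "i \<in> I" for i
      unfolding cJ_def v_def b2_def
      by (rule local_integral_bound[OF C0 qpos(1) W2 f S_meas[OF i] S_sub[OF i] A_eq[OF i, unfolded A_def] F0])
    \<comment> \<open>Local integrability is derived from the Herz norm, since in the homogeneous
      case \<open>Lq_loc\<close> gives no control near 0. The pieces up to index k are summed by
      means of \<open>uv\<close> and the embedding of l^p into l^1.\<close>
    have loc: "mass f (cball c r) < \<infinity>" for c r
    proof -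
      obtain m :: nat where m: "norm c + r < real m" using reals_Archimedean2 by blast
      obtain k where k: "k \<in> I" "int m \<le> k" using S_large by blast
      have "real m \<le> 2 ^ m" by (simp add: less_imp_le of_nat_less_two_power)
      also have "(2::real) ^ m = 2 powi int m" by simp
      also have "\<dots> \<le> 2 powi k" using k by (intro power_int_increasing) auto
      finally have "cball c r \<subseteq> Bk k"
        using m unfolding Bk_eq_cball by (auto simp: cball_subset_cball_iff)
      then have "mass f (cball c r) \<le> mass f (Bk k)"
        by (intro nn_integral_mono) (auto simp: indicator_def)
      also have "\<dots> \<le> (\<integral>\<^sup>+i. mass f (S i \<inter> Bk k) \<partial>count_space I)"
        by (rule nn_integral_cover) measurable
      also have "\<dots> \<le> (\<integral>\<^sup>+i. ennreal (cJ * (E * (2 powi k) ^ ?N / (u k * v k))) * ennreal (u i * F i) \<partial>count_space I)"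
      proof (rule nn_integral_mono)
        fix i assume "i \<in> space (count_space I)"
        then have i: "i \<in> I" by simp
        show "mass f (S i \<inter> Bk k) \<le> ennreal (cJ * (E * (2 powi k) ^ ?N / (u k * v k))) * ennreal (u i * F i)"
        proof (cases "i \<le> k")
          case True
          have "mass f (S i \<inter> Bk k) \<le> mass f (S i)"
            by (intro nn_integral_mono) (auto simp: indicator_def)
          also note J[OF i]
          also have "cJ * ((2 powi i) ^ ?N * (F i / v i)) \<le> cJ * (E * (2 powi k) ^ ?N / (u k * v k)) * (u i * F i)"
          proof -
            have P: "(2 powi i) ^ ?N * (2 powi (k - i)) ^ ?N = ((2::real) powi k) ^ ?N"
              by (simp flip: power_mult_distrib power_int_add)
            have "(2 powi i) ^ ?N * (u k * v k) \<le> (2 powi i) ^ ?N * (E * (2 powi (k - i)) ^ ?N * (u i * v i))"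
              by (intro mult_left_mono uv True) simp
            also have "\<dots> = E * ((2 powi i) ^ ?N * (2 powi (k - i)) ^ ?N) * u i * v i" by (simp only: mult_ac)
            finally have "(2 powi i) ^ ?N / v i \<le> E * (2 powi k) ^ ?N / (u k * v k) * u i"
              unfolding P using u_pos[of k] v_pos[of k] v_pos[of i] by (simp add: field_simps)
            then have "cJ * ((2 powi i) ^ ?N / v i * F i) \<le> cJ * (E * (2 powi k) ^ ?N / (u k * v k) * u i * F i)"
              using cJ F0 by (intro mult_left_mono mult_right_mono) auto
            then show ?thesis by (simp add: mult_ac)
          qed
          finally show ?thesis
            using u_pos[of k] v_pos[of k] u_pos[of i] F0[of i] cJ E
            by (simp add: ennreal_leI flip: ennreal_mult)
        next
          case False
          then have "S i \<inter> Bk k = {}" using S_low[OF i k(1)] by auto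
          then show ?thesis by simp
        qed
      qed
      also have "\<dots> = ennreal (cJ * (E * (2 powi k) ^ ?N / (u k * v k))) * (\<integral>\<^sup>+i. ennreal (u i * F i) \<partial>count_space I)"
        by (rule nn_integral_cmult) simp
      also have "\<dots> < \<infinity>"
        using sumH by (auto simp: ennreal_mult_less_top intro: le_less_trans)
      finally show ?thesis .
    qed
    show "(\<lambda>x. enn2ereal (intrinsic_square \<beta> f x)) \<in> borel_measurable lebesgue"
      by (rule measurable_intrinsic_square[OF f loc \<beta>])
    show "(SUP \<sigma>\<in>{0<..}. ennreal \<sigma> *
        epowr (weak_herz_sum \<alpha> p q w1 w2 (\<lambda>x. enn2ereal (intrinsic_square \<beta> f x)) \<sigma>) (1 / p))
      \<le> ennreal (M powr (1 / p)) * epowr (herz_sum \<alpha> p q w1 w2 f) (1 / p)"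
    proof (rule SUP_least)
      fix \<sigma> :: real assume "\<sigma> \<in> {0<..}"
      then have \<sigma>: "0 < \<sigma>" by simp
      obtain \<phi> where \<phi>: "adapted_family \<beta> ?K ?R \<phi>"
        and dom: "\<And>x. area_integral \<beta> f x \<le> ennreal cd * adapted_family.square_sum ?R \<phi> f x"
        using area_integral_le_square_sum[OF \<beta> f loc] unfolding cd_def by blast
      interpret adapted_family \<beta> ?K ?R \<phi> by (rule \<phi>)
      define e where "e k = wmeas w2 {x \<in> S k. \<bar>enn2ereal (intrinsic_square \<beta> f x)\<bar> > ereal \<sigma>}" for k
      \<comment> \<open>\<open>\<sigma>\<^sup>2\<close> equals \<open>cd * (2 * t + 2 * t)\<close>:
        if the near and the far part are both at most t, the square function is at most
        \<sigma>.\<close>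
      define t where "t = \<sigma>\<^sup>2 / (4 * cd)"
      have t: "0 < t" using \<sigma> cd by (simp add: t_def)
      have e_le: "e k \<le> ennreal (ca * \<sigma> powr (- q)) * ennreal (\<Sum>i\<in>I \<inter> {k-1..k+1}. F i powr q)
        + (if ennreal (\<sigma> / cb) < (\<integral>\<^sup>+i. ennreal ((2 powi (i - max i k)) ^ ?N * (F i / v i)) \<partial>count_space I)
           then ennreal (v k powr q) else 0)" if k: "k \<in> I" for k
      proof -
        let ?near = "I \<inter> {k-1..k+1}"
        define Nr where "Nr = (\<Union>i\<in>?near. S i)"
        define Fr where "Fr = (\<Union>i\<in>I - ?near. S i)"
        have [measurable]: "Nr \<in> sets lebesgue" "Fr \<in> sets lebesgue"
          unfolding Nr_def Fr_def by (auto intro: sets_UN_S)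
        let ?n = "\<lambda>y. f y * indicator Nr y" and ?f = "\<lambda>y. f y * indicator Fr y"
        define T where "T = (\<integral>\<^sup>+i. ennreal ((2 powi (i - max i k)) ^ ?N * (F i / v i)) \<partial>count_space I)"
        have AE_split: "AE y in lebesgue. f y = ?n y + ?f y"
          using S_cover
        proof eventually_elim
          fix y assume "\<exists>i\<in>I. y \<in> S i"
          then obtain i where i: "i \<in> I" "y \<in> S i" by blast
          have uniq: "j = i" if "j \<in> I" "y \<in> S j" for j
            using S_disj i that unfolding disjoint_family_on_def by blast
          show "f y = ?n y + ?f y"
          proof (cases "i \<in> ?near")
            case True
            then have "y \<in> Nr" using i unfolding Nr_def by blast
            moreover have "y \<notin> Fr" using uniq True unfolding Fr_def by blast
            ultimately show ?thesis by simp
          next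
            case False
            then have "y \<in> Fr" using i unfolding Fr_def by blast
            moreover have "y \<notin> Nr" using uniq False unfolding Nr_def by blast
            ultimately show ?thesis by simp
          qed
        qed
        have Nr_sub: "Nr \<subseteq> cball 0 (2 powi (k + 1))"
        proof
          fix y assume "y \<in> Nr"
          then obtain i where i: "i \<in> I" "i \<le> k + 1" "y \<in> S i" by (auto simp: Nr_def)
          then have "norm y \<le> 2 powi i" using S_sub by (auto simp: Bk_def)
          also have "\<dots> \<le> 2 powi (k + 1)" using i by (intro power_int_increasing) auto
          finally show "y \<in> cball 0 (2 powi (k + 1))" by simp
        qed
        have int_n: "integrable lebesgue ?n"
        proof (rule integrableI_bounded)
          have "(\<integral>\<^sup>+y. ennreal (norm (?n y)) \<partial>lebesgue) \<le> mass f (cball 0 (2 powi (k + 1)))"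
            using Nr_sub by (intro nn_integral_mono) (auto simp: indicator_def)
          also have "\<dots> < \<infinity>" by (rule loc)
          finally show "(\<integral>\<^sup>+y. ennreal (norm (?n y)) \<partial>lebesgue) < \<infinity>" .
        qed measurable
        have weak: "wmeas w2 {x. ennreal t < square_sum ?n x} \<le> ennreal (ca * \<sigma> powr (- q)) * ennreal (\<Sum>i\<in>?near. F i powr q)"
        proof -
          have "wmeas w2 {x. ennreal t < square_sum ?n x} \<le> ennreal (cw * t powr (- q / 2)) *
              (\<integral>\<^sup>+x. ennreal (norm (?n x) powr q) * ennreal (w2 x) \<partial>lebesgue)"
            unfolding cw_def
          proof (rule weighted_weak_type(1)[OF C0 qpos(1) W2 int_n _ t])
            fix y assume "?n y \<noteq> 0"
            then have "y \<in> Nr" by (auto simp: indicator_def split: if_splits)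
            then show "norm y \<le> 2 powi (k + 1)" using Nr_sub by auto
          qed
          also have "cw * t powr (- q / 2) = ca * \<sigma> powr (- q)"
          proof -
            have "t powr (- q / 2) = (\<sigma>\<^sup>2) powr (- q / 2) / (4 * cd) powr (- q / 2)"
              unfolding t_def by (rule powr_divide)
            also have "(\<sigma>\<^sup>2) powr (- q / 2) = \<sigma> powr (- q)"
              using \<sigma> by (simp add: powr_powr flip: powr_numeral)
            also have "\<sigma> powr (- q) / (4 * cd) powr (- q / 2) = \<sigma> powr (- q) * (4 * cd) powr (q / 2)"
              by (simp add: powr_minus_divide)
            finally show ?thesis by (simp add: ca_def)
          qed
          also have "(\<integral>\<^sup>+x. ennreal (norm (?n x) powr q) * ennreal (w2 x) \<partial>lebesgue) \<le> (\<integral>\<^sup>+x. (\<Sum>i\<in>?near. ennreal (norm (f x * indicator (S i) x) powr q) * ennreal (w2 x)) \<partial>lebesgue)"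
          proof (rule nn_integral_mono)
            fix x
            show "ennreal (norm (?n x) powr q) * ennreal (w2 x) \<le> (\<Sum>i\<in>?near. ennreal (norm (f x * indicator (S i) x) powr q) * ennreal (w2 x))"
            proof (cases "x \<in> Nr")
              case True
              then obtain i where i: "i \<in> ?near" "x \<in> S i" by (auto simp: Nr_def)
              have "ennreal (norm (?n x) powr q) * ennreal (w2 x) = ennreal (norm (f x * indicator (S i) x) powr q) * ennreal (w2 x)"
                using i True by simp
              also have "\<dots> \<le> (\<Sum>i\<in>?near. ennreal (norm (f x * indicator (S i) x) powr q) * ennreal (w2 x))"
                using i by (intro member_le_sum) auto
              finally show ?thesis .
            qed simp
          qed
          also have "\<dots> = (\<Sum>i\<in>?near. A i)"
            unfolding A_def using S_meas by (intro nn_integral_sum) auto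
          also have "\<dots> = (\<Sum>i\<in>?near. ennreal (F i powr q))" by (intro sum.cong refl A_eq) simp
          also have "\<dots> = ennreal (\<Sum>i\<in>?near. F i powr q)" by (rule sum_ennreal) simp
          finally show ?thesis by (simp add: mult_left_mono)
        qed
        \<comment> \<open>Pieces not adjacent to k lie at distance at least 2^max(i, k) / 4 from x,
          so \<open>square_sum_far\<close> bounds the far part by a multiple of the square of
          T.\<close>
        have far_bound: "ennreal (\<sigma> / cb) < T" if x: "x \<in> S k" and big: "ennreal t < square_sum ?f x" for x
        proof (rule ccontr)
          assume "\<not> ?thesis"
          then have T_le: "T \<le> ennreal (\<sigma> / cb)" by simp
          have "square_sum ?f x \<le> ennreal far * (\<integral>\<^sup>+i. ennreal (1 / (2 powi max i k / 4) ^ ?N) *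
              mass ?f (S i) \<partial>count_space (I - ?near))\<^sup>2"
            unfolding far_def
          proof (rule square_sum_far)
            fix y assume "?f y \<noteq> 0"
            then have "y \<in> Fr" by (auto simp: indicator_def split: if_splits)
            then show "\<exists>i\<in>I - ?near. y \<in> S i" by (auto simp: Fr_def)
          next
            fix i y assume "i \<in> I - ?near" "y \<in> S i"
            then show "2 powi max i k / 4 \<le> dist x y" using S_sep[of i k x y] k x by auto
          qed (use S_meas in auto)
          also have "\<dots> \<le> ennreal far * (ennreal (4 ^ ?N * cJ) * T)\<^sup>2"
          proof (intro mult_left_mono power_mono)
            have "(\<integral>\<^sup>+i. ennreal (1 / (2 powi max i k / 4) ^ ?N) * mass ?f (S i) \<partial>count_space (I - ?near))
                \<le> (\<integral>\<^sup>+i. ennreal (4 ^ ?N * cJ) * ennreal ((2 powi (i - max i k)) ^ ?N * (F i / v i)) \<partial>count_space (I - ?near))"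
            proof (rule nn_integral_mono)
              fix i assume "i \<in> space (count_space (I - ?near))"
              then have i: "i \<in> I" by simp
              have "mass ?f (S i) \<le> mass f (S i)"
                by (intro nn_integral_mono) (auto simp: indicator_def)
              also note J[OF i]
              finally have "ennreal (1 / (2 powi max i k / 4) ^ ?N) * mass ?f (S i)
                  \<le> ennreal (1 / (2 powi max i k / 4) ^ ?N) * ennreal (cJ * ((2 powi i) ^ ?N * (F i / v i)))"
                by (rule mult_left_mono) simp
              also have "\<dots> = ennreal (1 / (2 powi max i k / 4) ^ ?N * (cJ * ((2 powi i) ^ ?N * (F i / v i))))"
                using cJ F0[of i] v_pos[of i] by (intro ennreal_mult[symmetric]) auto
              also have "1 / (2 powi max i k / 4) ^ ?N * (cJ * ((2 powi i) ^ ?N * (F i / v i)))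
                  = 4 ^ ?N * cJ * ((2 powi (i - max i k)) ^ ?N * (F i / v i))"
                by (simp add: power_int_diff power_divide)
              finally show "ennreal (1 / (2 powi max i k / 4) ^ ?N) * mass ?f (S i)
                  \<le> ennreal (4 ^ ?N * cJ) * ennreal ((2 powi (i - max i k)) ^ ?N * (F i / v i))"
                using cJ F0[of i] v_pos[of i] by (simp flip: ennreal_mult)
            qed
            also have "\<dots> = ennreal (4 ^ ?N * cJ) * (\<integral>\<^sup>+i. ennreal ((2 powi (i - max i k)) ^ ?N * (F i / v i)) \<partial>count_space (I - ?near))"
              by (rule nn_integral_cmult) simp
            also have "\<dots> \<le> ennreal (4 ^ ?N * cJ) * T"
              unfolding T_def by (intro mult_left_mono nn_integral_count_space_mono_set) auto
            finally show "(\<integral>\<^sup>+i. ennreal (1 / (2 powi max i k / 4) ^ ?N) * mass ?f (S i) \<partial>count_space (I - ?near))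
                \<le> ennreal (4 ^ ?N * cJ) * T" .
          qed auto
          also have "\<dots> \<le> ennreal far * (ennreal (4 ^ ?N * cJ) * ennreal (\<sigma> / cb))\<^sup>2"
            by (intro mult_left_mono power_mono T_le) auto
          also have "\<dots> = ennreal (far * (4 ^ ?N * cJ * (\<sigma> / cb))\<^sup>2)"
            using far cJ \<sigma> cb by (simp add: ennreal_power flip: ennreal_mult)
          also have "\<dots> \<le> ennreal t"
          proof (rule ennreal_leI)
            have "4 ^ ?N * cJ * (\<sigma> / cb) = \<sigma> / sqrt (4 * cd * (far + 1))"
              using cJ by (simp add: cb_def)
            then have "far * (4 ^ ?N * cJ * (\<sigma> / cb))\<^sup>2 = far * (\<sigma>\<^sup>2 / (4 * cd * (far + 1)))"
              using cd far by (simp add: power_divide)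
            also have "\<dots> = far / (far + 1) * t" using cd far by (simp add: t_def)
            also have "\<dots> \<le> 1 * t" using far t by (intro mult_right_mono) auto
            finally show "far * (4 ^ ?N * cJ * (\<sigma> / cb))\<^sup>2 \<le> t" by simp
          qed
          finally show False using big by simp
        qed
        \<comment> \<open>T does not depend on x, so when the far part may exceed t somewhere, all
          of \<open>S k\<close> is counted; its weight is at most \<open>v k powr q\<close>.\<close>
        have sub: "{x \<in> S k. \<bar>enn2ereal (intrinsic_square \<beta> f x)\<bar> > ereal \<sigma>}
            \<subseteq> {x. ennreal t < square_sum ?n x} \<union> (if ennreal (\<sigma> / cb) < T then S k else {})"
        proof
          fix x assume "x \<in> {x \<in> S k. \<bar>enn2ereal (intrinsic_square \<beta> f x)\<bar> > ereal \<sigma>}"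
          then have x: "x \<in> S k" and "ennreal (\<sigma>\<^sup>2) < area_integral \<beta> f x"
            using level_intrinsic_square[OF \<sigma>] by auto
          note this(2)
          also have "area_integral \<beta> f x \<le> ennreal cd * (2 * square_sum ?n x + 2 * square_sum ?f x)"
            by (rule order_trans[OF dom]) (intro mult_left_mono square_sum_split[OF f loc _ _ AE_split] zero_le; measurable)
          finally have lt: "ennreal (\<sigma>\<^sup>2) < ennreal cd * (2 * square_sum ?n x + 2 * square_sum ?f x)" .
          have "ennreal t < square_sum ?n x \<or> ennreal t < square_sum ?f x"
          proof (rule ccontr)
            assume "\<not> ?thesis"
            then have "square_sum ?n x \<le> ennreal t" "square_sum ?f x \<le> ennreal t" by auto
            then have "ennreal cd * (2 * square_sum ?n x + 2 * square_sum ?f x) \<le> ennreal cd * (2 * ennreal t + 2 * ennreal t)"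
              by (intro mult_left_mono add_mono) auto
            also have "\<dots> = ennreal cd * ennreal (4 * t)"
            proof -
              have "2 * ennreal t + 2 * ennreal t = ennreal (2 * t + 2 * t)"
                using t by (simp only: ennreal_plus[of "2 * t" "2 * t"] ennreal_mult) (simp add: ennreal_mult)
              then show ?thesis by simp
            qed
            also have "\<dots> = ennreal (\<sigma>\<^sup>2)" using cd t by (simp add: t_def flip: ennreal_mult)
            finally show False using lt by simp
          qed
          then show "x \<in> {x. ennreal t < square_sum ?n x} \<union> (if ennreal (\<sigma> / cb) < T then S k else {})"
            using far_bound[OF x] x by auto
        qed
        have "e k \<le> wmeas w2 {x. ennreal t < square_sum ?n x} + wmeas w2 (if ennreal (\<sigma> / cb) < T then S k else {})"
          unfolding e_def using sub S_meas[OF k] open_square_sum_level[of "ennreal t" ?n]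
          by (intro wmeas_Un_le[OF W2]) auto
        also have "wmeas w2 (if ennreal (\<sigma> / cb) < T then S k else {}) \<le> (if ennreal (\<sigma> / cb) < T then ennreal (v k powr q) else 0)"
          unfolding v_powr b2_def wmeas_Bk[OF W2, symmetric] using wmeas_mono[OF S_sub[OF k], of w2]
          by (auto simp: wmeas_def)
        finally show ?thesis using weak unfolding T_def by (auto intro: order_trans add_right_mono)
      qed
      have "weak_herz_sum \<alpha> p q w1 w2 (\<lambda>x. enn2ereal (intrinsic_square \<beta> f x)) \<sigma>
          = (\<integral>\<^sup>+k. ennreal (u k powr p) * epowr (e k) (p / q) \<partial>count_space I)"
        unfolding weak_herz_sum_def w1_Bk e_def ..
      also have "\<dots> \<le> ennreal (M * (H / \<sigma>) powr p)"
        unfolding M_def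
        by (rule herz_weak_sum[OF p q \<sigma> H0 less_imp_le[OF ca] cb E D \<delta> u_pos u_mono u_dbl v_pos v_dec uv F0 sum_H e_le])
      finally have "epowr (weak_herz_sum \<alpha> p q w1 w2 (\<lambda>x. enn2ereal (intrinsic_square \<beta> f x)) \<sigma>) (1 / p)
          \<le> epowr (ennreal (M * (H / \<sigma>) powr p)) (1 / p)"
        using p by (intro epowr_mono) auto
      also have "\<dots> = ennreal (M powr (1 / p) * (H / \<sigma>))"
        using M p H0 \<sigma> by (simp add: epowr_ennreal_nonneg powr_mult powr_powr)
      finally have "ennreal \<sigma> * epowr (weak_herz_sum \<alpha> p q w1 w2 (\<lambda>x. enn2ereal (intrinsic_square \<beta> f x)) \<sigma>) (1 / p)
          \<le> ennreal \<sigma> * ennreal (M powr (1 / p) * (H / \<sigma>))"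
        by (rule mult_left_mono) simp
      also have "\<dots> = ennreal (M powr (1 / p)) * ennreal H"
        using \<sigma> H0 by (simp flip: ennreal_mult)
      finally show "ennreal \<sigma> * epowr (weak_herz_sum \<alpha> p q w1 w2 (\<lambda>x. enn2ereal (intrinsic_square \<beta> f x)) \<sigma>) (1 / p)
        \<le> ennreal (M powr (1 / p)) * epowr (herz_sum \<alpha> p q w1 w2 f) (1 / p)"
        unfolding H_norm .
    qed
  qed
qed

end

section \<open>Herz spaces\<close>

lemma infsum_ennreal_eq_nn_integral:
  fixes h :: "'a \<Rightarrow> ennreal"
  assumes "countable A" shows "infsum h A = (\<integral>\<^sup>+x. h x \<partial>count_space A)"
  unfolding nn_integral_count_space_eq_SUP[OF assms] by (rule nonneg_infsum_complete) simp

lemma suminf_ennreal_eq_nn_integral_int: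
  fixes h :: "int \<Rightarrow> ennreal"
  shows "(\<Sum>k. h (int k)) = (\<integral>\<^sup>+k. h k \<partial>count_space {0..})"
proof -
  have "bij_betw int UNIV {0..}"
    by (rule bij_betwI[of _ _ _ nat]) auto
  then have "(\<integral>\<^sup>+k. h (int k) \<partial>count_space UNIV) = (\<integral>\<^sup>+k. h k \<partial>count_space {0..})"
    by (rule nn_integral_bij_count_space)
  then show ?thesis
    by (simp only: nn_integral_count_space_nat)
qed

lemma mem_Ck: "x \<in> Ck k \<longleftrightarrow> 2 powi (k - 1) < norm x \<and> norm x \<le> 2 powi k"
  by (auto simp: Ck_def Bk_def)

section \<open>Geometry of the annuli\<close>

lemma separation_of_annuli:
  assumes "norm y \<le> 2 powi i" "2 powi (k - 1) < norm x" "i \<le> k - 2"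
  shows "2 powi k \<le> 4 * dist x y"
proof -
  have "2 powi i \<le> (2::real) powi (k - 2)" using assms(3) by (intro power_int_increasing) auto
  then have "norm y \<le> 2 powi k / 4" using assms(1) by (simp add: power_int_diff)
  moreover have "2 powi k / 2 < norm x" using assms(2) by (simp add: power_int_diff)
  moreover have "norm x - norm y \<le> dist x y" unfolding dist_norm by (rule norm_triangle_ineq2)
  ultimately show ?thesis by linarith
qed

lemma annulus_index_le:
  assumes "2 powi (i - 1) < norm y" "norm y \<le> (2::real) powi k" shows "i \<le> k"
proof (rule ccontr)
  assume "\<not> i \<le> k"
  then have "(2::real) powi k \<le> 2 powi (i - 1)" by (intro power_int_increasing) auto
  then show False using assms by linarith
qed

lemma exists_annulus:
  fixes r :: real
  assumes "0 < r" shows "\<exists>k. 2 powi (k - 1) < r \<and> r \<le> 2 powi k"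
proof -
  define k where "k = \<lceil>log 2 r\<rceil>"
  have "2 powr (real_of_int k - 1) < 2 powr log 2 r" unfolding k_def by (intro powr_less_mono) linarith+
  moreover have "2 powr log 2 r \<le> 2 powr real_of_int k" unfolding k_def by (intro powr_mono) auto
  moreover have "(2::real) powi (k - 1) = 2 powr (real_of_int k - 1)" "(2::real) powi k = 2 powr real_of_int k"
    by (simp_all add: powr_real_of_int'[symmetric])
  ultimately show ?thesis using assms by (intro exI[of _ k]) simp
qed

lemma sets_Ck [simp]: "Ck k \<in> sets lebesgue"
  by (simp add: Ck_def)

lemma herz_sets_homogeneous: "herz_sets UNIV (Ck :: int \<Rightarrow> (real ^ 'n) set)"
proof
  show "disjoint_family_on (Ck :: int \<Rightarrow> (real ^ 'n) set) UNIV"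
    unfolding disjoint_family_on_def
  proof (intro ballI impI)
    fix i j :: int assume "i \<noteq> j"
    show "Ck i \<inter> Ck j = ({} :: (real ^ 'n) set)"
    proof (rule ccontr)
      assume "\<not> ?thesis"
      then obtain x :: "real ^ 'n" where "x \<in> Ck i" "x \<in> Ck j" by blast
      then have "i \<le> j" "j \<le> i" by (auto simp: mem_Ck intro: annulus_index_le)
      then show False using \<open>i \<noteq> j\<close> by simp
    qed
  qed
  \<comment> \<open>The origin is the only point outside all annuli.\<close>
  have "AE y in lebesgue. y \<noteq> (0 :: real ^ 'n)"
    by (intro AE_completion AE_lborel_singleton)
  then show "AE y in lebesgue. \<exists>i\<in>UNIV. y \<in> (Ck i :: (real ^ 'n) set)"
  proof eventually_elim
    fix y :: "real ^ 'n" assume "y \<noteq> 0"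
    then show "\<exists>i\<in>UNIV. y \<in> Ck i" using exists_annulus[of "norm y"] by (simp add: mem_Ck)
  qed
  fix i k :: int and x y :: "real ^ 'n"
  show "2 powi max i k \<le> 4 * dist x y" if "2 \<le> \<bar>i - k\<bar>" "x \<in> Ck k" "y \<in> Ck i"
  proof (cases "i \<le> k")
    case True
    then show ?thesis using that separation_of_annuli[of y i k x] by (simp add: mem_Ck max_def)
  next
    case False
    then show ?thesis using that separation_of_annuli[of x k i y] by (simp add: mem_Ck max_def dist_commute)
  qed
  show "i \<le> k" if "y \<in> Ck i" "y \<in> Bk k"
    using that annulus_index_le[of i y k] by (simp add: mem_Ck Bk_def)
qed (auto simp: Ck_def)

lemma mem_Ck_tilde:
  "0 \<le> k \<Longrightarrow> x \<in> Ck_tilde (nat k) \<longleftrightarrow> norm x \<le> 2 powi k \<and> (0 < k \<longrightarrow> 2 powi (k - 1) < norm x)"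
  by (auto simp: Ck_tilde_def mem_Ck Bk_def)

lemma herz_sets_nonhomogeneous: "herz_sets {0..} (\<lambda>k. Ck_tilde (nat k) :: (real ^ 'n) set)"
proof
  have low: "i \<le> k" if "0 \<le> i" "0 \<le> k" "y \<in> Ck_tilde (nat i)" "norm y \<le> 2 powi k" for i k and y :: "real ^ 'n"
  proof (cases "i = 0")
    case False
    then show ?thesis using that annulus_index_le[of i y k] by (simp add: mem_Ck_tilde)
  qed (use that in simp)
  show "disjoint_family_on (\<lambda>k. Ck_tilde (nat k) :: (real ^ 'n) set) {0..}"
    unfolding disjoint_family_on_def
  proof (intro ballI impI)
    fix i j :: int assume ij: "i \<in> {0..}" "j \<in> {0..}" "i \<noteq> j"
    show "Ck_tilde (nat i) \<inter> Ck_tilde (nat j) = ({} :: (real ^ 'n) set)"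
    proof (rule ccontr)
      assume "\<not> ?thesis"
      then obtain x :: "real ^ 'n" where "x \<in> Ck_tilde (nat i)" "x \<in> Ck_tilde (nat j)" by blast
      then have "i \<le> j" "j \<le> i" using ij by (auto simp: mem_Ck_tilde intro: low)
      then show False using ij by simp
    qed
  qed
  have "\<exists>i\<in>{0..}. y \<in> Ck_tilde (nat i)" for y :: "real ^ 'n"
  proof (cases "norm y \<le> 1")
    case True
    then show ?thesis by (intro bexI[of _ 0]) (auto simp: Ck_tilde_def Bk_def)
  next
    case False
    then have "0 < norm y" by linarith
    then obtain k where k: "2 powi (k - 1) < norm y" "norm y \<le> 2 powi k"
      using exists_annulus by blast
    have "0 < k"
    proof (rule ccontr)
      assume "\<not> 0 < k"
      then have "(2::real) powi k \<le> 2 powi 0" by (intro power_int_increasing) auto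
      then show False using k False by simp
    qed
    then show ?thesis using k by (intro bexI[of _ k]) (auto simp: mem_Ck_tilde)
  qed
  then show "AE y in lebesgue. \<exists>i\<in>{0..}. y \<in> (Ck_tilde (nat i) :: (real ^ 'n) set)" by simp
  show "\<exists>k\<in>{0..}. m \<le> k" for m :: int by (rule bexI[of _ "max m 0"]) auto
  fix i k :: int and x y :: "real ^ 'n"
  assume i: "i \<in> {0..}"
  show "Ck_tilde (nat i) \<in> sets (lebesgue :: (real ^ 'n) measure)" by (simp add: Ck_tilde_def)
  show "(Ck_tilde (nat i) :: (real ^ 'n) set) \<subseteq> Bk i" using i by (auto simp: mem_Ck_tilde Bk_def)
  assume k: "k \<in> {0..}"
  \<comment> \<open>Nonnegative indices at distance at least 2 make the larger one positive, so its
    piece is a true annulus, with a lower bound on the norm.\<close>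
  show "2 powi max i k \<le> 4 * dist x y" if "2 \<le> \<bar>i - k\<bar>" "x \<in> Ck_tilde (nat k)" "y \<in> Ck_tilde (nat i)"
  proof (cases "i \<le> k")
    case True
    then show ?thesis using that i k separation_of_annuli[of y i k x] by (simp add: mem_Ck_tilde max_def)
  next
    case False
    then show ?thesis using that i k separation_of_annuli[of x k i y] by (simp add: mem_Ck_tilde max_def dist_commute)
  qed
  show "i \<le> k" if "y \<in> Ck_tilde (nat i)" "y \<in> Bk k"
    using that i k low by (simp add: Bk_def)
qed

theorem theorem1p2:
  fixes \<beta> p q \<alpha> q1 q2 :: real
    and w1 w2 :: "real ^ 'n \<Rightarrow> real"
  assumes "0 < \<beta>" "\<beta> \<le> 1"
    and "0 < p" "p \<le> 1"
    and "1 < q"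
    and "1 \<le> q1"
    and "1 \<le> q2" "q2 \<le> q"
    and "w1 \<in> muckenhoupt q1"
    and "w2 \<in> muckenhoupt q2"
    and "\<alpha> * q1 = real CARD('n) * (1 - q2 / q)"
  shows "\<exists>C>0.
    (\<forall>f \<in> herz_space_hom \<alpha> p q w1 w2.
       (\<lambda>x. enn2ereal (intrinsic_square \<beta> f x)) \<in> weak_herz_space_hom \<alpha> p q w1 w2 \<and>
       weak_herz_norm_hom \<alpha> p q w1 w2 (\<lambda>x. enn2ereal (intrinsic_square \<beta> f x))
         \<le> ennreal C * herz_norm_hom \<alpha> p q w1 w2 f) \<and>
    (\<forall>f \<in> herz_space \<alpha> p q w1 w2.
       (\<lambda>x. enn2ereal (intrinsic_square \<beta> f x)) \<in> weak_herz_space \<alpha> p q w1 w2 \<and>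
       weak_herz_norm \<alpha> p q w1 w2 (\<lambda>x. enn2ereal (intrinsic_square \<beta> f x))
         \<le> ennreal C * herz_norm \<alpha> p q w1 w2 f)"
proof -
  interpret hom: herz_sets UNIV "Ck :: int \<Rightarrow> (real ^ 'n) set" by (rule herz_sets_homogeneous)
  interpret nonhom: herz_sets "{0..}" "\<lambda>k. Ck_tilde (nat k) :: (real ^ 'n) set" by (rule herz_sets_nonhomogeneous)
  have hom_norm: "herz_norm_hom \<alpha> p q w1 w2 f = epowr (hom.herz_sum \<alpha> p q w1 w2 f) (1 / p)" for f
    unfolding herz_norm_hom_def hom.herz_sum_def by (subst infsum_ennreal_eq_nn_integral) auto
  have hom_weak: "weak_herz_norm_hom \<alpha> p q w1 w2 g
      = (SUP \<sigma>\<in>{0<..}. ennreal \<sigma> * epowr (hom.weak_herz_sum \<alpha> p q w1 w2 g \<sigma>) (1 / p))" for g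
    unfolding weak_herz_norm_hom_def hom.weak_herz_sum_def by (subst infsum_ennreal_eq_nn_integral) auto
  have nonhom_norm: "herz_norm \<alpha> p q w1 w2 f = epowr (nonhom.herz_sum \<alpha> p q w1 w2 f) (1 / p)" for f
    unfolding herz_norm_def nonhom.herz_sum_def by (subst suminf_ennreal_eq_nn_integral_int[symmetric]) simp
  have nonhom_weak: "weak_herz_norm \<alpha> p q w1 w2 g
      = (SUP \<sigma>\<in>{0<..}. ennreal \<sigma> * epowr (nonhom.weak_herz_sum \<alpha> p q w1 w2 g \<sigma>) (1 / p))" for g
    unfolding weak_herz_norm_def nonhom.weak_herz_sum_def by (subst suminf_ennreal_eq_nn_integral_int[symmetric]) simp
  obtain C where C: "0 < C" and bound: "\<And>f. f \<in> borel_measurable lebesgue \<Longrightarrow> herz_norm_hom \<alpha> p q w1 w2 f < \<infinity> \<Longrightarrow>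
      (\<lambda>x. enn2ereal (intrinsic_square \<beta> f x)) \<in> borel_measurable lebesgue \<and>
      weak_herz_norm_hom \<alpha> p q w1 w2 (\<lambda>x. enn2ereal (intrinsic_square \<beta> f x)) \<le> ennreal C * herz_norm_hom \<alpha> p q w1 w2 f"
    using hom.herz_weak_bound[OF assms] unfolding hom_norm hom_weak by blast
  obtain C' where bound': "\<And>f. f \<in> borel_measurable lebesgue \<Longrightarrow> herz_norm \<alpha> p q w1 w2 f < \<infinity> \<Longrightarrow>
      (\<lambda>x. enn2ereal (intrinsic_square \<beta> f x)) \<in> borel_measurable lebesgue \<and>
      weak_herz_norm \<alpha> p q w1 w2 (\<lambda>x. enn2ereal (intrinsic_square \<beta> f x)) \<le> ennreal C' * herz_norm \<alpha> p q w1 w2 f"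
    using nonhom.herz_weak_bound[OF assms] unfolding nonhom_norm nonhom_weak by blast
  \<comment> \<open>The two bounds come with different constants and the maximum serves both;
    finiteness of the right-hand side gives membership in the weak space.\<close>
  have enlarge: "y \<le> ennreal (max C C') * x \<and> y < \<infinity>" if "y \<le> ennreal c * x" "c \<le> max C C'" "x < \<infinity>" for x y c
  proof
    show "y \<le> ennreal (max C C') * x"
      using that(1) mult_right_mono[OF ennreal_leI[OF that(2)], of x] by (auto intro: order_trans)
    have "ennreal c * x < \<infinity>" using that(3) by (simp add: ennreal_mult_less_top)
    with that(1) show "y < \<infinity>" by (rule le_less_trans)
  qed
  show ?thesis
  proof (intro exI[of _ "max C C'"] conjI ballI)
    show "0 < max C C'" using C by simp
  next
    fix f assume "f \<in> herz_space_hom \<alpha> p q w1 w2"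
    then have f: "f \<in> borel_measurable lebesgue" "herz_norm_hom \<alpha> p q w1 w2 f < \<infinity>"
      by (auto simp: herz_space_hom_def Lq_loc_def)
    note b = bound[OF f] and e = enlarge[OF conjunct2[OF bound[OF f]] max.cobounded1 f(2)]
    show "(\<lambda>x. enn2ereal (intrinsic_square \<beta> f x)) \<in> weak_herz_space_hom \<alpha> p q w1 w2"
      using b e by (simp add: weak_herz_space_hom_def)
    show "weak_herz_norm_hom \<alpha> p q w1 w2 (\<lambda>x. enn2ereal (intrinsic_square \<beta> f x))
        \<le> ennreal (max C C') * herz_norm_hom \<alpha> p q w1 w2 f"
      using e by (rule conjunct1)
  next
    fix f assume "f \<in> herz_space \<alpha> p q w1 w2"
    then have f: "f \<in> borel_measurable lebesgue" "herz_norm \<alpha> p q w1 w2 f < \<infinity>"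
      by (auto simp: herz_space_def Lq_loc_def)
    note b = bound'[OF f] and e = enlarge[OF conjunct2[OF bound'[OF f]] max.cobounded2 f(2)]
    show "(\<lambda>x. enn2ereal (intrinsic_square \<beta> f x)) \<in> weak_herz_space \<alpha> p q w1 w2"
      using b e by (simp add: weak_herz_space_def)
    show "weak_herz_norm \<alpha> p q w1 w2 (\<lambda>x. enn2ereal (intrinsic_square \<beta> f x))
        \<le> ennreal (max C C') * herz_norm \<alpha> p q w1 w2 f"
      using e by (rule conjunct1)
  qed
qed

end
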